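(* Let $0\le k\le n$ be integers and let $D\subset\mathbb{R}^n$ be a smooth bounded domain. For any $k$-convex functions $u_0,\dots,u_k$ with $u_0=\dots=u_k=0$ on $\partial D$, $$G_k[u_0,\dots,u_k]\le\prod_{j=0}^k\big(J_k[u_j]\big)^{\frac1{k+1}}.$$
   Context: For $\lambda\in\mathbb{R}^n$, $S_k(\lambda)=\frac{k!(n-k)!}{n!}\sum_{i_1<\dots<i_k}\lambda_{i_1}\cdots\lambda_{i_k}$ is the normalized $k$-th elementary symmetric function ($S_0=1$). For a real symmetric $n\times n$ matrix $A$ with vector of eigenvalues $\lambda(A)$, $S_k(A)=S_k(\lambda(A))$. $\tilde S_k$ denotes the complete polarization of $S_k$, i.e. the symmetric $k$-linear form with $\tilde S_k(A,\dots,A)=S_k(A)$. Let $\Gamma_k=\{\lambda\in\mathbb{R}^n:S_j(\lambda)\ge0,\ j=1,\dots,k\}$. A real-valued function $u\in C^2(\bar D)$ is $k$-convex if $\lambda(\mathrm{Hess}(u))\in\Gamma_k$ at every point, where $\mathrm{Hess}(u)$ is the (real) Hessian matrix of $u$. For $u,u_0,\dots,u_k\in C^2(\bar D)$, $$G_k[u_0,\dots,u_k]=\int_D(-u_0)\,\tilde S_k\big(\mathrm{Hess}(u_1),\dots,\mathrm{Hess}(u_k)\big),\qquad J_k[u]=G_k[u,\dots,u].$$ *)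

theory Defs
  imports "HOL-Analysis.Analysis"
begin

section \<open>Symmetric functions of eigenvalues\<close>

definition S_vec :: "nat \<Rightarrow> real ^ 'n \<Rightarrow> real" where
  "S_vec k l = fact k * fact (CARD('n) - k) / fact CARD('n) *
     (\<Sum>I | card I = k. \<Prod>i\<in>I. l $ i)"

text \<open>The eigenvalues with algebraic multiplicity, in an arbitrary order. Over the reals such a
  vector need not exist for an arbitrary matrix, but it does for a symmetric one.\<close>

definition is_eigenvalue_vector :: "real ^ 'n ^ 'n \<Rightarrow> real ^ 'n \<Rightarrow> bool" where
  "is_eigenvalue_vector A l \<longleftrightarrow> (\<forall>t. det (mat t - A) = (\<Prod>i\<in>UNIV. t - l $ i))"

definition eigenvalue_vector :: "real ^ 'n ^ 'n \<Rightarrow> real ^ 'n" where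
  "eigenvalue_vector A = (SOME l. is_eigenvalue_vector A l)"

definition S_mat :: "nat \<Rightarrow> real ^ 'n ^ 'n \<Rightarrow> real" where
  "S_mat k A = S_vec k (eigenvalue_vector A)"

definition symmetric_matrices :: "(real ^ 'n ^ 'n) set" where
  "symmetric_matrices = {A. transpose A = A}"

definition Gamma_cone :: "nat \<Rightarrow> (real ^ 'n) set" where
  "Gamma_cone k = {l. \<forall>j\<in>{1..k}. 0 \<le> S_vec j l}"


section \<open>Complete polarization\<close>

text \<open>A \<open>k\<close>-linear form on symmetric matrices is a function of a sequence \<open>A\<close> of matrices that
  depends only on the arguments \<open>A 1, \<dots>, A k\<close>. These conditions determine the values
  of \<open>F\<close> on symmetric arguments uniquely.\<close>

definition is_complete_polarization ::
  "nat \<Rightarrow> (real ^ 'n ^ 'n \<Rightarrow> real) \<Rightarrow> ((nat \<Rightarrow> real ^ 'n ^ 'n) \<Rightarrow> real) \<Rightarrow> bool" where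
  "is_complete_polarization k f F \<longleftrightarrow>
     (\<forall>A B. (\<forall>i\<in>{1..k}. A i = B i) \<longrightarrow> F A = F B) \<and>
     (\<forall>A p. (\<forall>i\<in>{1..k}. A i \<in> symmetric_matrices) \<and> p permutes {1..k} \<longrightarrow> F (A \<circ> p) = F A) \<and>
     (\<forall>A. (\<forall>i\<in>{1..k}. A i \<in> symmetric_matrices) \<longrightarrow>
        (\<forall>i\<in>{1..k}. \<forall>X\<in>symmetric_matrices. \<forall>Y\<in>symmetric_matrices. \<forall>a b.
           F (A(i := a *\<^sub>R X + b *\<^sub>R Y)) = a * F (A(i := X)) + b * F (A(i := Y)))) \<and>
     (\<forall>X\<in>symmetric_matrices. F (\<lambda>_. X) = f X)"

definition S_pol :: "nat \<Rightarrow> (nat \<Rightarrow> real ^ 'n ^ 'n) \<Rightarrow> real" where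
  "S_pol k = (SOME F. is_complete_polarization k (S_mat k) F)"


section \<open>Differentiability classes and domains\<close>

definition partial :: "'n \<Rightarrow> (real ^ 'n \<Rightarrow> real) \<Rightarrow> real ^ 'n \<Rightarrow> real" where
  "partial i f x = frechet_derivative f (at x) (axis i 1)"

definition Hess :: "(real ^ 'n \<Rightarrow> real) \<Rightarrow> real ^ 'n \<Rightarrow> real ^ 'n ^ 'n" where
  "Hess u x = (\<chi> i j. partial i (partial j u) x)"

text \<open>To be used for open sets \<open>U\<close> only.\<close>

primrec Ck_on :: "nat \<Rightarrow> (real ^ 'n) set \<Rightarrow> (real ^ 'n \<Rightarrow> real) \<Rightarrow> bool" where
  "Ck_on 0 U f \<longleftrightarrow> continuous_on U f"
| "Ck_on (Suc m) U f \<longleftrightarrow> (\<forall>x\<in>U. f differentiable (at x)) \<and> (\<forall>i. Ck_on m U (partial i f))"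

definition smooth_fun_on :: "(real ^ 'n) set \<Rightarrow> (real ^ 'n \<Rightarrow> real) \<Rightarrow> bool" where
  "smooth_fun_on U f \<longleftrightarrow> (\<forall>m. Ck_on m U f)"

definition extends_to_closure :: "(real ^ 'n) set \<Rightarrow> (real ^ 'n \<Rightarrow> real) \<Rightarrow> bool" where
  "extends_to_closure D f \<longleftrightarrow> (\<exists>g. continuous_on (closure D) g \<and> (\<forall>x\<in>D. g x = f x))"

text \<open>The class \<open>C\<^sup>2\<close> on the closure of an open set \<open>D\<close>: all derivatives up to order two
  exist in \<open>D\<close> and extend continuously to the closure. The function itself is required to be
  continuous on the closure, because its boundary values matter.\<close>

definition C2_closure :: "(real ^ 'n) set \<Rightarrow> (real ^ 'n \<Rightarrow> real) \<Rightarrow> bool" where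
  "C2_closure D u \<longleftrightarrow> Ck_on 2 D u \<and> continuous_on (closure D) u \<and>
     (\<forall>i. extends_to_closure D (partial i u)) \<and>
     (\<forall>i j. extends_to_closure D (partial i (partial j u)))"

text \<open>The boundary is smooth if \<open>D\<close> is locally the sublevel set of a smooth function with
  nonvanishing gradient.\<close>

definition smooth_bounded_domain :: "(real ^ 'n) set \<Rightarrow> bool" where
  "smooth_bounded_domain D \<longleftrightarrow> D \<noteq> {} \<and> open D \<and> connected D \<and> bounded D \<and>
     (\<forall>p\<in>frontier D. \<exists>U r. open U \<and> p \<in> U \<and> smooth_fun_on U r \<and>
        (\<forall>x\<in>U. \<exists>i. partial i r x \<noteq> 0) \<and> D \<inter> U = {x\<in>U. r x < 0})"


section \<open>Hessian integrals\<close>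

definition k_convex :: "nat \<Rightarrow> (real ^ 'n) set \<Rightarrow> (real ^ 'n \<Rightarrow> real) \<Rightarrow> bool" where
  "k_convex k D u \<longleftrightarrow> C2_closure D u \<and> (\<forall>x\<in>D. eigenvalue_vector (Hess u x) \<in> Gamma_cone k)"

definition G_int :: "nat \<Rightarrow> (real ^ 'n) set \<Rightarrow> (nat \<Rightarrow> real ^ 'n \<Rightarrow> real) \<Rightarrow> real" where
  "G_int k D u = (LINT x:D|lborel. (- u 0 x) * S_pol k (\<lambda>i. Hess (u i) x))"

definition J_int :: "nat \<Rightarrow> (real ^ 'n) set \<Rightarrow> (real ^ 'n \<Rightarrow> real) \<Rightarrow> real" where
  "J_int k D u = G_int k D (\<lambda>_. u)"

end

theory Submission
  imports Defs "HOL-Computational_Algebra.Fundamental_Theorem_Algebra"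
begin

text \<open>On symmetric matrices the polarization of \<open>S\<^sub>k\<close> is the mixed discriminant with \<open>n - k\<close> of its
  \<open>n\<close> arguments equal to the identity. Since \<open>det\<close> has no zero \<open>X + i y 1\<close> with \<open>X\<close> symmetric and
  \<open>y > 0\<close>, the Gauss-Lucas theorem and a root continuity argument give Garding's inequality: the mixed
  discriminant of matrices in \<open>\<Gamma>\<^sub>k\<close> is nonnegative. The identity being the Hessian of \<open>|x|\<^sup>2 / 2\<close>,
  every \<open>G\<^sub>k\<close> is the integral of a mixed discriminant of Hessians. By expansion along rows this is a sum
  of Jacobian determinants, and the integral of the Jacobian of a compactly supported map \<open>f\<close> vanishes
  because \<open>x + t f(x)\<close> permutes a large box for small \<open>t\<close>. Integrating by parts against
  compactly supported truncations of \<open>u\<^sub>0\<close>, which is nonpositive by the maximum principle, exhibits \<open>G\<^sub>k\<close> as a positive semidefinite symmetric form in \<open>\<nabla>u\<^sub>0\<close> and \<open>\<nabla>u\<^sub>1\<close>. The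
  Cauchy-Schwarz inequality for all pairs of arguments then yields the product inequality.\<close>

text \<open>Two obstacles shape the proof. First, the \<open>u j\<close> are only twice
  differentiable, so cofactors of their Hessians cannot be differentiated and the divergence
  structure of the Hessian operator is out of reach. A determinant of second derivatives is instead
  read as the Jacobian of a map built from first derivatives: such a map is C^1, and the volume
  argument differentiates nothing further. Second, nonnegativity must hold on closed cones, where
  mixed discriminants may vanish; every stability statement is therefore made for matrices shifted
  by a positive multiple of the identity, and the shift is removed by continuity. The positivity
  behind the Cauchy-Schwarz inequality comes from one observation: \<open>\<xi> \<xi>^T\<close> lies
  in every cone \<Gamma>_k, so Garding's inequality applies with this matrix in the slot that held
  the Hessian of \<open>u 1\<close>. The resulting form in two gradients has coefficients depending
  on the remaining arguments only, which is what allows arguments to be exchanged one pair at a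
  time.\<close>

section \<open>Expansion of multiaffine functions over sets of slots\<close>

text \<open>The carrier \<open>V\<close> is there for the abstract polarization, whose linearity is
  assumed on symmetric matrices only. The relation between \<open>X\<close>, \<open>Y\<close>,
  \<open>Z\<close> enters only through \<open>G\<close>, so one statement serves real and complex
  matrices.\<close>

lemma multiaffine_expand:
  fixes G :: "('s \<Rightarrow> 'v) \<Rightarrow> 'a::comm_semiring_1"
  assumes "finite T"
    and "\<And>A s. s \<in> T \<Longrightarrow> (\<And>r. A r \<in> V) \<Longrightarrow> G (A(s := Z)) = G (A(s := X)) + c * G (A(s := Y))"
    and "X \<in> V" "Y \<in> V" "Z \<in> V" and "\<And>r. A r \<in> V"
  shows "G (\<lambda>r. if r \<in> T then Z else A r) =
    (\<Sum>J\<in>Pow T. c ^ card J * G (\<lambda>r. if r \<in> J then Y else if r \<in> T then X else A r))"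
  using assms(1,2,6)
proof (induction T arbitrary: A rule: finite_induct)
  case empty
  then show ?case by simp
next
  case (insert s T)
  let ?B = "\<lambda>J r. if r \<in> J then Y else if r \<in> T then X else A r"
  have inj: "inj_on (insert s) (Pow T)"
    using insert.hyps(2) by (auto simp: inj_on_def)
  have "G (\<lambda>r. if r \<in> insert s T then Z else A r) = G (\<lambda>r. if r \<in> T then Z else (A(s := Z)) r)"
    using insert.hyps(2) by (intro arg_cong[where f=G]) (auto simp: fun_eq_iff)
  also have "\<dots> = (\<Sum>J\<in>Pow T. c ^ card J * G (\<lambda>r. if r \<in> J then Y else if r \<in> T then X else (A(s := Z)) r))"
    using insert.prems assms(5) by (intro insert.IH) auto
  also have "\<dots> = (\<Sum>J\<in>Pow T. c ^ card J * G ((?B J)(s := Z)))"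
    using insert.hyps(2) by (intro sum.cong refl arg_cong2[where f="(*)"] arg_cong[where f=G]) (auto simp: fun_eq_iff)
  also have "\<dots> = (\<Sum>J\<in>Pow T. c ^ card J * G ((?B J)(s := X)) + c ^ card (insert s J) * G ((?B J)(s := Y)))"
  proof (intro sum.cong refl)
    fix J assume "J \<in> Pow T"
    then have "finite J" "s \<notin> J"
      using insert.hyps finite_subset by auto
    moreover have "G ((?B J)(s := Z)) = G ((?B J)(s := X)) + c * G ((?B J)(s := Y))"
      using insert.prems(2) assms(3,4) by (intro insert.prems(1)) auto
    ultimately show "c ^ card J * G ((?B J)(s := Z)) = c ^ card J * G ((?B J)(s := X)) + c ^ card (insert s J) * G ((?B J)(s := Y))"
      by (simp add: algebra_simps)
  qed
  also have "\<dots> = (\<Sum>J\<in>Pow T. c ^ card J * G (\<lambda>r. if r \<in> J then Y else if r \<in> insert s T then X else A r))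
      + (\<Sum>J\<in>insert s ` Pow T. c ^ card J * G (\<lambda>r. if r \<in> J then Y else if r \<in> insert s T then X else A r))"
    unfolding sum.distrib sum.reindex[OF inj] o_def
    using insert.hyps(2)
    by (intro arg_cong2[where f="(+)"] sum.cong refl arg_cong2[where f="(*)"] arg_cong[where f=G]) (auto simp: fun_eq_iff)
  also have "\<dots> = (\<Sum>J\<in>Pow (insert s T). c ^ card J * G (\<lambda>r. if r \<in> J then Y else if r \<in> insert s T then X else A r))"
    unfolding Pow_insert using insert.hyps by (subst sum.union_disjoint) auto
  finally show ?case .
qed

lemma sum_Pow_by_card:
  fixes c :: "'a::comm_semiring_1"
  assumes "finite T"
  shows "(\<Sum>J\<in>Pow T. c ^ card J * g J) = (\<Sum>j\<le>card T. (\<Sum>J | J \<subseteq> T \<and> card J = j. g J) * c ^ j)"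
proof -
  have "(\<Sum>J\<in>Pow T. c ^ card J * g J) = (\<Sum>j\<le>card T. \<Sum>J | J \<in> Pow T \<and> card J = j. c ^ card J * g J)"
    using assms by (intro sum.group[symmetric]) (auto intro: card_mono)
  also have "\<dots> = (\<Sum>j\<le>card T. (\<Sum>J | J \<subseteq> T \<and> card J = j. g J) * c ^ j)"
    unfolding sum_distrib_right by (intro sum.cong) (auto simp: mult.commute)
  finally show ?thesis .
qed

lemma subsets_card_1: "{J. J \<subseteq> T \<and> card J = Suc 0} = (\<lambda>s. {s}) ` T"
  by (auto simp: card_1_singleton_iff)

section \<open>Mixed discriminants\<close>

text \<open>The polarization of \<open>det\<close>, normalized to equal \<open>det A\<close> when
  all slots hold \<open>A\<close>. It is written as a signed sum of determinants because each of
  them later becomes a Jacobian. Slots and rows share the index type \<open>'n\<close>.\<close>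

definition mixed_disc :: "('n::finite \<Rightarrow> 'a::field_char_0 ^ 'n ^ 'n) \<Rightarrow> 'a" where
  "mixed_disc A = (\<Sum>p | p permutes UNIV. of_int (sign p) * det (\<chi> j. A j $ p j)) / fact CARD('n)"

lemma mixed_disc_expand:
  fixes A :: "'n::finite \<Rightarrow> 'a::field_char_0 ^ 'n ^ 'n"
  shows "mixed_disc A = (\<Sum>p | p permutes UNIV. \<Sum>q | q permutes UNIV.
     of_int (sign p) * of_int (sign q) * (\<Prod>j\<in>UNIV. A j $ p j $ q j)) / fact CARD('n)"
  by (simp add: mixed_disc_def det_def sum_distrib_left mult.assoc)

lemma mixed_disc_transpose:
  fixes A :: "'n::finite \<Rightarrow> 'a::field_char_0 ^ 'n ^ 'n"
  shows "mixed_disc (\<lambda>j. transpose (A j)) = mixed_disc A"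
proof -
  have "mixed_disc (\<lambda>j. transpose (A j)) = (\<Sum>p | p permutes UNIV. \<Sum>q | q permutes UNIV.
     of_int (sign q) * of_int (sign p) * (\<Prod>j\<in>UNIV. A j $ q j $ p j)) / fact CARD('n)"
    unfolding mixed_disc_expand by (simp add: transpose_def mult.commute)
  also have "\<dots> = mixed_disc A"
    unfolding mixed_disc_expand by (subst sum.swap) simp
  finally show ?thesis .
qed

lemma mixed_disc_diag:
  fixes A :: "'a::field_char_0 ^ 'n ^ 'n"
  shows "mixed_disc (\<lambda>_. A) = det A"
proof -
  have "of_int (sign p) * det (\<chi> j. A $ p j) = det A" if "p permutes UNIV" for p
  proof -
    have "of_int (sign p) * det (\<chi> j. A $ p j) = of_int (sign p * sign p) * det A"
      unfolding det_permute_rows[OF that] of_int_mult by (simp only: mult.assoc)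
    then show ?thesis by (simp only: sign_idempotent of_int_1 mult_1_left)
  qed
  then have "mixed_disc (\<lambda>_. A) = of_nat (card {p. p permutes (UNIV::'n set)}) * det A / fact CARD('n)"
    by (simp add: mixed_disc_def)
  then show ?thesis
    by (simp add: card_permutations[OF refl])
qed

lemma mixed_disc_permute:
  fixes A :: "'n::finite \<Rightarrow> 'a::field_char_0 ^ 'n ^ 'n"
  assumes "p permutes UNIV"
  shows "mixed_disc (A \<circ> p) = mixed_disc A"
proof -
  have "(\<Sum>s | s permutes UNIV. of_int (sign s) * det (\<chi> j. (A \<circ> p) j $ s j)) =
     (\<Sum>s | s permutes UNIV. of_int (sign (s \<circ> p)) * det (\<chi> j. (A \<circ> p) j $ (s \<circ> p) j))"
    by (rule sum_permutations_compose_right[OF assms])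
  also have "\<dots> = (\<Sum>s | s permutes UNIV. of_int (sign s) * det (\<chi> j. A j $ s j))"
  proof (intro sum.cong refl)
    fix s :: "'n \<Rightarrow> 'n" assume "s \<in> {s. s permutes UNIV}"
    then have s: "s permutes UNIV" by simp
    have "(\<chi> j. (A \<circ> p) j $ (s \<circ> p) j) = (\<chi> j. (\<chi> j. A j $ s j) $ p j)"
      by (simp add: vec_eq_iff)
    then have "det (\<chi> j. (A \<circ> p) j $ (s \<circ> p) j) = of_int (sign p) * det (\<chi> j. A j $ s j)"
      using det_permute_rows[OF assms, of "\<chi> j. A j $ s j"] by simp
    moreover have "sign (s \<circ> p) = sign s * sign p"
      using s assms by (meson sign_compose permutes_imp_permutation finite)
    ultimately have "of_int (sign (s \<circ> p)) * det (\<chi> j. (A \<circ> p) j $ (s \<circ> p) j)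
        = of_int (sign s * (sign p * sign p)) * det (\<chi> j. A j $ s j)"
      by (simp only: of_int_mult mult.assoc)
    then show "of_int (sign (s \<circ> p)) * det (\<chi> j. (A \<circ> p) j $ (s \<circ> p) j) = of_int (sign s) * det (\<chi> j. A j $ s j)"
      by (simp only: sign_idempotent mult_1_right)
  qed
  finally show ?thesis by (simp add: mixed_disc_def)
qed

text \<open>The hypothesis is entrywise so that real scaling and complex coefficients are covered
  alike.\<close>

lemma mixed_disc_slot:
  fixes A :: "'n::finite \<Rightarrow> 'a::field_char_0 ^ 'n ^ 'n"
  assumes "\<And>i j. Z $ i $ j = X $ i $ j + c * Y $ i $ j"
  shows "mixed_disc (A(s := Z)) = mixed_disc (A(s := X)) + c * mixed_disc (A(s := Y))"
proof -
  have pr: "(\<Prod>j\<in>UNIV. (A(s := M)) j $ p j $ q j) = M $ p s $ q s * (\<Prod>j\<in>UNIV - {s}. A j $ p j $ q j)" for M p q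
    by (subst prod.remove[of UNIV s]) (auto intro!: prod.cong)
  show ?thesis
    unfolding mixed_disc_expand pr assms
    by (simp add: sum_distrib_left sum_divide_distrib sum.distrib[symmetric] add_divide_distrib[symmetric] algebra_simps)
qed

lemma mixed_disc_scale:
  fixes A B :: "'n::finite \<Rightarrow> 'a::field_char_0 ^ 'n ^ 'n"
  assumes "\<And>r i j. B r $ i $ j = c r * A r $ i $ j"
  shows "mixed_disc B = prod c UNIV * mixed_disc A"
  unfolding mixed_disc_expand assms prod.distrib
  by (simp add: sum_distrib_left mult_ac)

lemma continuous_on_mixed_disc [continuous_intros]:
  fixes A :: "'b::topological_space \<Rightarrow> 'n::finite \<Rightarrow> 'a::{real_normed_field} ^ 'n ^ 'n"
  assumes "\<And>r i j. continuous_on S (\<lambda>x. A x r $ i $ j)"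
  shows "continuous_on S (\<lambda>x. mixed_disc (A x))"
  unfolding mixed_disc_expand by (intro continuous_intros assms) simp_all

lemma coeff_sum_monom:
  "coeff (\<Sum>j\<le>n. monom (c j) j) m = (if m \<le> (n::nat) then c m else 0)"
  by (simp add: coeff_sum)

text \<open>Turns analytic facts about \<open>X + w Y\<close> into facts about roots and
  coefficients of one polynomial. Only the coefficients of \<open>w\<close>, of \<open>w ^ k\<close>
  for a given \<open>k\<close>, and of the top power are ever read off.\<close>

lemma mixed_disc_pencil:
  fixes A :: "'n::finite \<Rightarrow> 'a::field_char_0 ^ 'n ^ 'n" and T :: "'n set"
  obtains q where "\<And>w Z. (\<And>i j. Z $ i $ j = X $ i $ j + w * Y $ i $ j) \<Longrightarrow>
      poly q w = mixed_disc (\<lambda>r. if r \<in> T then Z else A r)"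
    and "\<And>m. coeff q m = (\<Sum>J | J \<subseteq> T \<and> card J = m.
      mixed_disc (\<lambda>r. if r \<in> J then Y else if r \<in> T then X else A r))"
proof
  let ?g = "\<lambda>J. mixed_disc (\<lambda>r. if r \<in> J then Y else if r \<in> T then X else A r)"
  let ?q = "\<Sum>j\<le>card T. monom (\<Sum>J | J \<subseteq> T \<and> card J = j. ?g J) j"
  fix w Z assume Z: "\<And>i j. Z $ i $ j = X $ i $ j + w * Y $ i $ j"
  have "mixed_disc (\<lambda>r. if r \<in> T then Z else A r) = (\<Sum>J\<in>Pow T. w ^ card J * ?g J)"
    by (rule multiaffine_expand[where V = UNIV]) (auto simp del: fun_upd_apply intro: mixed_disc_slot Z)
  then show "poly ?q w = mixed_disc (\<lambda>r. if r \<in> T then Z else A r)"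
    by (simp add: sum_Pow_by_card poly_sum poly_monom)
next
  let ?g = "\<lambda>J. mixed_disc (\<lambda>r. if r \<in> J then Y else if r \<in> T then X else A r)"
  let ?q = "\<Sum>j\<le>card T. monom (\<Sum>J | J \<subseteq> T \<and> card J = j. ?g J) j"
  fix m
  have "{J. J \<subseteq> T \<and> card J = m} = {}" if "\<not> m \<le> card T"
    using that card_mono[of T] by auto
  then show "coeff ?q m = (\<Sum>J | J \<subseteq> T \<and> card J = m. ?g J)"
    unfolding coeff_sum_monom by (simp only: if_P split: if_split) (metis (no_types, lifting) sum.empty)
qed

lemma ex_permutes_same_card:
  fixes J J' :: "'n::finite set"
  assumes "card J = card J'"
  obtains p where "p permutes UNIV" "\<And>r. p r \<in> J' \<longleftrightarrow> r \<in> J"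
proof -
  obtain f where f: "bij_betw f J J'"
    using assms finite_same_card_bij[of J J'] by auto
  have "card (- J) = card (- J')"
    using assms by (simp add: Compl_eq_Diff_UNIV card_Diff_subset)
  then obtain g where g: "bij_betw g (- J) (- J')"
    using finite_same_card_bij[of "- J" "- J'"] by auto
  let ?p = "\<lambda>r. if r \<in> J then f r else g r"
  have "bij_betw ?p (J \<union> - J) (J' \<union> - J')"
    using f g by (intro bij_betw_disjoint_Un) auto
  then have "bij ?p" by simp
  then have "?p permutes UNIV" by (auto intro: bij_imp_permutes)
  moreover have "?p r \<in> J' \<longleftrightarrow> r \<in> J" for r
    using f g by (auto simp: bij_betw_def)
  ultimately show ?thesis by (rule that)
qed

lemma mixed_disc_two_valued:
  fixes X Y :: "'a::field_char_0 ^ 'n ^ 'n"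
  assumes "card J = card J'"
  shows "mixed_disc (\<lambda>r. if r \<in> J then Y else X) = mixed_disc (\<lambda>r. if r \<in> J' then Y else X)"
proof -
  obtain p where p: "p permutes UNIV" "\<And>r. p r \<in> J' \<longleftrightarrow> r \<in> J"
    using ex_permutes_same_card[OF assms] by metis
  have "(\<lambda>r. if r \<in> J then Y else X) = (\<lambda>r. if r \<in> J' then Y else X) \<circ> p"
    by (auto simp: p fun_eq_iff)
  then show ?thesis using mixed_disc_permute[OF p(1)] by metis
qed

lemma mixed_disc_slot_swap:
  fixes A :: "'n::finite \<Rightarrow> 'a::field_char_0 ^ 'n ^ 'n"
  assumes "s \<in> T" "s' \<in> T"
  shows "mixed_disc (\<lambda>r. if r = s then Y else if r \<in> T then X else A r) =
         mixed_disc (\<lambda>r. if r = s' then Y else if r \<in> T then X else A r)"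
proof -
  have "(\<lambda>r. if r = s then Y else if r \<in> T then X else A r) =
     (\<lambda>r. if r = s' then Y else if r \<in> T then X else A r) \<circ> Transposition.transpose s s'"
    using assms by (auto simp: fun_eq_iff Transposition.transpose_def)
  then show ?thesis
    by (simp add: mixed_disc_permute permutes_swap_id)
qed

subsection \<open>Stability\<close>

text \<open>The Gauss-Lucas argument at the point 0: the logarithmic derivative there is the sum of
  \<open>- 1 / r\<close> over the roots \<open>r\<close>, and \<open>Im (1 / r) > 0\<close> when
  \<open>Im r < 0\<close>. Strictness for positive degree is what makes the derivative at 0
  nonzero.\<close>

lemma lower_half_plane_roots_log_derivative:
  fixes q :: "complex poly"
  assumes "\<And>w. 0 \<le> Im w \<Longrightarrow> poly q w \<noteq> 0"
  shows "Im (poly (pderiv q) 0 / poly q 0) \<le> 0 \<and>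
    (degree q > 0 \<longrightarrow> Im (poly (pderiv q) 0 / poly q 0) < 0)"
  using assms
proof (induction "degree q" arbitrary: q)
  case 0
  then have "pderiv q = 0" by (simp add: pderiv_eq_0_iff)
  then show ?case using 0 by simp
next
  case (Suc d)
  then have "\<not> constant (poly q)" by (simp add: constant_degree)
  then obtain r where r: "poly q r = 0"
    using fundamental_theorem_of_algebra by blast
  then obtain q' where q': "q = [:- r, 1:] * q'"
    using poly_eq_0_iff_dvd by (metis dvdE)
  have Im: "Im r < 0" using r Suc.prems[of r] by (meson linorder_not_less)
  have "q' \<noteq> 0" using Suc.hyps(2) q' by auto
  then have "degree q = Suc (degree q')" unfolding q' by (subst degree_mult_eq) auto
  then have d: "d = degree q'" using Suc.hyps(2) by simp
  have nz: "poly q' w \<noteq> 0" if "0 \<le> Im w" for w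
    using Suc.prems[OF that] unfolding q' by auto
  have IH: "Im (poly (pderiv q') 0 / poly q' 0) \<le> 0"
    using Suc.hyps(1)[OF d nz] by blast
  have "r \<noteq> 0" "poly q' 0 \<noteq> 0" using Im nz[of 0] by auto
  then have "poly (pderiv q) 0 / poly q 0 = poly (pderiv q') 0 / poly q' 0 - 1 / r"
    unfolding q' pderiv_mult by (simp add: pderiv_pCons field_simps)
  moreover have "Im (1 / r) > 0"
  proof -
    have "(Re r)\<^sup>2 + (Im r)\<^sup>2 > 0" using Im by (simp add: sum_power2_gt_zero_iff)
    then show ?thesis using Im by (simp add: Im_divide divide_neg_pos)
  qed
  ultimately show ?case using IH by simp
qed

text \<open>Root continuity in quantitative form: the modulus of \<open>poly q z\<close> is that of
  the leading coefficient times the product of the distances from \<open>z\<close> to the roots. The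
  bound depends only on the degree and the leading coefficient, hence is uniform along a homotopy
  fixing both.\<close>

lemma poly_root_near:
  fixes q :: "complex poly"
  assumes "e > 0" "cmod (poly q z) < cmod (lead_coeff q) * e ^ degree q"
  obtains r where "poly q r = 0" "cmod (z - r) < e"
proof -
  have "cmod (lead_coeff q) * e ^ degree q \<le> cmod (poly q z)" if "\<And>r. poly q r = 0 \<Longrightarrow> e \<le> cmod (z - r)"
    using that
  proof (induction "degree q" arbitrary: q)
    case 0
    then obtain a where "q = [:a:]" using degree_eq_zeroE by metis
    then show ?case by simp
  next
    case (Suc d)
    then have "\<not> constant (poly q)" by (simp add: constant_degree)
    then obtain r where r: "poly q r = 0"
      using fundamental_theorem_of_algebra by blast
    then obtain q' where q': "q = [:- r, 1:] * q'"
      using poly_eq_0_iff_dvd by (metis dvdE)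
    have "q' \<noteq> 0" using Suc.hyps(2) q' by auto
    then have dq: "degree q = Suc (degree q')" unfolding q' by (subst degree_mult_eq) auto
    have "cmod (lead_coeff q') * e ^ degree q' \<le> cmod (poly q' z)"
      using Suc.hyps dq Suc.prems by (intro Suc.hyps(1)) (auto simp: q')
    moreover have "e \<le> cmod (z - r)" using r Suc.prems by blast
    ultimately have "e * (cmod (lead_coeff q') * e ^ degree q') \<le> cmod (z - r) * cmod (poly q' z)"
      using assms(1) by (intro mult_mono) auto
    moreover have "lead_coeff q = lead_coeff q'"
      unfolding q' by (subst lead_coeff_mult) simp
    moreover have "poly q z = (z - r) * poly q' z" by (simp add: q' algebra_simps)
    ultimately show ?case by (simp add: dq norm_mult mult_ac)
  qed
  then show ?thesis using assms that by (metis linorder_not_less)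
qed

definition cmat :: "real ^ 'n ^ 'n \<Rightarrow> real ^ 'n ^ 'n \<Rightarrow> complex ^ 'n ^ 'n" where
  "cmat X Y = (\<chi> i j. Complex (X $ i $ j) (Y $ i $ j))"

lemma cmat_nth [simp]: "cmat X Y $ i $ j = Complex (X $ i $ j) (Y $ i $ j)"
  by (simp add: cmat_def)

lemma mixed_disc_cmat_real:
  fixes A :: "'n::finite \<Rightarrow> real ^ 'n ^ 'n"
  shows "mixed_disc (\<lambda>r. cmat (A r) 0) = of_real (mixed_disc A)"
proof -
  have "Complex (A r $ i $ j) 0 = of_real (A r $ i $ j)" for r i j
    by (simp add: complex_of_real_def)
  then show ?thesis
    unfolding mixed_disc_expand by simp
qed

lemma symmetric_matrices_nth: "A \<in> symmetric_matrices \<longleftrightarrow> (\<forall>i j. A $ i $ j = A $ j $ i)"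
  by (auto simp: symmetric_matrices_def transpose_def vec_eq_iff)

text \<open>For \<open>v\<close> in the kernel of \<open>X + i y 1\<close>, the Hermitian form of
  \<open>X\<close> at \<open>v\<close> is real, so the imaginary part of
  \<open>v^* (X + i y 1) v = 0\<close> is \<open>y\<close> times the squared norm of
  \<open>v\<close>.\<close>

lemma det_cmat_mat_nonzero:
  fixes X :: "real ^ 'n ^ 'n"
  assumes "X \<in> symmetric_matrices" "y \<noteq> 0"
  shows "det (cmat X (y *\<^sub>R mat 1)) \<noteq> 0"
proof
  let ?M = "cmat X (y *\<^sub>R mat 1)"
  assume "det ?M = 0"
  then have "\<not> invertible ?M" by (simp add: invertible_det_nz)
  then have "\<not> (\<exists>B. B ** ?M = mat 1)"
    by (simp add: invertible_left_inverse)
  then obtain v where v: "?M *v v = 0" "v \<noteq> 0"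
    unfolding matrix_left_invertible_ker by blast
  have sym: "X $ i $ j = X $ j $ i" for i j
    using assms(1) by (simp add: symmetric_matrices_nth)
  have M: "?M $ i $ j = of_real (X $ i $ j) + (if i = j then \<i> * of_real y else 0)" for i j
    by (simp add: complex_eq_iff mat_def)
  define Q where "Q = (\<Sum>i\<in>UNIV. \<Sum>j\<in>UNIV. cnj (v $ i) * of_real (X $ i $ j) * v $ j)"
  have "cnj Q = (\<Sum>i\<in>UNIV. \<Sum>j\<in>UNIV. cnj (v $ j) * of_real (X $ j $ i) * v $ i)"
    unfolding Q_def cnj_sum by (intro sum.cong refl) (simp add: sym[symmetric] mult_ac)
  also have "\<dots> = Q" unfolding Q_def by (rule sum.swap)
  finally have "Im (cnj Q) = Im Q" by (rule arg_cong)
  then have ImQ: "Im Q = 0" by simp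
  define R where "R = y * (\<Sum>i\<in>UNIV. (cmod (v $ i))\<^sup>2)"
  have "(\<Sum>j\<in>UNIV. cnj (v $ i) * ?M $ i $ j * v $ j) =
     (\<Sum>j\<in>UNIV. cnj (v $ i) * of_real (X $ i $ j) * v $ j) + \<i> * of_real (y * (cmod (v $ i))\<^sup>2)" for i
  proof -
    have "(\<Sum>j\<in>UNIV. cnj (v $ i) * ?M $ i $ j * v $ j) = (\<Sum>j\<in>UNIV. cnj (v $ i) * of_real (X $ i $ j) * v $ j
        + (if i = j then cnj (v $ i) * (\<i> * of_real y) * v $ i else 0))"
      unfolding M by (intro sum.cong refl) (simp add: distrib_left distrib_right)
    also have "\<dots> = (\<Sum>j\<in>UNIV. cnj (v $ i) * of_real (X $ i $ j) * v $ j) + cnj (v $ i) * (\<i> * of_real y) * v $ i"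
      by (simp add: sum.distrib)
    also have "cnj (v $ i) * (\<i> * of_real y) * v $ i = \<i> * (of_real y * (v $ i * cnj (v $ i)))"
      by (simp only: mult_ac)
    also have "\<dots> = \<i> * of_real (y * (cmod (v $ i))\<^sup>2)"
      by (simp only: complex_norm_square[symmetric] of_real_mult)
    finally show ?thesis .
  qed
  then have "(\<Sum>i\<in>UNIV. \<Sum>j\<in>UNIV. cnj (v $ i) * ?M $ i $ j * v $ j) = Q + \<i> * of_real R"
    unfolding Q_def R_def by (simp only: sum.distrib sum_distrib_left of_real_sum)
  moreover have "(\<Sum>j\<in>UNIV. cnj (v $ i) * ?M $ i $ j * v $ j) = cnj (v $ i) * (?M *v v) $ i" for i
    by (simp only: matrix_vector_mult_def vec_lambda_beta sum_distrib_left mult.assoc)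
  ultimately have "Q + \<i> * of_real R = 0" using v(1) by simp
  then have "Im (Q + \<i> * of_real R) = 0" by simp
  then have "R = 0" using ImQ by simp
  then have "(\<Sum>i\<in>UNIV. (cmod (v $ i))\<^sup>2) = 0" using assms(2) by (simp add: R_def)
  then have "\<forall>i. v $ i = 0" by (subst (asm) sum_nonneg_eq_0_iff) auto
  then show False using v(2) by (simp add: vec_eq_iff)
qed

text \<open>Stability in the sense of half-plane polynomials, with real matrices frozen in the slots
  \<open>R\<close> and \<open>X + i Y\<close> in all others. For \<open>R = UNIV\<close> the complex
  argument disappears, and the statement is that a real mixed discriminant is nonzero.\<close>

definition stab :: "('n::finite \<Rightarrow> real ^ 'n ^ 'n) \<Rightarrow> 'n set \<Rightarrow> (real ^ 'n ^ 'n) set \<Rightarrow> bool" where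
  "stab B R C \<longleftrightarrow> (\<forall>X\<in>symmetric_matrices. \<forall>Y\<in>C.
     mixed_disc (\<lambda>s. if s \<in> R then cmat (B s) 0 else cmat X Y) \<noteq> 0)"

lemma stabD:
  fixes B :: "'n::finite \<Rightarrow> real ^ 'n ^ 'n"
  assumes "stab B R C" "X \<in> symmetric_matrices" "Y \<in> C"
  shows "mixed_disc (\<lambda>s. if s \<in> R then cmat (B s) 0 else cmat X Y) \<noteq> 0"
  using assms by (auto simp: stab_def)

text \<open>Scaling is by positive numbers only, so that 0 may be missing: stability fails at
  \<open>X = Y = 0\<close> unless all slots are frozen.\<close>

definition sym_cone :: "(real ^ 'n ^ 'n) set \<Rightarrow> bool" where
  "sym_cone C \<longleftrightarrow> C \<subseteq> symmetric_matrices \<and> (\<forall>Y\<in>C. \<forall>Z\<in>C. Y + Z \<in> C) \<and> (\<forall>Y\<in>C. \<forall>c>0. c *\<^sub>R Y \<in> C)"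

lemma symmetric_matrices_closed [intro, simp]:
  shows "0 \<in> symmetric_matrices" "mat c \<in> symmetric_matrices"
    "X \<in> symmetric_matrices \<Longrightarrow> Y \<in> symmetric_matrices \<Longrightarrow> X + Y \<in> symmetric_matrices"
    "X \<in> symmetric_matrices \<Longrightarrow> a *\<^sub>R X \<in> symmetric_matrices"
    "X \<in> symmetric_matrices \<Longrightarrow> - X \<in> symmetric_matrices"
  by (auto simp: symmetric_matrices_nth mat_def)

lemma mixed_disc_scale_on:
  fixes A :: "'n::finite \<Rightarrow> 'a::field_char_0 ^ 'n ^ 'n"
  assumes "\<And>i j. Z $ i $ j = c * Y $ i $ j"
  shows "mixed_disc (\<lambda>r. if r \<in> R then A r else Z) = c ^ card (- R) * mixed_disc (\<lambda>r. if r \<in> R then A r else Y)"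
proof -
  have "mixed_disc (\<lambda>r. if r \<in> R then A r else Z) =
     (\<Prod>r\<in>UNIV. if r \<in> R then 1 else c) * mixed_disc (\<lambda>r. if r \<in> R then A r else Y)"
    using assms by (intro mixed_disc_scale) auto
  also have "(\<Prod>r\<in>UNIV. if r \<in> R then 1 else c) = c ^ card (- R)"
    by (simp add: prod.If_cases)
  finally show ?thesis .
qed

text \<open>For \<open>X + i Y + w B s\<close> with \<open>Im w \<ge> 0\<close> the imaginary part
  stays in \<open>C\<close>, so the polynomial in \<open>w\<close> has its roots in the open lower
  half plane. Its derivative at 0 is then nonzero, and up to a positive integer factor this
  derivative is the mixed discriminant with \<open>B s\<close> in one more slot.\<close>

lemma stab_insert:
  fixes B :: "'n::finite \<Rightarrow> real ^ 'n ^ 'n"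
  assumes st: "stab B R C" and C: "sym_cone C" and s: "s \<notin> R" "B s \<in> C"
  shows "stab B (insert s R) C"
  unfolding stab_def
proof (intro ballI)
  fix X Y :: "real ^ 'n ^ 'n" assume X: "X \<in> symmetric_matrices" and Y: "Y \<in> C"
  let ?b = "\<lambda>r. cmat (B r) 0"
  obtain q where q: "\<And>w Z. (\<And>i j. Z $ i $ j = cmat X Y $ i $ j + w * ?b s $ i $ j) \<Longrightarrow>
      poly q w = mixed_disc (\<lambda>r. if r \<in> - R then Z else ?b r)"
    and coeff: "\<And>m. coeff q m = (\<Sum>J | J \<subseteq> - R \<and> card J = m.
      mixed_disc (\<lambda>r. if r \<in> J then ?b s else if r \<in> - R then cmat X Y else ?b r))"
    using mixed_disc_pencil[of "cmat X Y" "?b s" "- R" ?b] by blast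
  have flip: "(\<lambda>r. if r \<in> - R then Z else ?b r) = (\<lambda>r. if r \<in> R then ?b r else Z)" for Z
    by auto
  have nz: "poly q w \<noteq> 0" if "0 \<le> Im w" for w
  proof -
    have "poly q w = mixed_disc (\<lambda>r. if r \<in> - R then cmat (X + Re w *\<^sub>R B s) (Y + Im w *\<^sub>R B s) else ?b r)"
      by (rule q) (simp add: complex_eq_iff)
    moreover have "Y + Im w *\<^sub>R B s \<in> C"
      using that Y s C by (cases "Im w = 0") (auto simp: sym_cone_def)
    moreover have "X + Re w *\<^sub>R B s \<in> symmetric_matrices"
      using X s C by (auto simp: sym_cone_def)
    ultimately show ?thesis
      unfolding flip by (auto dest: stabD[OF st])
  qed
  have "coeff q (card (- R)) \<noteq> 0"
  proof -
    have "J = - R" if "J \<subseteq> - R" "card J = card (- R)" for J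
      using that by (intro card_subset_eq) auto
    then have "{J. J \<subseteq> - R \<and> card J = card (- R)} = {- R}" by auto
    then have "coeff q (card (- R)) = mixed_disc (\<lambda>r. if r \<in> - R then ?b s else if r \<in> - R then cmat X Y else ?b r)"
      unfolding coeff by simp
    also have "\<dots> = mixed_disc (\<lambda>r. if r \<in> R then ?b r else ?b s)"
      by (intro arg_cong[where f = mixed_disc]) auto
    finally have 1: "coeff q (card (- R)) = mixed_disc (\<lambda>r. if r \<in> R then ?b r else ?b s)" .
    \<comment> \<open>The top coefficient has \<open>B s\<close> in all free slots; it is nonzero
      because a power of \<open>\<i>\<close> times it is the value at \<open>X = 0\<close>,
      \<open>Y = B s\<close>, where \<open>st\<close> applies.\<close>
    have "mixed_disc (\<lambda>r. if r \<in> R then ?b r else cmat 0 (B s)) \<noteq> 0"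
      by (rule stabD[OF st]) (use s in auto)
    moreover have "mixed_disc (\<lambda>r. if r \<in> R then ?b r else cmat 0 (B s)) =
       \<i> ^ card (- R) * mixed_disc (\<lambda>r. if r \<in> R then ?b r else ?b s)"
      by (rule mixed_disc_scale_on) (simp add: complex_eq_iff)
    ultimately show ?thesis using 1 by auto
  qed
  then have "card (- R) \<le> degree q" by (rule le_degree)
  moreover have "card (- R) > 0" using s by (auto simp: card_gt_0_iff)
  ultimately have "degree q > 0" by simp
  then have "poly (pderiv q) 0 \<noteq> 0"
    using lower_half_plane_roots_log_derivative[OF nz] by auto
  \<comment> \<open>The linear coefficient is a sum over the free slots, in which all summands agree
    by symmetry.\<close>
  then have "coeff q 1 \<noteq> 0" by (simp add: poly_0_coeff_0 coeff_pderiv)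
  moreover have "coeff q 1 = (\<Sum>t\<in>- R. mixed_disc (\<lambda>r. if r = t then ?b s else if r \<in> - R then cmat X Y else ?b r))"
    unfolding coeff One_nat_def subsets_card_1 by (subst sum.reindex) (auto simp: inj_on_def)
  moreover have "\<dots> = (\<Sum>t\<in>- R. mixed_disc (\<lambda>r. if r = s then ?b s else if r \<in> - R then cmat X Y else ?b r))"
    using s by (intro sum.cong refl mixed_disc_slot_swap) auto
  ultimately have "mixed_disc (\<lambda>r. if r = s then ?b s else if r \<in> - R then cmat X Y else ?b r) \<noteq> 0"
    by auto
  moreover have "(\<lambda>r. if r = s then ?b s else if r \<in> - R then cmat X Y else ?b r) =
     (\<lambda>r. if r \<in> insert s R then ?b r else cmat X Y)"
    by auto
  ultimately show "mixed_disc (\<lambda>r. if r \<in> insert s R then ?b r else cmat X Y) \<noteq> 0" by simp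
qed

lemma stab_union:
  fixes B :: "'n::finite \<Rightarrow> real ^ 'n ^ 'n"
  assumes "stab B R C" "sym_cone C" "\<And>s. s \<in> S \<Longrightarrow> B s \<in> C"
  shows "stab B (R \<union> S) C"
proof -
  have "finite S" by simp
  then show ?thesis using assms(3)
  proof (induction S rule: finite_induct)
    case empty
    then show ?case using assms(1) by simp
  next
    case (insert s S)
    show ?case
    proof (cases "s \<in> R \<union> S")
      case True
      then show ?thesis using insert by (simp add: insert_absorb)
    next
      case False
      then show ?thesis using stab_insert[OF insert.IH assms(2) False] insert.prems by auto
    qed
  qed
qed

section \<open>Enlarging the cone of imaginary parts by a root homotopy\<close>

definition scalar_cone :: "(real ^ 'n ^ 'n) set" where
  "scalar_cone = {y *\<^sub>R mat 1 | y. y > 0}"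

lemma sym_cone_scalar: "sym_cone (scalar_cone :: (real ^ 'n ^ 'n) set)"
proof -
  have "a *\<^sub>R mat 1 \<in> (scalar_cone :: (real ^ 'n ^ 'n) set)" if "a > 0" for a :: real
    using that by (auto simp: scalar_cone_def)
  then show ?thesis
    unfolding sym_cone_def by (auto simp: scalar_cone_def scaleR_add_left[symmetric])
qed

lemma mat_1_in_scalar_cone: "mat 1 \<in> scalar_cone"
  unfolding scalar_cone_def by (auto intro!: exI[where x = 1])

lemma stab_scalar: "stab (\<lambda>_. mat 1) R (scalar_cone :: (real ^ 'n ^ 'n) set)"
proof -
  have "stab (\<lambda>_. mat 1) {} (scalar_cone :: (real ^ 'n ^ 'n) set)"
    unfolding stab_def
  proof (intro ballI)
    fix X Y :: "real ^ 'n ^ 'n" assume X: "X \<in> symmetric_matrices" and "Y \<in> scalar_cone"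
    then obtain y where "y > 0" "Y = y *\<^sub>R mat 1" by (auto simp: scalar_cone_def)
    then show "mixed_disc (\<lambda>s. if s \<in> {} then cmat (mat 1) 0 else cmat X Y) \<noteq> 0"
      using det_cmat_mat_nonzero[OF X, of y] by (simp add: mixed_disc_diag)
  qed
  from stab_union[OF this sym_cone_scalar, of R] show ?thesis
    using mat_1_in_scalar_cone by simp
qed

text \<open>The parameter \<open>s\<close> homogenizes the pencil, so that roots cannot escape to infinity.\<close>

lemma upper_half_plane_roots_homotopy:
  fixes H :: "real \<Rightarrow> real \<Rightarrow> complex \<Rightarrow> complex" and k :: nat
  assumes cont: "continuous_on UNIV (\<lambda>(d, s, z). H d s z)"
    and hom: "\<And>d s z. s > 0 \<Longrightarrow> H d s z = of_real s ^ k * H d 1 (z / of_real s)"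
    and inf: "\<And>d z. d \<in> {0..1} \<Longrightarrow> z \<noteq> 0 \<Longrightarrow> H d 0 z \<noteq> 0"
    and pol: "\<And>d. d \<in> {0..1} \<Longrightarrow> \<exists>q. degree q = m \<and> lead_coeff q = c \<and> (\<forall>z. poly q z = H d 1 z)"
    and "c \<noteq> 0"
    and real: "\<And>d z. d \<in> {0..1} \<Longrightarrow> Im z = 0 \<Longrightarrow> H d 1 z \<noteq> 0"
    and start: "\<And>z. 0 \<le> Im z \<Longrightarrow> H 0 1 z \<noteq> 0"
    and "0 \<le> Im z"
  shows "H 1 1 z \<noteq> 0"
proof -
  \<comment> \<open>\<open>Z\<close> collects the zeros over the closed upper half plane in
    homogeneous coordinates normalized by \<open>s + cmod z = 1\<close>. It is compact, and
    \<open>inf\<close> excludes \<open>s = 0\<close>, so the set \<open>T\<close> of parameters with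
    a zero is its projection and hence closed.\<close>
  define Z where "Z = {(d, s, z) | d s z. d \<in> {0..1} \<and> s \<in> {0..1} \<and> z \<in> cball 0 1 \<and> 0 \<le> Im z \<and> s + cmod z = 1 \<and> H d s z = 0}"
  define T where "T = {d \<in> {0..1}. \<exists>z. 0 \<le> Im z \<and> H d 1 z = 0}"
  have compZ: "compact Z"
  proof -
    have K: "compact ({0..1::real} \<times> {0..1::real} \<times> cball (0::complex) 1)"
      by (intro compact_Times compact_Icc compact_cball)
    have "closed {x::real \<times> real \<times> complex. 0 \<le> Im (snd (snd x)) \<and> fst (snd x) + cmod (snd (snd x)) = 1 \<and> (\<lambda>(d, s, z). H d s z) x = 0}"
      using cont by (intro closed_Collect_conj closed_Collect_le closed_Collect_eq continuous_intros)
    with K have "compact (({0..1::real} \<times> {0..1::real} \<times> cball (0::complex) 1) \<inter>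
       {x::real \<times> real \<times> complex. 0 \<le> Im (snd (snd x)) \<and> fst (snd x) + cmod (snd (snd x)) = 1 \<and> (\<lambda>(d, s, z). H d s z) x = 0})"
      by (rule compact_Int_closed)
    also have "\<dots> = Z" unfolding Z_def by auto
    finally show ?thesis .
  qed
  have TZ: "T = fst ` Z"
  proof (intro equalityI subsetI)
    fix d assume "d \<in> T"
    then obtain z where d: "d \<in> {0..1}" and z: "0 \<le> Im z" "H d 1 z = 0" by (auto simp: T_def)
    define s where "s = 1 / (1 + cmod z)"
    have s: "s > 0" "s \<le> 1" unfolding s_def by (auto simp: add_pos_nonneg)
    have "1 + cmod z \<noteq> 0" by (simp add: add_nonneg_eq_0_iff)
    then have "s * (1 + cmod z) = 1" unfolding s_def by simp
    then have n: "s + cmod (of_real s * z) = 1"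
      using s by (simp add: norm_mult algebra_simps)
    moreover have "H d s (of_real s * z) = 0"
      using hom[OF s(1), of d "of_real s * z"] s z by simp
    moreover have "0 \<le> Im (of_real s * z)" using s z by simp
    moreover have "of_real s * z \<in> cball 0 1" using n s by simp
    ultimately have "(d, s, of_real s * z) \<in> Z"
      using d s unfolding Z_def by auto
    then show "d \<in> fst ` Z" by force
  next
    fix d assume "d \<in> fst ` Z"
    then obtain s z where *: "d \<in> {0..1}" "s \<in> {0..1}" "0 \<le> Im z" "s + cmod z = 1" "H d s z = 0"
      unfolding Z_def by (auto simp del: atLeastAtMost_iff)
    have "z \<noteq> 0" if "s = 0" using * that by auto
    then have "s \<noteq> 0" using * inf[of d z] by blast
    then have s: "s > 0" using * by auto
    have "H d 1 (z / of_real s) = 0" using hom[OF s, of d z] * s by simp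
    moreover have "0 \<le> Im (z / of_real s)" using * s by simp
    ultimately show "d \<in> T" using *(1) unfolding T_def by blast
  qed
  have "compact T" unfolding TZ by (intro compact_continuous_image compZ continuous_intros)
  then have "closed T" by (rule compact_imp_closed)
  then have "closedin (top_of_set {0..1}) T"
    by (rule closed_subset[rotated]) (auto simp: T_def)
  \<comment> \<open>Since \<open>real\<close> excludes the axis, a zero \<open>z\<close> has
    \<open>Im z > 0\<close>. Nearby parameters have a zero within distance \<open>Im z\<close> of
    it, which is still in the upper half plane.\<close>
  moreover have "openin (top_of_set {0..1}) T"
    unfolding openin_contains_ball
  proof (intro conjI ballI)
    show "T \<subseteq> {0..1}" by (auto simp: T_def)
  next
    fix d assume "d \<in> T"
    then obtain z where d: "d \<in> {0..1}" and z: "0 \<le> Im z" "H d 1 z = 0" by (auto simp: T_def)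
    have Im: "Im z > 0" using real[OF d, of z] z by fastforce
    have "continuous_on UNIV (\<lambda>x. (\<lambda>(d, s, z). H d s z) (x, 1, z))"
      by (rule continuous_on_compose2[OF cont]) (auto intro!: continuous_intros)
    then have "isCont (\<lambda>x. H x 1 z) d"
      by (simp add: continuous_on_eq_continuous_at)
    moreover have "0 < cmod c * Im z ^ m" using Im assms(5) by simp
    ultimately obtain e where e: "e > 0" "\<And>x. dist x d < e \<Longrightarrow> dist (H x 1 z) (H d 1 z) < cmod c * Im z ^ m"
      unfolding continuous_at_eps_delta by blast
    have "x \<in> T" if "x \<in> ball d e \<inter> {0..1}" for x
    proof -
      have "x \<in> {0..1}" using that by blast
      then obtain q where q: "degree q = m" "lead_coeff q = c" "\<forall>z. poly q z = H x 1 z"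
        using pol by blast
      have "cmod (poly q z) < cmod (lead_coeff q) * Im z ^ degree q"
        using e(2)[of x] that z q by (simp add: dist_commute)
      then obtain r where r: "poly q r = 0" "cmod (z - r) < Im z"
        using poly_root_near[OF Im] by blast
      have "Im z - Im r \<le> cmod (z - r)" using abs_Im_le_cmod[of "z - r"] by simp
      then have "0 \<le> Im r" using r by simp
      then show ?thesis using that r q unfolding T_def by auto
    qed
    then show "\<exists>e>0. ball d e \<inter> {0..1} \<subseteq> T" using e(1) by blast
  qed
  ultimately have "T = {} \<or> T = {0..1}"
    using connected_clopen[of "{0..1::real}"] by auto
  moreover have "0 \<notin> T" using start by (auto simp: T_def)
  ultimately have "1 \<notin> T" by auto
  then show ?thesis using assms(8) by (auto simp: T_def)
qed

lemma sym_cone_add: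
  assumes "sym_cone C" "A \<in> symmetric_matrices"
  shows "sym_cone {Y + a *\<^sub>R A | Y a. Y \<in> C \<and> a \<ge> 0}"
  unfolding sym_cone_def
proof (intro conjI ballI allI impI)
  show "{Y + a *\<^sub>R A | Y a. Y \<in> C \<and> a \<ge> 0} \<subseteq> symmetric_matrices"
    using assms by (auto simp: sym_cone_def)
next
  fix Y Z assume "Y \<in> {Y + a *\<^sub>R A | Y a. Y \<in> C \<and> a \<ge> 0}" "Z \<in> {Y + a *\<^sub>R A | Y a. Y \<in> C \<and> a \<ge> 0}"
  then obtain Y' a Z' b where *: "Y = Y' + a *\<^sub>R A" "Z = Z' + b *\<^sub>R A" "Y' \<in> C" "Z' \<in> C" "a \<ge> 0" "b \<ge> 0" by auto
  then have "Y + Z = (Y' + Z') + (a + b) *\<^sub>R A" by (simp add: algebra_simps)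
  moreover have "Y' + Z' \<in> C" "a + b \<ge> 0" using * assms by (auto simp: sym_cone_def)
  ultimately show "Y + Z \<in> {Y + a *\<^sub>R A | Y a. Y \<in> C \<and> a \<ge> 0}" by blast
next
  fix Y and c :: real assume "Y \<in> {Y + a *\<^sub>R A | Y a. Y \<in> C \<and> a \<ge> 0}" "c > 0"
  then obtain Y' a where *: "Y = Y' + a *\<^sub>R A" "Y' \<in> C" "a \<ge> 0" by auto
  then have "c *\<^sub>R Y = c *\<^sub>R Y' + (c * a) *\<^sub>R A" by (simp add: algebra_simps)
  moreover have "c *\<^sub>R Y' \<in> C" "c * a \<ge> 0" using * assms \<open>c > 0\<close> by (auto simp: sym_cone_def)
  ultimately show "c *\<^sub>R Y \<in> {Y + a *\<^sub>R A | Y a. Y \<in> C \<and> a \<ge> 0}" by blast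
qed

text \<open>Consider the roots in \<open>z\<close> of the polynomial at
  \<open>X + i Y + z A\<close>. Stability for \<open>C\<close> excludes real roots, so none crosses
  the axis while \<open>X + i Y\<close> is deformed into \<open>i 1\<close>; there \<open>nz\<close>
  and the stability for scalar imaginary parts exclude roots in the upper half plane. The required
  value is the one at \<open>z = i a\<close>.\<close>

lemma stab_extend:
  fixes C :: "(real ^ 'n ^ 'n) set"
  assumes st: "stab (\<lambda>_. mat 1) R C" and C: "sym_cone C" and one: "mat 1 \<in> C"
    and A: "A \<in> symmetric_matrices"
    and nz: "\<And>t. t \<ge> 0 \<Longrightarrow> mixed_disc (\<lambda>s. if s \<in> R then mat 1 else A + t *\<^sub>R mat 1) \<noteq> 0"
  shows "stab (\<lambda>_. mat 1) R {Y + a *\<^sub>R A | Y a. Y \<in> C \<and> a \<ge> 0}"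
  unfolding stab_def
proof (intro ballI)
  fix X Y' :: "real ^ 'n ^ 'n"
  assume X: "X \<in> symmetric_matrices" and "Y' \<in> {Y + a *\<^sub>R A | Y a. Y \<in> C \<and> a \<ge> 0}"
  then obtain Y a where Y': "Y' = Y + a *\<^sub>R A" and Y: "Y \<in> C" and a: "a \<ge> 0" by auto
  define k where "k = card (- R)"
  define P where "P = (\<lambda>Z. mixed_disc (\<lambda>s. if s \<in> R then cmat (mat 1) 0 else Z))"
  define W where "W = (\<lambda>d. cmat (d *\<^sub>R X) ((1 - d) *\<^sub>R mat 1 + d *\<^sub>R Y))"
  \<comment> \<open>\<open>W\<close> runs from \<open>i 1\<close> at \<open>d = 0\<close> to
    \<open>X + i Y\<close> at \<open>d = 1\<close>, and \<open>s\<close> is the homogenizing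
    coordinate: at \<open>s = 0\<close> only \<open>z A\<close> remains, where \<open>nz\<close> at
    \<open>t = 0\<close> applies.\<close>
  define M where "M = (\<lambda>d (s::real) z. (\<chi> i j. of_real s * W d $ i $ j + z * of_real (A $ i $ j)))"
  define H where "H = (\<lambda>d s z. P (M d s z))"
  have P_st: "P (cmat U V) \<noteq> 0" if "U \<in> symmetric_matrices" "V \<in> C" for U V
    using stabD[OF st that] by (simp add: P_def)
  have P_scale: "P Z = c ^ k * P Z'" if "\<And>i j. Z $ i $ j = c * Z' $ i $ j" for Z Z' c
    unfolding P_def k_def using that by (rule mixed_disc_scale_on)
  have P_real: "P (cmat (A + t *\<^sub>R mat 1) 0) \<noteq> 0" if "t \<ge> 0" for t
  proof -
    have "P (cmat (A + t *\<^sub>R mat 1) 0) = mixed_disc (\<lambda>s. cmat (if s \<in> R then mat 1 else A + t *\<^sub>R mat 1) 0)"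
      unfolding P_def by (intro arg_cong[where f = mixed_disc]) auto
    also have "\<dots> = of_real (mixed_disc (\<lambda>s. if s \<in> R then mat 1 else A + t *\<^sub>R mat 1))"
      by (rule mixed_disc_cmat_real)
    finally show ?thesis using nz[OF that] by simp
  qed
  have C_convex: "(1 - d) *\<^sub>R mat 1 + d *\<^sub>R Y \<in> C" if "d \<in> {0..1}" for d
    using that one Y C by (cases "d = 0 \<or> d = 1") (auto simp: sym_cone_def)
  have "H 1 1 (\<i> * of_real a) \<noteq> 0"
  proof (rule upper_half_plane_roots_homotopy[where H = H and k = k and m = k and c = "P (cmat A 0)"])
    have ent: "continuous_on UNIV (\<lambda>x. (\<lambda>(d, s, z). M d s z $ i $ j) x)" for i j
      unfolding M_def W_def split_beta by (simp add: Complex_eq) (intro continuous_intros)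
    then show "continuous_on UNIV (\<lambda>(d, s, z). H d s z)"
      unfolding H_def P_def split_beta
    proof (intro continuous_on_mixed_disc)
      fix r i j
      show "continuous_on UNIV (\<lambda>x. (if r \<in> R then cmat (mat 1) 0 else M (fst x) (fst (snd x)) (snd (snd x))) $ i $ j)"
        using ent[of i j] by (cases "r \<in> R") (auto simp: split_beta)
    qed
  next
    fix d s :: real and z :: complex assume "s > 0"
    then show "H d s z = of_real s ^ k * H d 1 (z / of_real s)"
      unfolding H_def by (intro P_scale) (simp add: M_def field_simps)
  next
    fix d :: real and z :: complex assume "d \<in> {0..1}" "z \<noteq> 0"
    have "H d 0 z = z ^ k * P (cmat (A + 0 *\<^sub>R mat 1) 0)"
      unfolding H_def by (intro P_scale) (simp add: M_def complex_eq_iff)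
    then show "H d 0 z \<noteq> 0" using P_real[of 0] \<open>z \<noteq> 0\<close> by simp
  next
    show c: "P (cmat A 0) \<noteq> 0" using P_real[of 0] by simp
    fix d :: real assume "d \<in> {0..1}"
    obtain q where q: "\<And>w Z. (\<And>i j. Z $ i $ j = W d $ i $ j + w * cmat A 0 $ i $ j) \<Longrightarrow>
        poly q w = mixed_disc (\<lambda>r. if r \<in> - R then Z else cmat (mat 1) 0)"
      and coeff: "\<And>m. coeff q m = (\<Sum>J | J \<subseteq> - R \<and> card J = m.
        mixed_disc (\<lambda>r. if r \<in> J then cmat A 0 else if r \<in> - R then W d else cmat (mat 1) 0))"
      using mixed_disc_pencil[of "W d" "cmat A 0" "- R" "\<lambda>_. cmat (mat 1) 0"] by blast
    have "coeff q m = 0" if m: "m > k" for m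
    proof -
      have "card J \<noteq> m" if "J \<subseteq> - R" for J
        using card_mono[OF finite that] m unfolding k_def by linarith
      then have "{J. J \<subseteq> - R \<and> card J = m} = {}" by blast
      then show ?thesis unfolding coeff by (simp only: sum.empty)
    qed
    then have "degree q \<le> k" by (intro degree_le) blast
    moreover have "coeff q k = P (cmat A 0)"
    proof -
      have "J = - R" if "J \<subseteq> - R" "card J = card (- R)" for J
        using that by (intro card_subset_eq) auto
      then have "{J. J \<subseteq> - R \<and> card J = k} = {- R}" unfolding k_def by auto
      then have "coeff q k = mixed_disc (\<lambda>r. if r \<in> - R then cmat A 0 else if r \<in> - R then W d else cmat (mat 1) 0)"
        unfolding coeff by simp
      also have "\<dots> = P (cmat A 0)"
        unfolding P_def by (intro arg_cong[where f = mixed_disc]) auto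
      finally show ?thesis .
    qed
    ultimately have "degree q = k \<and> lead_coeff q = P (cmat A 0)"
      using c le_degree[of q k] by auto
    moreover have "poly q z = H d 1 z" for z
    proof -
      have "poly q z = mixed_disc (\<lambda>r. if r \<in> - R then M d 1 z else cmat (mat 1) 0)"
        by (rule q) (simp add: M_def complex_eq_iff)
      also have "\<dots> = H d 1 z"
        unfolding H_def P_def by (intro arg_cong[where f = mixed_disc]) auto
      finally show ?thesis .
    qed
    ultimately show "\<exists>q. degree q = k \<and> lead_coeff q = P (cmat A 0) \<and> (\<forall>z. poly q z = H d 1 z)" by blast
  next
    fix d :: real and z :: complex assume d: "d \<in> {0..1}" and z: "Im z = 0"
    have "M d 1 z = cmat (d *\<^sub>R X + Re z *\<^sub>R A) ((1 - d) *\<^sub>R mat 1 + d *\<^sub>R Y)"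
      using z by (simp add: M_def W_def vec_eq_iff complex_eq_iff)
    moreover have "d *\<^sub>R X + Re z *\<^sub>R A \<in> symmetric_matrices" using X A by simp
    ultimately show "H d 1 z \<noteq> 0"
      using P_st C_convex[OF d] by (simp only: H_def not_False_eq_True)
  next
    fix z :: complex assume z: "0 \<le> Im z"
    show "H 0 1 z \<noteq> 0"
    proof (cases "z = 0")
      case True
      then have "M 0 1 z = cmat 0 (mat 1)"
        by (simp add: M_def W_def vec_eq_iff)
      then show ?thesis using P_st[OF _ one, of 0] by (simp add: H_def)
    next
      case False
      \<comment> \<open>Dividing \<open>i 1 + z A\<close> by \<open>z\<close> gives
        \<open>A + \<tau> 1\<close>. For nonreal \<tau> stability applies, after a change of sign if
        \<open>Im \<tau> < 0\<close>. A real \<tau> is positive because \<open>Im z \<ge> 0\<close>,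
        and then \<open>nz\<close> applies.\<close>
      define \<tau> where "\<tau> = \<i> / z"
      have z\<tau>: "z * \<tau> = \<i>" using False by (simp add: \<tau>_def)
      have nn: "\<tau> \<noteq> 0" using z\<tau> by auto
      define N where "N = (\<chi> i j. of_real (A $ i $ j) + \<tau> * of_real (mat 1 $ i $ j :: real))"
      have "H 0 1 z = z ^ k * P N"
        unfolding H_def
      proof (rule P_scale)
        fix i j
        have "M 0 1 z $ i $ j = \<i> * of_real (mat 1 $ i $ j :: real) + z * of_real (A $ i $ j)"
          by (simp add: M_def W_def complex_eq_iff)
        also have "\<dots> = z * N $ i $ j"
          unfolding z\<tau>[symmetric] N_def by (simp add: algebra_simps)
        finally show "M 0 1 z $ i $ j = z * N $ i $ j" .
      qed
      moreover have "P N \<noteq> 0"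
      proof (cases "Im \<tau>" "0::real" rule: linorder_cases)
        case less
        have "P N = (-1) ^ k * P (cmat (- (A + Re \<tau> *\<^sub>R mat 1)) ((- Im \<tau>) *\<^sub>R mat 1))"
          by (rule P_scale) (simp add: N_def complex_eq_iff)
        moreover have "(- Im \<tau>) *\<^sub>R mat 1 \<in> C"
          using less one C unfolding sym_cone_def by (metis neg_0_less_iff_less)
        moreover have "- (A + Re \<tau> *\<^sub>R mat 1) \<in> symmetric_matrices"
          using A by (intro symmetric_matrices_closed)
        ultimately show ?thesis using P_st by simp
      next
        case equal
        then have \<tau>: "\<tau> = of_real (Re \<tau>)" by (simp add: complex_eq_iff)
        have "Im z * Re \<tau> = 1" using z\<tau> equal by (simp add: complex_eq_iff)
        then have "Re \<tau> \<ge> 0" using z by (metis mult_nonneg_nonpos not_one_le_zero linorder_le_cases)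
        moreover have "N = cmat (A + Re \<tau> *\<^sub>R mat 1) 0"
          using equal by (simp add: N_def vec_eq_iff complex_eq_iff)
        ultimately show ?thesis using P_real by simp
      next
        case greater
        have "N = cmat (A + Re \<tau> *\<^sub>R mat 1) (Im \<tau> *\<^sub>R mat 1)"
          by (simp add: N_def vec_eq_iff complex_eq_iff)
        moreover have "Im \<tau> *\<^sub>R mat 1 \<in> C"
          using greater one C unfolding sym_cone_def by metis
        ultimately show ?thesis using A P_st[of "A + Re \<tau> *\<^sub>R mat 1" "Im \<tau> *\<^sub>R mat 1"] by simp
      qed
      ultimately show ?thesis using False by simp
    qed
  next
    show "0 \<le> Im (\<i> * of_real a)" using a by simp
  qed
  moreover have "M 1 1 (\<i> * of_real a) = cmat X Y'"
    by (simp add: M_def W_def Y' vec_eq_iff complex_eq_iff)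
  ultimately have "P (cmat X Y') \<noteq> 0" by (simp add: H_def)
  then show "mixed_disc (\<lambda>s. if s \<in> R then cmat (mat 1) 0 else cmat X Y') \<noteq> 0"
    by (simp add: P_def)
qed

text \<open>The shift \<open>t\<close> is strictly positive because an enlarged cone contains
  \<open>A\<close> only together with an element of the previous one, here
  \<open>t 1\<close>.\<close>

lemma stab_extend_finite:
  fixes F :: "(real ^ 'n ^ 'n) set"
  assumes "finite F"
    and "\<And>A. A \<in> F \<Longrightarrow> A \<in> symmetric_matrices"
    and "\<And>A t. A \<in> F \<Longrightarrow> t \<ge> 0 \<Longrightarrow> mixed_disc (\<lambda>s. if s \<in> R then mat 1 else A + t *\<^sub>R mat 1) \<noteq> 0"
  obtains C where "sym_cone C" "stab (\<lambda>_. mat 1) R C" "mat 1 \<in> C"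
    "\<And>A t. A \<in> F \<Longrightarrow> t > 0 \<Longrightarrow> A + t *\<^sub>R mat 1 \<in> C"
proof -
  have "\<exists>C. sym_cone C \<and> stab (\<lambda>_. mat 1) R C \<and> mat 1 \<in> C \<and>
    (\<forall>A\<in>F. \<forall>t>0. A + t *\<^sub>R mat 1 \<in> C)"
    using assms
  proof (induction F rule: finite_induct)
    case empty
    then show ?case
      using sym_cone_scalar stab_scalar mat_1_in_scalar_cone by blast
  next
    case (insert A F)
    then obtain C where C: "sym_cone C" "stab (\<lambda>_. mat 1) R C" "mat 1 \<in> C"
      "\<And>A t. A \<in> F \<Longrightarrow> t > 0 \<Longrightarrow> A + t *\<^sub>R mat 1 \<in> C"
      by auto
    let ?C = "{Y + a *\<^sub>R A | Y a. Y \<in> C \<and> a \<ge> 0}"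
    have CC: "Y \<in> ?C" if "Y \<in> C" for Y
      using that by (auto intro!: exI[of _ Y] exI[of _ "0::real"])
    have "A + t *\<^sub>R mat 1 \<in> ?C" if "t > 0" for t
      using that C(1,3) by (auto simp: sym_cone_def intro!: exI[of _ "t *\<^sub>R mat 1"] exI[of _ "1::real"])
    moreover have "stab (\<lambda>_. mat 1) R ?C"
      using insert.prems by (intro stab_extend C) auto
    moreover have "sym_cone ?C"
      using insert.prems by (intro sym_cone_add C) auto
    ultimately show ?case
      using CC C(3,4) by (intro exI[of _ ?C]) blast
  qed
  then show ?thesis using that by blast
qed

section \<open>Garding's inequality for mixed discriminants\<close>

text \<open>After a shift by \<open>e 1\<close> all arguments lie in one convex cone containing the
  identity, on which the mixed discriminant has no zero. It is 1 at the identity, hence positive at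
  the shifted arguments, and \<open>e\<close> tends to 0.\<close>

theorem mixed_disc_nonneg:
  fixes B :: "'n::finite \<Rightarrow> real ^ 'n ^ 'n"
  assumes sym: "\<And>s. s \<notin> R \<Longrightarrow> B s \<in> symmetric_matrices"
    and nz: "\<And>s t. s \<notin> R \<Longrightarrow> t > 0 \<Longrightarrow> mixed_disc (\<lambda>r. if r \<in> R then mat 1 else B s + t *\<^sub>R mat 1) \<noteq> 0"
  shows "0 \<le> mixed_disc (\<lambda>r. if r \<in> R then mat 1 else B r)"
proof -
  define f where "f = (\<lambda>e. mixed_disc (\<lambda>r. if r \<in> R then mat 1 else B r + e *\<^sub>R mat 1))"
  have pos: "f e > 0" if "e > 0" for e
  proof -
    \<comment> \<open>Half of \<open>e\<close> makes the nonvanishing condition hold from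
      \<open>t = 0\<close> on, as adjoining a matrix requires; the other half moves the shifted
      matrix into the enlarged cone.\<close>
    let ?F = "(\<lambda>s. B s + (e / 2) *\<^sub>R mat 1) ` (- R)"
    have "finite ?F" by simp
    moreover have "A \<in> symmetric_matrices" if "A \<in> ?F" for A
      using that sym by auto
    moreover have "mixed_disc (\<lambda>s. if s \<in> R then mat 1 else A + t *\<^sub>R mat 1) \<noteq> 0" if A: "A \<in> ?F" and t: "t \<ge> 0" for A t
    proof -
      obtain s where s: "s \<notin> R" "A = B s + (e / 2) *\<^sub>R mat 1" using A by auto
      then have "A + t *\<^sub>R mat 1 = B s + (e / 2 + t) *\<^sub>R mat 1"
        by (simp only: scaleR_add_left add.assoc)
      moreover have "e / 2 + t > 0" using t \<open>e > 0\<close> by simp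
      ultimately show ?thesis using nz[OF s(1)] by metis
    qed
    ultimately obtain C where C: "sym_cone C" "stab (\<lambda>_. mat 1) R C" "mat 1 \<in> C"
      "\<And>A t. A \<in> ?F \<Longrightarrow> t > 0 \<Longrightarrow> A + t *\<^sub>R mat 1 \<in> C"
      by (rule stab_extend_finite) blast+
    have BC: "B s + e *\<^sub>R mat 1 \<in> C" if "s \<notin> R" for s
    proof -
      have "B s + (e / 2) *\<^sub>R mat 1 + (e / 2) *\<^sub>R mat 1 \<in> C"
        using that \<open>e > 0\<close> by (intro C(4)) auto
      then show ?thesis by (simp add: add.assoc scaleR_add_left[symmetric])
    qed
    \<comment> \<open>The segments from the identity to \<open>B r + e 1\<close> stay in
      \<open>C\<close>. Freezing cone elements in all slots leaves no complex argument, so stability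
      shows that \<open>g\<close> has no zero on the unit interval.\<close>
    define g where "g = (\<lambda>t. mixed_disc (\<lambda>r. if r \<in> R then mat 1 else (1 - t) *\<^sub>R mat 1 + t *\<^sub>R (B r + e *\<^sub>R mat 1)))"
    have gnz: "g t \<noteq> 0" if "t \<in> {0..1}" for t
    proof -
      let ?b = "\<lambda>r. if r \<in> R then mat 1 else (1 - t) *\<^sub>R mat 1 + t *\<^sub>R (B r + e *\<^sub>R mat 1)"
      have b: "?b r \<in> C" for r
        using that BC[of r] C(1,3) by (cases "t = 0 \<or> t = 1") (auto simp: sym_cone_def)
      have "stab ?b R C"
        using C(2) unfolding stab_def by (simp cong: if_cong)
      then have "stab ?b (R \<union> - R) C"
        using C(1) b by (rule stab_union)
      then have "mixed_disc (\<lambda>s. if s \<in> R \<union> - R then cmat (?b s) 0 else cmat 0 (mat 1)) \<noteq> 0"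
        by (rule stabD) (use C(3) in auto)
      then have "mixed_disc (\<lambda>s. cmat (?b s) 0) \<noteq> 0" by simp
      then show ?thesis unfolding g_def mixed_disc_cmat_real by simp
    qed
    have cont: "continuous_on {0..1} g"
      unfolding g_def
    proof (intro continuous_on_mixed_disc)
      fix r i j
      show "continuous_on {0..1} (\<lambda>t. (if r \<in> R then mat 1 else (1 - t) *\<^sub>R mat 1 + t *\<^sub>R (B r + e *\<^sub>R mat 1)) $ i $ j)"
        by (cases "r \<in> R") (auto intro!: continuous_intros)
    qed
    have "g 0 = 1" by (simp add: g_def mixed_disc_diag cong: if_cong)
    have "g 1 > 0"
    proof (rule ccontr)
      assume "\<not> g 1 > 0"
      then obtain t where "0 \<le> t" "t \<le> 1" "g t = 0"
        using IVT2'[of g 1 0 0] cont \<open>g 0 = 1\<close> by auto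
      then show False using gnz by auto
    qed
    then show ?thesis by (simp add: g_def f_def cong: if_cong)
  qed
  have "continuous_on UNIV f"
    unfolding f_def
  proof (intro continuous_on_mixed_disc)
    fix r i j
    show "continuous_on UNIV (\<lambda>e. (if r \<in> R then mat 1 else B r + e *\<^sub>R mat 1) $ i $ j)"
      by (cases "r \<in> R") (auto intro!: continuous_intros)
  qed
  then have "(f \<longlongrightarrow> f 0) (at_right 0)"
    by (auto simp: continuous_on_eq_continuous_at isCont_def filterlim_at_split)
  then have "0 \<le> f 0"
    by (rule tendsto_lowerbound) (auto simp: eventually_at_right_less eventually_at_filter intro!: always_eventually less_imp_le pos)
  then show ?thesis by (simp add: f_def cong: if_cong)
qed

subsection \<open>Symmetric functions of eigenvalues as mixed discriminants\<close>

lemma monic_real_rooted_factorization: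
  fixes q :: "complex poly"
  assumes "finite S" "degree q = card S" "lead_coeff q = 1"
    and "\<And>z. poly q z = 0 \<Longrightarrow> z \<in> \<real>"
  shows "\<exists>l. \<forall>z. poly q z = (\<Prod>i\<in>S. z - of_real (l i))"
  using assms
proof (induction S arbitrary: q rule: finite_induct)
  case empty
  then obtain a where "q = [:a:]" by (metis card.empty degree_eq_zeroE)
  then show ?case using empty by simp
next
  case (insert s S)
  then have "\<not> constant (poly q)" by (simp add: constant_degree)
  then obtain r where r: "poly q r = 0"
    using fundamental_theorem_of_algebra by blast
  then obtain q' where q': "q = [:- r, 1:] * q'"
    using poly_eq_0_iff_dvd by (metis dvdE)
  have "q' \<noteq> 0" using insert.prems q' by auto
  then have "degree q = Suc (degree q')" unfolding q' by (subst degree_mult_eq) auto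
  moreover have "lead_coeff q = lead_coeff q'"
    unfolding q' by (subst lead_coeff_mult) simp
  ultimately obtain l where l: "\<And>z. poly q' z = (\<Prod>i\<in>S. z - of_real (l i))"
    using insert.IH[of q'] insert.prems insert.hyps by (auto simp: q')
  have rr: "of_real (Re r) = r" using insert.prems(3)[OF r] by simp
  have "poly q z = (\<Prod>i\<in>insert s S. z - of_real ((l(s := Re r)) i))" for z
  proof -
    have "(\<Prod>i\<in>S. z - of_real ((l(s := Re r)) i)) = (\<Prod>i\<in>S. z - of_real (l i))"
      using insert.hyps by (intro prod.cong) auto
    then show ?thesis using insert.hyps by (simp add: q' l rr left_diff_distrib)
  qed
  then show ?case by blast
qed

text \<open>By \<open>det_cmat_mat_nonzero\<close> the characteristic polynomial has no nonreal
  root, so it splits over the reals. This makes the choice in \<open>eigenvalue_vector\<close>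
  meaningful for symmetric matrices.\<close>

lemma symmetric_has_eigenvalue_vector:
  fixes A :: "real ^ 'n ^ 'n"
  assumes A: "A \<in> symmetric_matrices"
  shows "\<exists>l. is_eigenvalue_vector A l"
proof -
  obtain q where q: "\<And>w Z. (\<And>i j. Z $ i $ j = cmat (- A) 0 $ i $ j + w * cmat (mat 1) 0 $ i $ j) \<Longrightarrow>
      poly q w = mixed_disc (\<lambda>r::'n. if r \<in> UNIV then Z else 0)"
    and coeff: "\<And>m. coeff q m = (\<Sum>J | J \<subseteq> UNIV \<and> card J = m.
      mixed_disc (\<lambda>r::'n. if r \<in> J then cmat (mat 1) 0 else if r \<in> UNIV then cmat (- A) 0 else 0))"
    using mixed_disc_pencil[of "cmat (- A) 0" "cmat (mat 1) 0" "UNIV :: 'n set" "\<lambda>_. 0"] by blast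
  have qd: "poly q w = det Z" if "\<And>i j. Z $ i $ j = cmat (- A) 0 $ i $ j + w * cmat (mat 1) 0 $ i $ j" for w Z
    using q[OF that] by (simp add: mixed_disc_diag)
  have "coeff q m = 0" if m: "m > CARD('n)" for m
  proof -
    have "card J \<noteq> m" for J :: "'n set"
      using card_mono[of UNIV J] m by simp
    then have "{J. J \<subseteq> (UNIV::'n set) \<and> card J = m} = {}" by blast
    then show ?thesis unfolding coeff by (simp only: sum.empty)
  qed
  then have "degree q \<le> CARD('n)" by (intro degree_le) blast
  moreover have "coeff q (CARD('n)) = 1"
  proof -
    have "{J. J \<subseteq> (UNIV::'n set) \<and> card J = CARD('n)} = {UNIV}"
      using card_subset_eq[OF finite subset_UNIV] by auto
    then have "coeff q (CARD('n)) = mixed_disc (\<lambda>r::'n. cmat (mat 1) 0)"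
      unfolding coeff by simp
    also have "\<dots> = of_real (mixed_disc (\<lambda>r::'n. mat 1))"
      by (rule mixed_disc_cmat_real)
    finally show ?thesis by (simp add: mixed_disc_diag)
  qed
  ultimately have deg: "degree q = card (UNIV :: 'n set)" and lc: "lead_coeff q = 1"
    using le_degree[of q "CARD('n)"] by auto
  have "z \<in> \<real>" if "poly q z = 0" for z
  proof (rule ccontr)
    assume "z \<notin> \<real>"
    then have "Im z \<noteq> 0" by (simp add: complex_is_Real_iff)
    moreover have "poly q z = det (cmat (- A + Re z *\<^sub>R mat 1) (Im z *\<^sub>R mat 1))"
      by (rule qd) (simp add: complex_eq_iff)
    moreover have "- A + Re z *\<^sub>R mat 1 \<in> symmetric_matrices" using A by (intro symmetric_matrices_closed)
    ultimately show False using det_cmat_mat_nonzero that by metis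
  qed
  then obtain l where l: "\<And>z. poly q z = (\<Prod>i\<in>(UNIV::'n set). z - of_real (l i))"
    using monic_real_rooted_factorization[of "UNIV::'n set", OF finite deg lc] by blast
  have "det (mat t - A) = (\<Prod>i\<in>UNIV. t - (\<chi> i. l i) $ i)" for t
  proof -
    have "of_real (det (mat t - A)) = det (cmat (mat t - A) 0)"
      using mixed_disc_cmat_real[of "\<lambda>_::'n. mat t - A"] by (simp add: mixed_disc_diag)
    also have "\<dots> = poly q (of_real t)"
      by (rule qd[symmetric]) (simp add: complex_eq_iff mat_def)
    also have "\<dots> = of_real (\<Prod>i\<in>UNIV. t - (\<chi> i. l i) $ i)"
      by (simp add: l)
    finally show ?thesis by (simp only: of_real_eq_iff)
  qed
  then show ?thesis unfolding is_eigenvalue_vector_def by blast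
qed

text \<open>Compare the coefficients of \<open>s ^ k\<close> in \<open>det (1 + s A)\<close> and in
  the product of the factors \<open>1 + s l_i\<close>. On the matrix side the coefficient consists
  of \<open>n choose k\<close> equal mixed discriminants, which is exactly the normalization in
  \<open>S_vec\<close>.\<close>

lemma S_vec_eigenvalues_mixed_disc:
  fixes A :: "real ^ 'n ^ 'n"
  assumes l: "is_eigenvalue_vector A l" and k: "card (- R) = k"
  shows "S_vec k l = mixed_disc (\<lambda>r. if r \<in> R then mat 1 else A)"
proof -
  let ?n = "CARD('n)"
  have kn: "k \<le> ?n" unfolding k[symmetric] by (rule card_mono) auto
  obtain q where q: "\<And>w Z. (\<And>i j. Z $ i $ j = mat 1 $ i $ j + w * A $ i $ j) \<Longrightarrow>
      poly q w = mixed_disc (\<lambda>r::'n. if r \<in> UNIV then Z else 0)"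
    and coeff: "\<And>m. coeff q m = (\<Sum>J | J \<subseteq> UNIV \<and> card J = m.
      mixed_disc (\<lambda>r::'n. if r \<in> J then A else if r \<in> UNIV then mat 1 else 0))"
    using mixed_disc_pencil[of "mat 1" A "UNIV :: 'n set" "\<lambda>_. 0"] by blast
  define e where "e j = (\<Sum>J | J \<subseteq> UNIV \<and> card J = j. \<Prod>i\<in>J. l $ i)" for j
  define q' where "q' = (\<Sum>j\<le>?n. monom (e j) j)"
  have "poly q s = poly q' s" for s
  proof -
    have "poly q s = det (mat 1 + s *\<^sub>R A)"
      using q[of "mat 1 + s *\<^sub>R A" s] by (simp add: mixed_disc_diag)
    also have "\<dots> = (\<Prod>i\<in>UNIV. 1 + s * l $ i)"
    \<comment> \<open>For \<open>s \<noteq> 0\<close> the matrix \<open>1 + s A\<close> is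
      \<open>- s\<close> times \<open>mat (- 1 / s) - A\<close>, which brings in the characteristic
      polynomial.\<close>
    proof (cases "s = 0")
      case False
      have "mat 1 + s *\<^sub>R A = (\<chi> i. (- s) *s (mat (- 1 / s) - A) $ i)"
        using False by (auto simp: vec_eq_iff mat_def algebra_simps)
      then have "det (mat 1 + s *\<^sub>R A) = (\<Prod>i\<in>(UNIV::'n set). - s) * det (mat (- 1 / s) - A)"
        using det_rows_mul[of "\<lambda>_. - s" "\<lambda>i. (mat (- 1 / s) - A) $ i"] by (simp only: vec_lambda_eta)
      also have "\<dots> = (\<Prod>i\<in>UNIV. (- s) * (- 1 / s - l $ i))"
        using l unfolding is_eigenvalue_vector_def by (simp only: prod.distrib)
      also have "\<dots> = (\<Prod>i\<in>UNIV. 1 + s * l $ i)"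
        using False by (intro prod.cong) (auto simp: field_simps)
      finally show ?thesis .
    qed simp
    also have "\<dots> = (\<Prod>i\<in>UNIV. s * l $ i + 1)" by (simp add: add.commute)
    also have "\<dots> = (\<Sum>J\<in>Pow UNIV. s ^ card J * (\<Prod>i\<in>J. l $ i))"
      by (simp add: prod_add prod.distrib)
    also have "\<dots> = poly q' s"
      unfolding q'_def e_def by (subst sum_Pow_by_card) (simp_all add: poly_sum poly_monom)
    finally show ?thesis .
  qed
  then have qq': "q = q'" by (simp add: poly_eq_poly_eq_iff[symmetric] fun_eq_iff)
  have "coeff q k = e k" unfolding qq' unfolding q'_def coeff_sum_monom using kn by simp
  moreover have "coeff q k = (\<Sum>J | J \<subseteq> (UNIV::'n set) \<and> card J = k. mixed_disc (\<lambda>r. if r \<in> R then mat 1 else A))"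
    unfolding coeff
  proof (intro sum.cong refl)
    fix J :: "'n set" assume "J \<in> {J. J \<subseteq> UNIV \<and> card J = k}"
    then have "mixed_disc (\<lambda>r. if r \<in> J then A else mat 1) = mixed_disc (\<lambda>r. if r \<in> - R then A else mat 1)"
      using k by (intro mixed_disc_two_valued) auto
    also have "\<dots> = mixed_disc (\<lambda>r. if r \<in> R then mat 1 else A)"
      by (intro arg_cong[where f = mixed_disc]) auto
    finally show "mixed_disc (\<lambda>r. if r \<in> J then A else if r \<in> UNIV then mat 1 else 0) = mixed_disc (\<lambda>r. if r \<in> R then mat 1 else A)"
      by (simp cong: if_cong)
  qed
  moreover have "card {J. J \<subseteq> (UNIV::'n set) \<and> card J = k} = ?n choose k"
    by (rule n_subsets) simp
  ultimately have "e k = of_nat (?n choose k) * mixed_disc (\<lambda>r. if r \<in> R then mat 1 else A)"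
    by simp
  then show ?thesis
    using kn by (simp add: S_vec_def e_def binomial_fact)
qed

lemma S_mat_mixed_disc:
  fixes A :: "real ^ 'n ^ 'n"
  assumes "A \<in> symmetric_matrices" "card (- R) = k"
  shows "S_mat k A = mixed_disc (\<lambda>r. if r \<in> R then mat 1 else A)"
proof -
  have "is_eigenvalue_vector A (eigenvalue_vector A)"
    unfolding eigenvalue_vector_def
    using symmetric_has_eigenvalue_vector[OF assms(1)] by (rule someI_ex)
  then show ?thesis unfolding S_mat_def using assms(2) by (rule S_vec_eigenvalues_mixed_disc)
qed

subsection \<open>The Garding cone\<close>

text \<open>The matrix form of \<Gamma>_k: by \<open>S_mat_mixed_disc\<close> the conditions say
  that \<open>S_mat j A \<ge> 0\<close> for \<open>j \<le> k\<close>. These are, up to positive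
  factors, the coefficients of \<open>t\<close> in \<open>S_mat k (A + t 1)\<close>.\<close>

definition k_positive :: "nat \<Rightarrow> real ^ 'n ^ 'n \<Rightarrow> bool" where
  "k_positive k A \<longleftrightarrow> A \<in> symmetric_matrices \<and>
     (\<forall>R. card (- R) \<le> k \<longrightarrow> 0 \<le> mixed_disc (\<lambda>r. if r \<in> R then mat 1 else A))"

lemma k_positive_Gamma_cone:
  fixes A :: "real ^ 'n ^ 'n"
  assumes "A \<in> symmetric_matrices" "eigenvalue_vector A \<in> Gamma_cone k"
  shows "k_positive k A"
  unfolding k_positive_def
proof (intro conjI allI impI assms(1))
  fix R :: "'n set" assume R: "card (- R) \<le> k"
  show "0 \<le> mixed_disc (\<lambda>r. if r \<in> R then mat 1 else A)"
  proof (cases "R = UNIV")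
    case True
    then show ?thesis by (simp add: mixed_disc_diag)
  next
    case False
    then have "card (- R) \<in> {1..k}" using R by (auto simp: Suc_le_eq card_gt_0_iff)
    then have "0 \<le> S_vec (card (- R)) (eigenvalue_vector A)"
      using assms(2) by (auto simp: Gamma_cone_def)
    then show ?thesis
      using S_mat_mixed_disc[OF assms(1) refl, of R] by (simp add: S_mat_def)
  qed
qed

text \<open>With \<open>B s + t 1\<close> in all free slots, the expansion in \<open>t\<close> has
  nonnegative coefficients and top coefficient 1, so it is positive for \<open>t > 0\<close>. This
  is the nonvanishing condition of \<open>mixed_disc_nonneg\<close>.\<close>

lemma mixed_disc_nonneg_k_positive:
  fixes B :: "'n::finite \<Rightarrow> real ^ 'n ^ 'n"
  assumes B: "\<And>s. s \<notin> R \<Longrightarrow> k_positive k (B s)" and R: "card (- R) \<le> k"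
  shows "0 \<le> mixed_disc (\<lambda>r. if r \<in> R then mat 1 else B r)"
proof (rule mixed_disc_nonneg)
  show "B s \<in> symmetric_matrices" if "s \<notin> R" for s
    using B[OF that] by (simp add: k_positive_def)
next
  fix s t assume s: "s \<notin> R" and t: "(t::real) > 0"
  let ?g = "\<lambda>J. mixed_disc (\<lambda>r. if r \<in> J then mat 1 else if r \<in> - R then B s else mat 1)"
  have "mixed_disc (\<lambda>r. if r \<in> - R then B s + t *\<^sub>R mat 1 else mat 1) = (\<Sum>J\<in>Pow (- R). t ^ card J * ?g J)"
    by (rule multiaffine_expand[where V = UNIV]) (auto simp del: fun_upd_apply intro: mixed_disc_slot)
  moreover have "0 < (\<Sum>J\<in>Pow (- R). t ^ card J * ?g J)"
  proof (rule sum_pos2[of _ "- R"])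
    have "?g (- R) = mixed_disc (\<lambda>r::'n. mat 1 :: real ^ 'n ^ 'n)"
      by (simp cong: if_cong)
    then show "0 < t ^ card (- R) * ?g (- R)" using t by (simp add: mixed_disc_diag)
  next
    fix J assume J: "J \<in> Pow (- R)"
    have "?g J = mixed_disc (\<lambda>r. if r \<in> R \<union> J then mat 1 else B s)"
      by (intro arg_cong[where f = mixed_disc]) auto
    moreover have "card (- (R \<union> J)) \<le> card (- R)" by (intro card_mono) auto
    then have "0 \<le> mixed_disc (\<lambda>r. if r \<in> R \<union> J then mat 1 else B s)"
      using B[OF s] R unfolding k_positive_def by (meson order_trans)
    ultimately have "0 \<le> ?g J" by (simp only:)
    then show "0 \<le> t ^ card J * ?g J" using t by simp
  qed auto
  moreover have "(\<lambda>r. if r \<in> - R then B s + t *\<^sub>R mat 1 else mat 1) = (\<lambda>r. if r \<in> R then mat 1 else B s + t *\<^sub>R mat 1)"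
    by auto
  ultimately show "mixed_disc (\<lambda>r. if r \<in> R then mat 1 else B s + t *\<^sub>R mat 1) \<noteq> 0"
    by simp
qed

text \<open>The right-hand side is the trace of \<open>A\<close> divided by \<open>n\<close>. It
  stays a sum over permutations because only its sign matters later.\<close>

lemma mixed_disc_single:
  fixes A :: "'a::field_char_0 ^ 'n ^ 'n"
  shows "mixed_disc (\<lambda>r. if r = a then A else mat 1) = (\<Sum>p | p permutes (UNIV::'n set). A $ p a $ p a) / fact CARD('n)"
proof -
  have "(\<Sum>q | q permutes (UNIV::'n set). of_int (sign p) * of_int (sign q) * (\<Prod>j\<in>UNIV. (if j = a then A else mat 1) $ p j $ q j)) = A $ p a $ p a"
    (is "?L = _") if p: "p permutes (UNIV :: 'n set)" for p
  proof -
    have 0: "(\<Prod>j\<in>UNIV. (if j = a then A else mat 1) $ p j $ q j) = 0" if q: "q permutes UNIV" "q \<noteq> p" for q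
    proof -
      have "\<exists>j. j \<noteq> a \<and> p j \<noteq> q j"
      proof (rule ccontr)
        assume "\<not> ?thesis"
        then have eq: "p j = q j" if "j \<noteq> a" for j using that by blast
        obtain b where b: "q b = p a" using q(1) by (metis permutes_def)
        have "b = a" using eq[of b] b permutes_inj[OF p] by (metis injD)
        then have "p = q" using eq b by (auto simp: fun_eq_iff) metis
        then show False using q by simp
      qed
      then obtain j where "j \<noteq> a" "p j \<noteq> q j" by blast
      then have "(if j = a then A else mat 1) $ p j $ q j = 0" by (simp add: mat_def)
      then show ?thesis by (intro prod_zero[OF finite] bexI[of _ j]) auto
    qed
    have "?L = (\<Sum>q\<in>{p}. of_int (sign p) * of_int (sign q) * (\<Prod>j\<in>UNIV. (if j = a then A else mat 1) $ p j $ q j))"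
      using p 0 by (intro sum.mono_neutral_right) auto
    also have "\<dots> = (of_int (sign p) * of_int (sign p)) * (\<Prod>j\<in>UNIV. (if j = a then A else mat 1) $ p j $ p j)"
      by simp
    also have "\<dots> = (\<Prod>j\<in>UNIV. if j = a then A $ p a $ p a else 1)"
      by (simp only: of_int_mult[symmetric] sign_idempotent of_int_1 mult_1_left) (intro prod.cong, auto simp: mat_def)
    finally show ?thesis by simp
  qed
  then show ?thesis by (simp add: mixed_disc_expand)
qed

text \<open>With the rank-one matrix in two slots, each determinant in \<open>mixed_disc\<close> has
  two rows proportional to \<xi>; with it in one slot the value is a nonnegative trace. This gives
  the positivity of the energy form.\<close>

lemma k_positive_rank_one:
  fixes \<xi> :: "real ^ 'n"
  shows "k_positive k (\<chi> i j. \<xi> $ i * \<xi> $ j)"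
  unfolding k_positive_def
proof (intro conjI allI impI)
  let ?A = "\<chi> i j. \<xi> $ i * \<xi> $ j"
  show "?A \<in> symmetric_matrices" by (simp add: symmetric_matrices_nth)
  fix R :: "'n set"
  consider "R = UNIV" | a where "- R = {a}" | a b where "a \<noteq> b" "a \<notin> R" "b \<notin> R"
    by blast
  then show "0 \<le> mixed_disc (\<lambda>r. if r \<in> R then mat 1 else ?A)"
  proof cases
    case 1
    then show ?thesis by (simp add: mixed_disc_diag)
  next
    case 2
    then have "r \<in> R \<longleftrightarrow> r \<noteq> a" for r by blast
    then have "(\<lambda>r. if r \<in> R then mat 1 else ?A) = (\<lambda>r. if r = a then ?A else mat 1)" by (simp add: fun_eq_iff)
    then show ?thesis by (simp add: mixed_disc_single sum_nonneg)
  next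
    case 3
    have "det (\<chi> r. (if r \<in> R then mat 1 else ?A) $ p r) = 0" for p
    proof -
      let ?c = "\<lambda>r. if r \<in> R then 1 else \<xi> $ p r" and ?N = "\<lambda>r. if r \<in> R then mat 1 $ p r else \<xi>"
      have "(\<chi> r. (if r \<in> R then mat 1 else ?A) $ p r) = (\<chi> r. ?c r *s ?N r)"
        by (auto simp: vec_eq_iff)
      moreover have "det (\<chi> r. ?N r) = 0"
        using 3 by (intro det_identical_rows[of a b]) (auto simp: row_def)
      ultimately show ?thesis by (simp only: det_rows_mul mult_zero_right)
    qed
    then show ?thesis by (simp add: mixed_disc_def)
  qed
qed

subsection \<open>Complete polarization\<close>

text \<open>Links the arguments of a polarization, numbered from 1 to \<open>k\<close>, with the
  slots of a mixed discriminant, which are indexed by \<open>'n\<close>.\<close>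

definition slot_index :: "'n::finite \<Rightarrow> nat" where
  "slot_index = (SOME f. bij_betw f UNIV {1..CARD('n)})"

lemma bij_slot_index: "bij_betw (slot_index :: 'n::finite \<Rightarrow> nat) UNIV {1..CARD('n::finite)}"
proof -
  have "\<exists>f. bij_betw f (UNIV :: 'n::finite set) {1..CARD('n::finite)}"
    by (intro finite_same_card_bij) auto
  then show ?thesis unfolding slot_index_def by (rule someI_ex)
qed

lemma slot_index_eq_iff: "slot_index s = slot_index t \<longleftrightarrow> s = t"
  using bij_slot_index by (auto simp: bij_betw_def inj_def)

lemma slot_index_ge_1: "1 \<le> slot_index (s :: 'n::finite)"
  using bij_betw_apply[OF bij_slot_index, of s] by simp

definition free_slots :: "nat \<Rightarrow> 'n::finite set" where
  "free_slots k = {s. k < slot_index s}"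

lemma slot_of_index:
  assumes "i \<in> {1..k}" "k \<le> CARD('n::finite)"
  obtains s :: "'n::finite" where "slot_index s = i" "s \<notin> free_slots k"
proof -
  have "i \<in> {1..CARD('n)}" using assms by auto
  then obtain s :: 'n where "slot_index s = i"
    using bij_slot_index[where 'n = 'n] unfolding bij_betw_def by (metis imageE)
  then show ?thesis using that assms by (auto simp: free_slots_def)
qed

lemma card_slots:
  assumes "k \<le> CARD('n::finite)"
  shows "card (- (free_slots k :: 'n::finite set)) = k"
proof -
  have "slot_index ` (- (free_slots k) :: 'n set) = {1..k}"
  proof (intro equalityI subsetI)
    fix i assume "i \<in> slot_index ` (- (free_slots k) :: 'n set)"
    then obtain s :: 'n where "i = slot_index s" "s \<notin> free_slots k" by blast
    then show "i \<in> {1..k}" using slot_index_ge_1[of s] by (simp add: free_slots_def)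
  next
    fix i assume "i \<in> {1..k}"
    then obtain s :: 'n where "slot_index s = i" "s \<notin> free_slots k"
      using assms by (rule slot_of_index)
    then show "i \<in> slot_index ` (- (free_slots k) :: 'n set)" by blast
  qed
  moreover have "inj_on slot_index (- (free_slots k) :: 'n set)"
    by (simp add: inj_on_def slot_index_eq_iff)
  ultimately show ?thesis by (metis card_image card_atLeastAtMost diff_Suc_1)
qed

definition k_form :: "nat \<Rightarrow> (nat \<Rightarrow> real ^ 'n ^ 'n) \<Rightarrow> real" where
  "k_form k A = mixed_disc (\<lambda>s. if s \<in> free_slots k then mat 1 else A (slot_index s))"

lemma mixed_disc_slot_linear:
  fixes A :: "'n::finite \<Rightarrow> real ^ 'n ^ 'n"
  shows "mixed_disc (A(s := a *\<^sub>R X + b *\<^sub>R Y)) = a * mixed_disc (A(s := X)) + b * mixed_disc (A(s := Y))"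
proof -
  have "mixed_disc (A(s := 0)) = mixed_disc (A(s := 0)) + 1 * mixed_disc (A(s := 0))"
    by (rule mixed_disc_slot) simp
  then have 0: "mixed_disc (A(s := 0)) = 0" by simp
  have "mixed_disc (A(s := a *\<^sub>R X)) = mixed_disc (A(s := 0)) + a * mixed_disc (A(s := X))"
    by (rule mixed_disc_slot) simp
  moreover have "mixed_disc (A(s := a *\<^sub>R X + b *\<^sub>R Y)) = mixed_disc (A(s := a *\<^sub>R X)) + b * mixed_disc (A(s := Y))"
    by (rule mixed_disc_slot) simp
  ultimately show ?thesis using 0 by simp
qed

lemma k_form_upd:
  fixes A :: "nat \<Rightarrow> real ^ 'n ^ 'n"
  assumes "s \<notin> free_slots k"
  shows "k_form k (A(slot_index s := X)) =
    mixed_disc ((\<lambda>s. if s \<in> free_slots k then mat 1 else A (slot_index s))(s := X))"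
  unfolding k_form_def using assms
  by (intro arg_cong[where f = mixed_disc]) (auto simp: fun_eq_iff slot_index_eq_iff)

text \<open>A permutation of the numbers up to \<open>k\<close>, fixing all other numbers, is
  carried to a permutation of all slots that preserves the set of slots holding the
  identity.\<close>

lemma k_form_permute:
  fixes A :: "nat \<Rightarrow> real ^ 'n ^ 'n"
  assumes "k \<le> CARD('n)" "p permutes {1..k}"
  shows "k_form k (A \<circ> p) = k_form k A"
proof -
  let ?i = "slot_index :: 'n \<Rightarrow> nat"
  define p' where "p' = inv ?i \<circ> p \<circ> ?i"
  have inj: "inj ?i" by (simp add: inj_def slot_index_eq_iff)
  have "p permutes {1..CARD('n)}" using assms by (auto intro: permutes_subset)
  then have b: "bij_betw p {1..CARD('n)} {1..CARD('n)}" by (rule permutes_imp_bij)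
  have ip: "?i (p' s) = p (?i s)" for s
  proof -
    have "p (?i s) \<in> range ?i"
      using b bij_slot_index[where 'n = 'n] by (metis bij_betw_apply bij_betw_imp_surj_on UNIV_I)
    then show ?thesis by (simp add: p'_def f_inv_into_f)
  qed
  have "inj p'"
    using permutes_inj[OF assms(2)] inj ip by (metis injD injI)
  then have "p' permutes UNIV" by (auto intro!: bij_imp_permutes simp: bij_def finite_UNIV_inj_surj)
  then have "mixed_disc ((\<lambda>s. if s \<in> free_slots k then mat 1 else A (slot_index s)) \<circ> p') = k_form k A"
    unfolding k_form_def by (rule mixed_disc_permute)
  moreover have "((\<lambda>s. if s \<in> free_slots k then mat 1 else A (slot_index s)) \<circ> p')
     = (\<lambda>s. if s \<in> free_slots k then mat 1 else (A \<circ> p) (slot_index s))"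
  proof
    fix s :: 'n
    have "p (?i s) \<le> k \<longleftrightarrow> ?i s \<le> k"
      using permutes_in_image[OF assms(2), of "?i s"] slot_index_ge_1[of s]
        permutes_not_in[OF assms(2), of "?i s"] by (cases "?i s \<le> k") auto
    then show "((\<lambda>s. if s \<in> free_slots k then mat 1 else A (slot_index s)) \<circ> p') s
      = (if s \<in> free_slots k then mat 1 else (A \<circ> p) (slot_index s))"
      by (simp add: ip free_slots_def not_le[symmetric])
  qed
  ultimately show ?thesis by (simp add: k_form_def)
qed

lemma k_form_is_complete_polarization:
  assumes "k \<le> CARD('n::finite)"
  shows "is_complete_polarization k (S_mat k) (k_form k :: (nat \<Rightarrow> real ^ 'n::finite ^ 'n) \<Rightarrow> real)"
  unfolding is_complete_polarization_def
proof (intro conjI allI impI ballI)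
  fix A B :: "nat \<Rightarrow> real ^ 'n ^ 'n" assume *: "\<forall>i\<in>{1..k}. A i = B i"
  have "A (slot_index s) = B (slot_index s)" if "s \<notin> free_slots k" for s :: 'n
    using * that slot_index_ge_1[of s] by (auto simp: free_slots_def)
  then show "k_form k A = k_form k B"
    unfolding k_form_def by (intro arg_cong[where f = mixed_disc]) auto
next
  fix A :: "nat \<Rightarrow> real ^ 'n ^ 'n" and p
  assume "(\<forall>i\<in>{1..k}. A i \<in> symmetric_matrices) \<and> p permutes {1..k}"
  then show "k_form k (A \<circ> p) = k_form k A" using assms k_form_permute by blast
next
  fix A :: "nat \<Rightarrow> real ^ 'n ^ 'n" and i X Y and a b :: real assume "i \<in> {1..k}"
  then obtain s :: 'n where s: "slot_index s = i" "s \<notin> free_slots k"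
    using assms by (rule slot_of_index)
  show "k_form k (A(i := a *\<^sub>R X + b *\<^sub>R Y)) = a * k_form k (A(i := X)) + b * k_form k (A(i := Y))"
    unfolding s(1)[symmetric] k_form_upd[OF s(2)] by (rule mixed_disc_slot_linear)
next
  fix X :: "real ^ 'n ^ 'n" assume "X \<in> symmetric_matrices"
  then show "k_form k (\<lambda>_. X) = S_mat k X"
    unfolding k_form_def by (rule S_mat_mixed_disc[symmetric]) (rule card_slots[OF assms])
qed

text \<open>The linear coefficient has \<open>Y\<close> in exactly one of the slots after
  \<open>m\<close>, and by symmetry all \<open>k - m\<close> choices give the same value. Comparing
  it for two polarizations fixes one more argument.\<close>

lemma complete_polarization_expand:
  fixes F :: "(nat \<Rightarrow> real ^ 'n ^ 'n) \<Rightarrow> real"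
  assumes F: "is_complete_polarization k f F" and m: "m < k"
    and A: "\<And>i. A i \<in> symmetric_matrices" and X: "X \<in> symmetric_matrices" and Y: "Y \<in> symmetric_matrices"
  obtains c where "\<And>t. F (\<lambda>i. if i \<le> m then A i else X + t *\<^sub>R Y) = (\<Sum>j\<le>k - m. c j * t ^ j)"
    and "c 1 = real (k - m) * F (\<lambda>i. if i \<le> m then A i else if i = Suc m then Y else X)"
proof -
  let ?T = "{Suc m..k}"
  let ?g = "\<lambda>J. F (\<lambda>r. if r \<in> J then Y else if r \<in> ?T then X else A r)"
  define c where "c j = (\<Sum>J | J \<subseteq> ?T \<and> card J = j. ?g J)" for j
  have dep: "F A = F B" if "\<And>i. i \<in> {1..k} \<Longrightarrow> A i = B i" for A B
    using F[unfolded is_complete_polarization_def, THEN conjunct1] that by simp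
  have perm: "F (A \<circ> p) = F A" if "\<And>i. i \<in> {1..k} \<Longrightarrow> A i \<in> symmetric_matrices" "p permutes {1..k}" for A p
    using F[unfolded is_complete_polarization_def, THEN conjunct2, THEN conjunct1] that by simp
  have lin: "F (A(i := a *\<^sub>R X + b *\<^sub>R Y)) = a * F (A(i := X)) + b * F (A(i := Y))"
    if "\<And>i. A i \<in> symmetric_matrices" "i \<in> {1..k}" "X \<in> symmetric_matrices" "Y \<in> symmetric_matrices" for A i X Y a b
    using F[unfolded is_complete_polarization_def, THEN conjunct2, THEN conjunct2, THEN conjunct1] that by simp
  have "F (\<lambda>i. if i \<le> m then A i else X + t *\<^sub>R Y) = (\<Sum>j\<le>k - m. c j * t ^ j)" for t
  proof -
    have "F (\<lambda>i. if i \<le> m then A i else X + t *\<^sub>R Y) = F (\<lambda>i. if i \<in> ?T then X + t *\<^sub>R Y else A i)"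
      by (rule dep) auto
    also have "\<dots> = (\<Sum>J\<in>Pow ?T. t ^ card J * ?g J)"
    proof (rule multiaffine_expand[where V = symmetric_matrices])
      fix B :: "nat \<Rightarrow> real ^ 'n ^ 'n" and s assume "s \<in> ?T" and B: "\<And>r. B r \<in> symmetric_matrices"
      then have "s \<in> {1..k}" by auto
      then show "F (B(s := X + t *\<^sub>R Y)) = F (B(s := X)) + t * F (B(s := Y))"
        using lin[where A = B and i = s and X = X and Y = Y and a = 1 and b = t] B X Y by simp
    qed (use A X Y in auto)
    also have "\<dots> = (\<Sum>j\<le>k - m. c j * t ^ j)"
      unfolding c_def by (subst sum_Pow_by_card) auto
    finally show ?thesis .
  qed
  moreover have "c 1 = real (k - m) * F (\<lambda>i. if i \<le> m then A i else if i = Suc m then Y else X)"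
  proof -
    have "c 1 = (\<Sum>s\<in>?T. ?g {s})"
      unfolding c_def One_nat_def subsets_card_1 by (subst sum.reindex) (auto simp: inj_on_def)
    also have "\<dots> = (\<Sum>s\<in>?T. F (\<lambda>i. if i \<le> m then A i else if i = Suc m then Y else X))"
    proof (intro sum.cong refl)
      fix s assume s: "s \<in> ?T"
      let ?B = "\<lambda>i. if i \<le> m then A i else if i = Suc m then Y else X"
      let ?p = "Transposition.transpose s (Suc m)"
      have "?g {s} = F (?B \<circ> ?p)"
        using s by (intro dep) (auto simp: Transposition.transpose_def)
      also have "\<dots> = F ?B"
        using s A X Y by (intro perm permutes_swap_id) auto
      finally show "?g {s} = F ?B" .
    qed
    finally show ?thesis using m by simp
  qed
  ultimately show ?thesis by (rule that)
qed

text \<open>Induction on the number \<open>m\<close> of prescribed arguments, the others being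
  equal. If two forms agree at \<open>X + t Y\<close> for all \<open>t\<close>, their linear
  coefficients agree, which turns one of the equal arguments into the prescribed
  \<open>Y\<close>.\<close>

lemma complete_polarization_unique:
  fixes F F' :: "(nat \<Rightarrow> real ^ 'n ^ 'n) \<Rightarrow> real"
  assumes F: "is_complete_polarization k f F" and F': "is_complete_polarization k f F'"
    and A: "\<And>i. i \<in> {1..k} \<Longrightarrow> A i \<in> symmetric_matrices"
  shows "F A = F' A"
proof -
  have Q: "F (\<lambda>i. if i \<le> m then A i else X) = F' (\<lambda>i. if i \<le> m then A i else X)"
    if "m \<le> k" "X \<in> symmetric_matrices" "\<And>i. A i \<in> symmetric_matrices" for m A X
    using that
  proof (induction m arbitrary: A X)
    case 0
    have "F (\<lambda>i. if i \<le> 0 then A i else X) = F (\<lambda>_. X)"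
      using F unfolding is_complete_polarization_def by auto
    moreover have "F' (\<lambda>i. if i \<le> 0 then A i else X) = F' (\<lambda>_. X)"
      using F' unfolding is_complete_polarization_def by auto
    ultimately show ?case
      using F F' 0 unfolding is_complete_polarization_def by auto
  next
    case (Suc m)
    then have m: "m < k" by simp
    let ?Y = "A (Suc m)"
    obtain c where c: "\<And>t. F (\<lambda>i. if i \<le> m then A i else X + t *\<^sub>R ?Y) = (\<Sum>j\<le>k - m. c j * t ^ j)"
      "c 1 = real (k - m) * F (\<lambda>i. if i \<le> m then A i else if i = Suc m then ?Y else X)"
      using complete_polarization_expand[OF F m, where A = A and X = X and Y = ?Y, OF Suc.prems(3) Suc.prems(2) Suc.prems(3)] by blast
    obtain c' where c': "\<And>t. F' (\<lambda>i. if i \<le> m then A i else X + t *\<^sub>R ?Y) = (\<Sum>j\<le>k - m. c' j * t ^ j)"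
      "c' 1 = real (k - m) * F' (\<lambda>i. if i \<le> m then A i else if i = Suc m then ?Y else X)"
      using complete_polarization_expand[OF F' m, where A = A and X = X and Y = ?Y, OF Suc.prems(3) Suc.prems(2) Suc.prems(3)] by blast
    have "(\<Sum>j\<le>k - m. c j * t ^ j) = (\<Sum>j\<le>k - m. c' j * t ^ j)" for t
      unfolding c(1)[symmetric] c'(1)[symmetric]
      using m Suc.prems by (intro Suc.IH) auto
    then have "c 1 = c' 1"
      using polyfun_eq_coeffs[of c "k - m" c'] m by auto
    then have "F (\<lambda>i. if i \<le> m then A i else if i = Suc m then ?Y else X) =
      F' (\<lambda>i. if i \<le> m then A i else if i = Suc m then ?Y else X)"
      using c(2) c'(2) m by simp
    moreover have "(\<lambda>i. if i \<le> m then A i else if i = Suc m then ?Y else X) = (\<lambda>i. if i \<le> Suc m then A i else X)"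
      by (auto simp: le_Suc_eq)
    ultimately show ?case by simp
  qed
  \<comment> \<open>The induction treats sequences that are symmetric everywhere; outside the
    relevant indices the values are set to 0.\<close>
  let ?A = "\<lambda>i. if i \<in> {1..k} then A i else 0"
  have "F A = F (\<lambda>i. if i \<le> k then ?A i else 0)"
    using F unfolding is_complete_polarization_def by auto
  also have "\<dots> = F' (\<lambda>i. if i \<le> k then ?A i else 0)"
    using A by (intro Q) auto
  also have "\<dots> = F' A"
    using F' unfolding is_complete_polarization_def by auto
  finally show ?thesis .
qed

theorem S_pol_eq_k_form:
  fixes A :: "nat \<Rightarrow> real ^ 'n ^ 'n"
  assumes "k \<le> CARD('n)" "\<And>i. i \<in> {1..k} \<Longrightarrow> A i \<in> symmetric_matrices"
  shows "S_pol k A = k_form k A"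
proof -
  have "is_complete_polarization k (S_mat k) (S_pol k :: (nat \<Rightarrow> real ^ 'n ^ 'n) \<Rightarrow> real)"
    unfolding S_pol_def using k_form_is_complete_polarization[OF assms(1)] by (rule someI[of "is_complete_polarization k (S_mat k)"])
  then show ?thesis
    using complete_polarization_unique[OF _ k_form_is_complete_polarization[OF assms(1)]] assms(2) by blast
qed

subsection \<open>The Jacobian as a null Lagrangian\<close>

lemma det_mat_1_add_scaleR:
  fixes A :: "real ^ 'n ^ 'n"
  shows "det (mat 1 + t *\<^sub>R A) =
    (\<Sum>m\<le>CARD('n). (\<Sum>J | J \<subseteq> (UNIV::'n set) \<and> card J = m. mixed_disc (\<lambda>r. if r \<in> J then A else mat 1)) * t ^ m)"
proof -
  have "mixed_disc (\<lambda>r::'n. if r \<in> UNIV then mat 1 + t *\<^sub>R A else 0) =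
    (\<Sum>J\<in>Pow (UNIV::'n set). t ^ card J * mixed_disc (\<lambda>r. if r \<in> J then A else if r \<in> UNIV then mat 1 else 0))"
    by (rule multiaffine_expand[where V = UNIV]) (auto simp del: fun_upd_apply intro: mixed_disc_slot)
  then show ?thesis by (subst (asm) sum_Pow_by_card) (simp_all add: mixed_disc_diag cong: if_cong)
qed

text \<open>The determinant is 1 at parameter 0 and cannot vanish on the way, as the perturbation
  strictly contracts norms.\<close>

lemma det_mat_1_add_scaleR_pos:
  fixes A :: "real ^ 'n ^ 'n"
  assumes A: "\<And>h. norm (A *v h) \<le> L * norm h" and t: "0 \<le> t" "t * L < 1"
  shows "0 < det (mat 1 + t *\<^sub>R A)"
proof -
  let ?g = "\<lambda>s. det (mat 1 + s *\<^sub>R A)"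
  have nz: "?g s \<noteq> 0" if s: "s \<in> {0..t}" for s
  proof -
    have "v = 0" if v: "(mat 1 + s *\<^sub>R A) *v v = 0" for v
    proof (rule ccontr)
      assume "v \<noteq> 0"
      have "v + s *\<^sub>R (A *v v) = 0"
        using v by (simp add: matrix_vector_mult_add_rdistrib scaleR_matrix_vector_assoc)
      then have "norm v = norm (s *\<^sub>R (A *v v))"
        by (metis add_eq_0_iff norm_minus_cancel)
      also have "\<dots> \<le> s * (L * norm v)" using A[of v] s by (simp add: mult_left_mono)
      also have "\<dots> \<le> (t * L) * norm v"
      proof -
        have "0 \<le> L * norm v" using A[of v] norm_ge_zero order_trans by blast
        then show ?thesis using s by (simp add: mult.assoc mult_right_mono)
      qed
      also have "\<dots> < 1 * norm v" using t \<open>v \<noteq> 0\<close> by (intro mult_strict_right_mono) auto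
      finally show False by simp
    qed
    then have "\<exists>B. B ** (mat 1 + s *\<^sub>R A) = mat 1"
      unfolding matrix_left_invertible_ker by blast
    then show ?thesis by (simp add: invertible_left_inverse invertible_det_nz[symmetric])
  qed
  have cont: "continuous_on {0..t} ?g"
    unfolding det_mat_1_add_scaleR by (intro continuous_intros)
  show ?thesis
  proof (rule ccontr)
    assume "\<not> 0 < ?g t"
    then obtain s where "0 \<le> s" "s \<le> t" "?g s = 0"
      using IVT2'[of ?g t 0 0] cont t(1) by auto
    then show False using nz by auto
  qed
qed

text \<open>Solving \<open>x + t f(x) = y\<close> is a fixed point problem for the contraction
  sending \<open>x\<close> to \<open>y - t f(x)\<close>, so the map is a bijection of the whole
  space. It is the identity off \<open>S\<close>, hence must map \<open>S\<close> onto
  itself.\<close>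

lemma lipschitz_perturbation_image:
  fixes f :: "'a::euclidean_space \<Rightarrow> 'a"
  assumes lip: "\<And>x y. norm (f x - f y) \<le> L * norm (x - y)" and t: "0 \<le> t" "t * L < 1" "0 \<le> L"
    and zero: "\<And>x. x \<notin> S \<Longrightarrow> f x = 0"
  shows "inj (\<lambda>x. x + t *\<^sub>R f x)" "(\<lambda>x. x + t *\<^sub>R f x) ` S = S"
proof -
  have ex1: "\<exists>!x. x + t *\<^sub>R f x = y" for y
  proof -
    have "dist (y - t *\<^sub>R f x) (y - t *\<^sub>R f z) \<le> (t * L) * dist x z" for x z
    proof -
      have "dist (y - t *\<^sub>R f x) (y - t *\<^sub>R f z) = norm (t *\<^sub>R (f x - f z))"
        unfolding dist_norm norm_minus_commute[of "y - t *\<^sub>R f x"] by (simp add: algebra_simps)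
      also have "\<dots> \<le> t * (L * norm (x - z))" using lip[of x z] t by (simp add: mult_left_mono)
      finally show ?thesis by (simp add: dist_norm mult.assoc)
    qed
    then have "\<exists>!x. y - t *\<^sub>R f x = x"
      using t by (intro banach_fix_type[of "t * L"]) auto
    moreover have "y - t *\<^sub>R f x = x \<longleftrightarrow> x + t *\<^sub>R f x = y" for x
      by (metis add_diff_cancel diff_add_cancel)
    ultimately show ?thesis by simp
  qed
  show inj: "inj (\<lambda>x. x + t *\<^sub>R f x)"
    using ex1 by (metis (mono_tags, lifting) injI)
  have outside: "x + t *\<^sub>R f x = x" if "x \<notin> S" for x using zero[OF that] by simp
  show "(\<lambda>x. x + t *\<^sub>R f x) ` S = S"
  proof (intro equalityI subsetI)
    fix y assume "y \<in> (\<lambda>x. x + t *\<^sub>R f x) ` S"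
    then obtain x where x: "x \<in> S" "y = x + t *\<^sub>R f x" by blast
    show "y \<in> S"
    proof (rule ccontr)
      assume "y \<notin> S"
      then have "y + t *\<^sub>R f y = y" by (rule outside)
      then have "y + t *\<^sub>R f y = x + t *\<^sub>R f x" using x(2) by (rule trans)
      then have "y = x" using ex1 by blast
      then show False using x(1) \<open>y \<notin> S\<close> by metis
    qed
  next
    fix y assume y: "y \<in> S"
    obtain x where x: "x + t *\<^sub>R f x = y" using ex1 by blast
    then have "x \<in> S" using y outside by metis
    then show "y \<in> (\<lambda>x. x + t *\<^sub>R f x) ` S" using x by blast
  qed
qed

text \<open>The volume of the box equals the integral of \<open>det (1 + t M)\<close> for all small
  \<open>t \<ge> 0\<close>. This integral is a polynomial in \<open>t\<close>, so its nonconstant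
  coefficients vanish, and the top one is the integral of \<open>det M\<close>.\<close>

lemma integral_det_eq_0_wellorder:
  fixes f :: "real ^ 'n::{finite,wellorder} \<Rightarrow> real ^ 'n::_" and M :: "real ^ 'n::_ \<Rightarrow> real ^ 'n::_ ^ 'n::_"
  assumes der: "\<And>x. (f has_derivative (*v) (M x)) (at x)"
    and cont: "continuous_on UNIV M"
    and zero: "\<And>x. x \<notin> cbox a b \<Longrightarrow> f x = 0"
  shows "((\<lambda>x. det (M x)) has_integral 0) (cbox a b)"
proof -
  let ?C = "cbox a b"
  have M0: "M x = 0" if "x \<notin> ?C" for x
  proof -
    have "(f has_derivative (\<lambda>h. 0)) (at x)"
      by (rule has_derivative_transform_within_open[of "\<lambda>_. 0" _ x UNIV "- ?C"]) (use that zero in auto)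
    then have "(*v) (M x) = (\<lambda>h. 0)" using der has_derivative_unique by blast
    then show ?thesis by (simp add: matrix_eq fun_eq_iff)
  qed
  have "bounded (M ` ?C)"
    using continuous_on_subset[OF cont] by (intro compact_imp_bounded compact_continuous_image) auto
  then obtain B where B: "B > 0" "\<And>x. x \<in> ?C \<Longrightarrow> norm (M x) \<le> B"
    unfolding bounded_pos by blast
  have ent: "\<bar>M x $ i $ j\<bar> \<le> B" for x i j
  proof (cases "x \<in> ?C")
    case True
    have "\<bar>M x $ i $ j\<bar> \<le> norm (M x $ i)" by (rule component_le_norm_cart)
    also have "\<dots> \<le> norm (M x)" by (rule Finite_Cartesian_Product.norm_nth_le)
    finally show ?thesis using B(2)[OF True] by simp
  next
    case False
    then show ?thesis using M0 B(1) by simp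
  qed
  define L where "L = real CARD('n) * real CARD('n) * B"
  have "L \<ge> 0" using B(1) by (simp add: L_def)
  have Mon: "onorm ((*v) (M x)) \<le> L" for x
    unfolding L_def by (rule onorm_le_matrix_component) (rule ent)
  have lip: "norm (f x - f y) \<le> L * norm (x - y)" for x y
    using der Mon by (intro differentiable_bound[of UNIV f "\<lambda>x. (*v) (M x)"]) auto
  have Mlip: "norm (M x *v h) \<le> L * norm h" for x h
  proof -
    have "norm (M x *v h) \<le> onorm ((*v) (M x)) * norm h"
      by (intro onorm matrix_vector_mul_bounded_linear)
    also have "\<dots> \<le> L * norm h" using Mon by (intro mult_right_mono) auto
    finally show ?thesis .
  qed
  \<comment> \<open>The denominator \<open>L + 1\<close> keeps \<open>t * L < 1\<close> strict and
    admits \<open>L = 0\<close>.\<close>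
  define \<delta> where "\<delta> = 1 / (L + 1)"
  have "\<delta> > 0" using \<open>L \<ge> 0\<close> by (simp add: \<delta>_def)
  have \<delta>L: "t * L < 1" if "0 \<le> t" "t \<le> \<delta>" for t
  proof -
    have "t * L \<le> \<delta> * L" using that \<open>L \<ge> 0\<close> by (intro mult_right_mono)
    also have "\<dots> < 1" using \<open>L \<ge> 0\<close> by (simp add: \<delta>_def field_simps)
    finally show ?thesis .
  qed
  define g where "g m x = (\<Sum>J | J \<subseteq> (UNIV::'n set) \<and> card J = m. mixed_disc (\<lambda>r. if r \<in> J then M x else mat 1))" for m x
  have det_g: "det (mat 1 + t *\<^sub>R M x) = (\<Sum>m\<le>CARD('n). g m x * t ^ m)" for t x
    unfolding g_def by (rule det_mat_1_add_scaleR)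
  have cont_ent: "continuous_on ?C (\<lambda>x. M x $ i $ j)" for i j
    by (intro continuous_on_component continuous_on_subset[OF cont]) simp
  have g_int: "g m integrable_on ?C" for m
  proof (rule integrable_continuous)
    show "continuous_on ?C (g m)"
      unfolding g_def
    proof (intro continuous_on_sum continuous_on_mixed_disc)
      fix J :: "'n set" and r i j
      show "continuous_on ?C (\<lambda>x. (if r \<in> J then M x else mat 1) $ i $ j)"
        using cont_ent by (cases "r \<in> J") auto
    qed
  qed
  have key: "(\<Sum>m\<le>CARD('n). integral ?C (g m) * t ^ m) = measure lebesgue ?C" if t: "0 \<le> t" "t \<le> \<delta>" for t
  proof -
    have tL: "t * L < 1" using \<delta>L t by blast
    have d: "((\<lambda>x. x + t *\<^sub>R f x) has_derivative (*v) (mat 1 + t *\<^sub>R M x)) (at x within ?C)" for x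
    proof -
      have "((\<lambda>x. x + t *\<^sub>R f x) has_derivative (\<lambda>h. h + t *\<^sub>R (M x *v h))) (at x within ?C)"
        by (intro derivative_intros has_derivative_at_withinI[OF der])
      moreover have "(\<lambda>h. h + t *\<^sub>R (M x *v h)) = (*v) (mat 1 + t *\<^sub>R M x)"
        by (simp add: fun_eq_iff matrix_vector_mult_add_rdistrib scaleR_matrix_vector_assoc)
      ultimately show ?thesis by simp
    qed
    have pos: "0 < det (mat 1 + t *\<^sub>R M x)" for x
      using det_mat_1_add_scaleR_pos[OF Mlip t(1) tL] .
    have sum_int: "((\<lambda>x. \<Sum>m\<le>CARD('n). g m x * t ^ m) has_integral (\<Sum>m\<le>CARD('n). integral ?C (g m) * t ^ m)) ?C"
      using g_int by (intro has_integral_sum has_integral_mult_left integrable_integral) auto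
    have abs: "(\<lambda>x. \<bar>det (matrix ((*v) (mat 1 + t *\<^sub>R M x)))\<bar>) = (\<lambda>x. \<Sum>m\<le>CARD('n). g m x * t ^ m)"
      using pos by (simp add: fun_eq_iff det_g[symmetric] abs_of_pos matrix_of_matrix_vector_mul)
    have "measure lebesgue ((\<lambda>x. x + t *\<^sub>R f x) ` ?C) = integral ?C (\<lambda>x. \<bar>det (matrix ((*v) (mat 1 + t *\<^sub>R M x)))\<bar>)"
    proof (rule measure_differentiable_image_eq)
      show "inj_on (\<lambda>x. x + t *\<^sub>R f x) ?C"
        using lipschitz_perturbation_image(1)[OF lip t(1) tL \<open>L \<ge> 0\<close> zero] inj_on_subset by blast
      show "(\<lambda>x. \<bar>det (matrix ((*v) (mat 1 + t *\<^sub>R M x)))\<bar>) integrable_on ?C"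
        unfolding abs using sum_int by blast
    qed (use d in auto)
    moreover have "(\<lambda>x. x + t *\<^sub>R f x) ` ?C = ?C"
      by (rule lipschitz_perturbation_image(2)[OF lip t(1) tL \<open>L \<ge> 0\<close> zero])
    ultimately have "measure lebesgue ?C = integral ?C (\<lambda>x. \<Sum>m\<le>CARD('n). g m x * t ^ m)"
      by (simp only: abs)
    then show ?thesis unfolding integral_unique[OF sum_int] by (rule sym)
  qed
  \<comment> \<open>\<open>q\<close> vanishes on a whole interval. Subtracting the volume changes
    only the constant coefficient, which is not the top one because the index type is
    nonempty.\<close>
  define q where "q = (\<Sum>m\<le>CARD('n). monom (integral ?C (g m)) m) - [:measure lebesgue ?C:]"
  have "poly q t = 0" if "t \<in> {0..\<delta>}" for t
    using key[of t] that by (simp add: q_def poly_sum poly_monom)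
  then have "{0..\<delta>} \<subseteq> {t. poly q t = 0}" by auto
  moreover have "infinite {0..\<delta>}" using \<open>\<delta> > 0\<close> by (simp add: infinite_Icc)
  ultimately have "q = 0" using poly_roots_finite finite_subset by blast
  moreover have "coeff q CARD('n) = integral ?C (g CARD('n))"
  proof -
    have "CARD('n) \<noteq> 0" by simp
    then show ?thesis unfolding q_def coeff_diff coeff_sum_monom by (simp add: coeff_pCons split: nat.split)
  qed
  ultimately have "integral ?C (g CARD('n)) = 0" by simp
  moreover have "g CARD('n) = (\<lambda>x. det (M x))"
  proof
    fix x
    have "{J. J \<subseteq> (UNIV::'n set) \<and> card J = CARD('n)} = {UNIV}"
      using card_subset_eq[OF finite subset_UNIV] by auto
    then show "g CARD('n) x = det (M x)" by (simp add: g_def mixed_disc_diag)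
  qed
  ultimately show ?thesis using g_int[of "CARD('n)"] by (simp add: has_integral_iff)
qed

subsection \<open>Transport to arbitrary finite index types\<close>

text \<open>The change of variables theorem of the library needs a well-ordered index type, so the
  index type is copied along an enumeration.\<close>

typedef 'a ordered_copy = "UNIV :: 'a set" by simp

lemma bij_Rep_ordered_copy: "bij Rep_ordered_copy"
  by (metis Abs_ordered_copy_inverse Rep_ordered_copy_inverse UNIV_I bijI')

instance ordered_copy :: (finite) finite
  by standard (metis bij_Rep_ordered_copy bij_betw_finite finite)

instantiation ordered_copy :: (finite) wellorder
begin

definition less_eq_ordered_copy :: "'a ordered_copy \<Rightarrow> 'a ordered_copy \<Rightarrow> bool" where
  "x \<le> y \<longleftrightarrow> slot_index (Rep_ordered_copy x) \<le> slot_index (Rep_ordered_copy y)"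

definition less_ordered_copy :: "'a ordered_copy \<Rightarrow> 'a ordered_copy \<Rightarrow> bool" where
  "x < y \<longleftrightarrow> slot_index (Rep_ordered_copy x) < slot_index (Rep_ordered_copy y)"

instance
proof
  fix P :: "'a ordered_copy \<Rightarrow> bool" and a
  assume step: "\<And>x. (\<And>y. y < x \<Longrightarrow> P y) \<Longrightarrow> P x"
  show "P a"
    by (induction a rule: measure_induct_rule[of "\<lambda>x. slot_index (Rep_ordered_copy x)"])
      (rule step, simp add: less_ordered_copy_def)
qed (auto simp: less_eq_ordered_copy_def less_ordered_copy_def slot_index_eq_iff Rep_ordered_copy_inject)

end

text \<open>Conjugation by \<open>f\<close> is a bijection between the permutations of the two index
  types and preserves signs.\<close>

lemma det_reindex:
  fixes A :: "'a::comm_ring_1 ^ 'n ^ 'n" and f :: "'m::finite \<Rightarrow> 'n"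
  assumes f: "bij f"
  shows "det (\<chi> i j. A $ f i $ f j) = det A"
proof -
  have bij: "bij_betw (map_permutation UNIV f) {p. p permutes UNIV} {p. p permutes UNIV}"
    unfolding bij_betw_def
  proof
    have app: "map_permutation UNIV f p (f i) = f (p i)" for p :: "'m \<Rightarrow> 'm" and i
      using f by (simp add: map_permutation_apply bij_def)
    show inj: "inj_on (map_permutation UNIV f) {p. p permutes UNIV}"
    proof (rule inj_onI)
      fix p q assume "map_permutation UNIV f p = map_permutation UNIV f q"
      then have "f (p i) = f (q i)" for i using app by metis
      then show "p = q" using bij_is_inj[OF f] by (auto simp: inj_eq)
    qed
    have "card (map_permutation UNIV f ` {p. p permutes UNIV}) = card {p. p permutes (UNIV :: 'n set)}"
      unfolding card_image[OF inj] card_permutations[OF refl finite] by (simp add: bij_betw_same_card[OF f])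
    then show "map_permutation UNIV f ` {p. p permutes UNIV} = {p. p permutes UNIV}"
      using map_permutation_permutes[OF f]
      by (intro card_subset_eq) (auto simp: finite_permutations)
  qed
  have "det A = (\<Sum>p | p permutes (UNIV :: 'm set). of_int (sign (map_permutation UNIV f p)) *
      (\<Prod>i\<in>UNIV. A $ i $ map_permutation UNIV f p i))"
    unfolding det_def by (rule sum.reindex_bij_betw[OF bij, symmetric])
  also have "\<dots> = (\<Sum>p | p permutes (UNIV :: 'm set). of_int (sign p) * (\<Prod>i\<in>UNIV. A $ f i $ f (p i)))"
  proof (intro sum.cong refl arg_cong2[where f = "(*)"])
    fix p :: "'m \<Rightarrow> 'm" assume "p \<in> {p. p permutes UNIV}"
    then show "of_int (sign (map_permutation UNIV f p)) = (of_int (sign p) :: 'a)"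
      using f by (simp add: sign_map_permutation bij_def)
    have "(\<Prod>i\<in>UNIV. A $ i $ map_permutation UNIV f p i) = (\<Prod>i\<in>UNIV. A $ f i $ map_permutation UNIV f p (f i))"
      by (rule prod.reindex_bij_betw[OF f, symmetric])
    then show "(\<Prod>i\<in>UNIV. A $ i $ map_permutation UNIV f p i) = (\<Prod>i\<in>UNIV. A $ f i $ f (p i))"
      using f by (simp add: map_permutation_apply bij_def)
  qed
  finally show ?thesis by (simp add: det_def)
qed

text \<open>\<open>P\<close> and \<open>Q\<close> relabel coordinates: they are mutually inverse,
  linear, and map boxes to boxes of the same volume, so the integral is transported with factor
  1.\<close>

lemma integral_det_eq_0_box:
  fixes f :: "real ^ 'n \<Rightarrow> real ^ 'n" and M :: "real ^ 'n \<Rightarrow> real ^ 'n ^ 'n"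
  assumes der: "\<And>x. (f has_derivative (*v) (M x)) (at x)"
    and cont: "continuous_on UNIV M"
    and zero: "\<And>x. x \<notin> cbox a b \<Longrightarrow> f x = 0"
  shows "((\<lambda>x. det (M x)) has_integral 0) (cbox a b)"
proof -
  let ?r = "Rep_ordered_copy :: 'n ordered_copy \<Rightarrow> 'n" and ?a = "Abs_ordered_copy :: 'n \<Rightarrow> 'n ordered_copy"
  have ra [simp]: "?r (?a i) = i" for i by (simp add: Abs_ordered_copy_inverse)
  have ar [simp]: "?a (?r w) = w" for w by (simp add: Rep_ordered_copy_inverse)
  define P :: "real ^ 'n \<Rightarrow> real ^ 'n ordered_copy" where "P x = (\<chi> w. x $ ?r w)" for x
  define Q :: "real ^ 'n ordered_copy \<Rightarrow> real ^ 'n" where "Q y = (\<chi> i. y $ ?a i)" for y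
  have P_nth [simp]: "P x $ w = x $ ?r w" for x w by (simp add: P_def)
  have Q_nth [simp]: "Q y $ i = y $ ?a i" for y i by (simp add: Q_def)
  have QP [simp]: "Q (P x) = x" for x by (simp add: vec_eq_iff)
  have PQ [simp]: "P (Q y) = y" for y by (simp add: vec_eq_iff)
  have blP: "bounded_linear P" and blQ: "bounded_linear Q"
    by (intro linear_linear[THEN iffD2] linearI; simp add: vec_eq_iff)+
  have P_box: "P ` cbox u v = cbox (P u) (P v)" for u v
  proof (intro equalityI subsetI)
    fix y assume "y \<in> cbox (P u) (P v)"
    then have "Q y \<in> cbox u v" unfolding mem_box_cart by (metis P_nth Q_nth ra)
    then show "y \<in> P ` cbox u v" by (metis PQ imageI)
  qed (auto simp: mem_box_cart)
  have Q_box: "Q ` cbox u v = cbox (Q u) (Q v)" for u v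
    by (metis (no_types, lifting) P_box PQ QP image_cong image_ident image_image)
  have der': "((\<lambda>y. P (f (Q y))) has_derivative (*v) (\<chi> v w. M (Q y) $ ?r v $ ?r w)) (at y)" for y
  proof -
    have "((\<lambda>y. P (f (Q y))) has_derivative (\<lambda>h. P (M (Q y) *v Q h))) (at y)"
      by (rule bounded_linear.has_derivative[OF blP], rule has_derivative_compose[OF _ der])
        (rule bounded_linear.has_derivative[OF blQ has_derivative_ident])
    moreover have "(\<lambda>h. P (M (Q y) *v Q h)) = (*v) (\<chi> v w. M (Q y) $ ?r v $ ?r w)"
    proof (intro ext, unfold vec_eq_iff, intro allI)
      fix h v
      have "P (M (Q y) *v Q h) $ v = (\<Sum>j\<in>UNIV. M (Q y) $ ?r v $ j * h $ ?a j)"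
        by (simp add: matrix_vector_mult_def)
      also have "\<dots> = (\<Sum>w\<in>UNIV. M (Q y) $ ?r v $ ?r w * h $ ?a (?r w))"
        by (rule sum.reindex_bij_betw[OF bij_Rep_ordered_copy, symmetric])
      finally show "P (M (Q y) *v Q h) $ v = ((\<chi> v w. M (Q y) $ ?r v $ ?r w) *v h) $ v"
        by (simp add: matrix_vector_mult_def)
    qed
    ultimately show ?thesis by simp
  qed
  have "((\<lambda>y. det ((\<chi> v w. M (Q y) $ ?r v $ ?r w) :: real ^ 'n ordered_copy ^ 'n ordered_copy)) has_integral 0) (cbox (P a) (P b))"
  proof (rule integral_det_eq_0_wellorder[OF der'])
    have "continuous_on UNIV (\<lambda>y. M (Q y))"
      using blQ by (intro continuous_on_compose2[OF cont]) (auto intro: linear_continuous_on)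
    then show "continuous_on UNIV (\<lambda>y. (\<chi> v w. M (Q y) $ ?r v $ ?r w) :: real ^ 'n ordered_copy ^ 'n ordered_copy)"
      by (intro continuous_on_vec_lambda continuous_on_component)
  next
    fix y assume "y \<notin> cbox (P a) (P b)"
    then have "Q y \<notin> cbox a b" using P_box by (metis PQ imageI)
    then show "P (f (Q y)) = 0" using zero by (simp add: vec_eq_iff)
  qed
  then have "((\<lambda>y. det (M (Q y))) has_integral 0) (cbox (P a) (P b))"
    by (simp add: det_reindex[OF bij_Rep_ordered_copy])
  then have "((\<lambda>x. det (M (Q (P x)))) has_integral (1 / 1) *\<^sub>R 0) (Q ` cbox (P a) (P b))"
  proof (rule has_integral_twiddle[rotated -1])
    show "continuous (at x) P" for x using blP by (rule linear_continuous_at)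
    show "\<exists>w z. P ` cbox u v = cbox w z" for u v using P_box by blast
    show "\<exists>w z. Q ` cbox u v = cbox w z" for u v using Q_box by blast
    show "measure lborel (P ` cbox u v) = 1 * measure lborel (cbox u v)" for u v
    proof -
      have "(\<Prod>w\<in>UNIV. v $ ?r w - u $ ?r w) = (\<Prod>i\<in>UNIV. v $ i - u $ i)"
        by (rule prod.reindex_bij_betw[OF bij_Rep_ordered_copy])
      moreover have "cbox (P u) (P v) = {} \<longleftrightarrow> cbox u v = {}" using P_box[of u v] by (metis image_is_empty)
      ultimately show ?thesis unfolding P_box content_cbox_if_cart by simp
    qed
  qed auto
  then show ?thesis by (simp add: Q_box)
qed

lemma integral_det_eq_0:
  fixes f :: "real ^ 'n \<Rightarrow> real ^ 'n" and M :: "real ^ 'n \<Rightarrow> real ^ 'n ^ 'n"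
  assumes der: "\<And>x. (f has_derivative (*v) (M x)) (at x)"
    and cont: "continuous_on UNIV M"
    and K: "compact K" and zero: "\<And>x. x \<notin> K \<Longrightarrow> f x = 0"
  shows "integrable lborel (\<lambda>x. det (M x))" "(LINT x|lborel. det (M x)) = 0"
proof -
  obtain a where a: "K \<subseteq> cbox (- a) a"
    using bounded_subset_cbox_symmetric[OF compact_imp_bounded[OF K]] .
  let ?C = "cbox (- a) a"
  have zero': "f x = 0" if "x \<notin> ?C" for x using that a zero by blast
  have M0: "M x = 0" if "x \<notin> ?C" for x
  proof -
    have "(f has_derivative (\<lambda>h. 0)) (at x)"
      by (rule has_derivative_transform_within_open[of "\<lambda>_. 0" _ x UNIV "- ?C"]) (use that zero' in auto)
    then have "(*v) (M x) = (\<lambda>h. 0)" using der has_derivative_unique by blast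
    then show ?thesis by (simp add: matrix_eq fun_eq_iff)
  qed
  have d0: "det (M x) = 0" if "x \<notin> ?C" for x
    using M0[OF that] by (simp add: mat_0[symmetric] det_0 del: mat_0)
  have "continuous_on UNIV (\<lambda>x. det (M x))"
    unfolding mixed_disc_diag[symmetric]
    by (intro continuous_on_mixed_disc continuous_on_component cont)
  then have "continuous_on ?C (\<lambda>x. det (M x))" by (rule continuous_on_subset) simp
  then have "integrable lborel (\<lambda>x. indicator ?C x *\<^sub>R det (M x))"
    by (intro borel_integrable_compact) auto
  moreover have "(\<lambda>x. indicator ?C x *\<^sub>R det (M x)) = (\<lambda>x. det (M x))"
    using d0 by (auto simp: indicator_def fun_eq_iff)
  ultimately show int: "integrable lborel (\<lambda>x. det (M x))" by simp
  have "((\<lambda>x. det (M x)) has_integral 0) ?C"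
    using der cont zero' by (rule integral_det_eq_0_box)
  then have "((\<lambda>x. det (M x)) has_integral 0) UNIV"
    by (rule has_integral_on_superset) (use d0 in auto)
  then show "(LINT x|lborel. det (M x)) = 0"
    using has_integral_integral_lborel[OF int] has_integral_unique by blast
qed

subsection \<open>Gradients\<close>

definition grad :: "(real ^ 'n \<Rightarrow> real) \<Rightarrow> real ^ 'n \<Rightarrow> real ^ 'n" where
  "grad u x = (\<chi> i. partial i u x)"

lemma grad_nth [simp]: "grad u x $ i = partial i u x"
  by (simp add: grad_def)

lemma has_derivative_inner_eq_grad:
  fixes f :: "real ^ 'n \<Rightarrow> real"
  assumes "(f has_derivative (\<lambda>h. g \<bullet> h)) (at x)"
  shows "f differentiable (at x)" "grad f x = g" "partial i f x = g $ i"
proof -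
  show "f differentiable (at x)" using assms by (auto simp: differentiable_def)
  have "(\<lambda>h. g \<bullet> h) = frechet_derivative f (at x)"
    by (rule frechet_derivative_at[OF assms])
  then have "frechet_derivative f (at x) (axis i 1) = g \<bullet> axis i 1" for i by metis
  then show "partial i f x = g $ i" for i by (simp add: partial_def inner_axis)
  then show "grad f x = g" by (simp add: vec_eq_iff)
qed

lemma has_derivative_grad:
  fixes f :: "real ^ 'n \<Rightarrow> real"
  assumes "f differentiable (at x)"
  shows "(f has_derivative (\<lambda>h. grad f x \<bullet> h)) (at x)"
proof -
  have d: "(f has_derivative frechet_derivative f (at x)) (at x)"
    using assms by (simp add: frechet_derivative_works)
  then have lin: "linear (frechet_derivative f (at x))" by (rule has_derivative_linear)
  have "frechet_derivative f (at x) h = grad f x \<bullet> h" for h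
  proof -
    have "h = (\<Sum>i\<in>UNIV. h $ i *\<^sub>R axis i 1)"
      using basis_expansion[of h] by (simp add: scalar_mult_eq_scaleR)
    then have "frechet_derivative f (at x) h = (\<Sum>i\<in>UNIV. h $ i * frechet_derivative f (at x) (axis i 1))"
      by (metis (mono_tags, lifting) linear_sum[OF lin] linear_scale[OF lin] real_scaleR_def sum.cong)
    then show ?thesis by (simp add: partial_def inner_vec_def mult.commute)
  qed
  then have "frechet_derivative f (at x) = (\<lambda>h. grad f x \<bullet> h)" by (rule ext)
  then show ?thesis using d by simp
qed

lemma Ck_on_1_iff:
  "Ck_on 1 D f \<longleftrightarrow> (\<forall>x\<in>D. f differentiable (at x)) \<and> continuous_on D (grad f)"
proof -
  have "continuous_on D (grad f)" if "\<forall>i. continuous_on D (partial i f)"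
    unfolding grad_def using that by (intro continuous_on_vec_lambda) auto
  moreover have "continuous_on D (partial i f)" if "continuous_on D (grad f)" for i
    using continuous_on_component[OF that, of i] by simp
  ultimately show ?thesis by (auto simp: One_nat_def)
qed

lemma Ck_on_1_continuous_on: "Ck_on 1 D f \<Longrightarrow> continuous_on D f"
  by (auto intro!: continuous_at_imp_continuous_on differentiable_imp_continuous_within simp: One_nat_def)

lemma Ck_on_2_iff:
  "Ck_on 2 D f \<longleftrightarrow> (\<forall>x\<in>D. f differentiable (at x)) \<and> (\<forall>i. Ck_on 1 D (partial i f))"
  by (simp add: numeral_2_eq_2)

subsection \<open>Cut-off functions\<close>

lemma has_field_derivative_max_0_power2:
  "((\<lambda>r::real. (max 0 r)\<^sup>2) has_field_derivative 2 * max 0 r) (at r)"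
proof (cases r "0::real" rule: linorder_cases)
  case less
  have "((\<lambda>r::real. 0) has_field_derivative 0) (at r)" by simp
  then show ?thesis
    by (rule has_field_derivative_transform_within_open[where S = "{..<0}", THEN DERIV_cong]) (use less in auto)
next
  case equal
  have "((\<lambda>y. ((max 0 y)\<^sup>2 - (max 0 (0::real))\<^sup>2) / (y - 0)) \<longlongrightarrow> 0) (at 0)"
  proof (rule Lim_null_comparison)
    show "eventually (\<lambda>y::real. norm (((max 0 y)\<^sup>2 - (max 0 0)\<^sup>2) / (y - 0)) \<le> \<bar>y\<bar>) (at 0)"
      by (intro always_eventually) (auto simp: max_def power2_eq_square)
    show "((\<lambda>y::real. \<bar>y\<bar>) \<longlongrightarrow> 0) (at 0)"
      by (intro tendsto_eq_intros) auto
  qed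
  then show ?thesis using equal by (simp add: has_field_derivative_iff)
next
  case greater
  have "((\<lambda>r::real. r\<^sup>2) has_field_derivative 2 * r) (at r)"
    by (auto intro!: derivative_eq_intros)
  then show ?thesis
    by (rule has_field_derivative_transform_within_open[where S = "{0<..}", THEN DERIV_cong]) (use greater in auto)
qed

lemmas DERIV_max_0_power2 = DERIV_chain2[OF has_field_derivative_max_0_power2]

text \<open>The quotient of two squared positive parts whose sum never vanishes. A continuous first
  derivative is all the regularity that the Jacobian argument asks for.\<close>

lemma smooth_step_exists:
  fixes b c :: real
  assumes "b < c"
  obtains \<eta> \<eta>' where "\<And>s. (\<eta> has_field_derivative \<eta>' s) (at s)" "continuous_on UNIV \<eta>'"
    "\<And>s. s \<ge> - b \<Longrightarrow> \<eta> s = 0" "\<And>s. s \<le> - c \<Longrightarrow> \<eta> s = 1"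
proof -
  let ?p = "\<lambda>s. (max 0 (- s - b))\<^sup>2" and ?q = "\<lambda>s. (max 0 (c + s))\<^sup>2"
  let ?p' = "\<lambda>s. 2 * max 0 (- s - b) * (-1)" and ?q' = "\<lambda>s. 2 * max 0 (c + s) * 1"
  have pos: "?p s + ?q s \<noteq> 0" for s
    using assms by (auto simp: max_def add_nonneg_eq_0_iff)
  have p: "(?p has_field_derivative ?p' s) (at s)" for s
    by (rule DERIV_max_0_power2) (auto intro!: derivative_eq_intros)
  have q: "(?q has_field_derivative ?q' s) (at s)" for s
    by (rule DERIV_max_0_power2) (auto intro!: derivative_eq_intros)
  let ?\<eta> = "\<lambda>s. ?p s / (?p s + ?q s)"
  let ?\<eta>' = "\<lambda>s. (?p' s * (?p s + ?q s) - ?p s * (?p' s + ?q' s)) / ((?p s + ?q s) * (?p s + ?q s))"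
  have "(?\<eta> has_field_derivative ?\<eta>' s) (at s)" for s
    by (rule DERIV_divide[OF p DERIV_add[OF p q] pos])
  moreover have "continuous_on UNIV ?\<eta>'"
    using pos by (intro continuous_intros) auto
  moreover have "?\<eta> s = 0" if "s \<ge> - b" for s using that by simp
  moreover have "?\<eta> s = 1" if "s \<le> - c" for s
    using that pos[of s] by (simp add: max_absorb1)
  ultimately show ?thesis by (rule that)
qed

text \<open>A C^1 replacement of the identity on the nonpositive half line: zero on
  \<open>s \<ge> - e\<close> and the translate \<open>s + 3 * e / 2\<close> on
  \<open>s \<le> - 2 * e\<close>. Its slope \<open>trunc'\<close> is linear in between.\<close>

definition trunc :: "real \<Rightarrow> real \<Rightarrow> real" where
  "trunc e s = - ((max 0 (- s - e))\<^sup>2 - (max 0 (- s - 2 * e))\<^sup>2) / (2 * e)"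

definition trunc' :: "real \<Rightarrow> real \<Rightarrow> real" where
  "trunc' e s = (max 0 (- s - e) - max 0 (- s - 2 * e)) / e"

lemma trunc_deriv:
  assumes "e > 0"
  shows "(trunc e has_field_derivative trunc' e s) (at s)"
proof -
  have p: "((\<lambda>s. (max 0 (- s - c))\<^sup>2) has_field_derivative 2 * max 0 (- s - c) * (-1)) (at s)" for c :: real
    by (rule DERIV_max_0_power2) (auto intro!: derivative_eq_intros)
  have "(trunc e has_field_derivative - (2 * max 0 (- s - e) * (-1) - 2 * max 0 (- s - 2 * e) * (-1)) / (2 * e)) (at s)"
    unfolding trunc_def[abs_def] by (intro DERIV_cdivide DERIV_minus DERIV_diff p)
  then show ?thesis
    by (rule DERIV_cong) (use assms in \<open>simp add: trunc'_def field_simps\<close>)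
qed

lemma trunc'_cont: "continuous_on UNIV (trunc' e)"
  unfolding trunc'_def by (cases "e = 0") (auto intro!: continuous_intros)

lemma trunc'_bounds: "e > 0 \<Longrightarrow> 0 \<le> trunc' e s \<and> trunc' e s \<le> 1"
  by (auto simp: trunc'_def max_def field_simps)

lemma trunc_eq_0: "e > 0 \<Longrightarrow> s \<ge> - e \<Longrightarrow> trunc e s = 0"
  by (simp add: trunc_def)

lemma trunc_far: "e > 0 \<Longrightarrow> s \<le> - 2 * e \<Longrightarrow> trunc e s = s + 3 * e / 2"
  by (simp add: trunc_def max_absorb2 power2_eq_square field_simps)

lemma trunc'_far: "e > 0 \<Longrightarrow> s \<le> - 2 * e \<Longrightarrow> trunc' e s = 1"
  by (simp add: trunc'_def max_absorb2)

text \<open>Supplies the majorant for dominated convergence as \<open>e\<close> tends to 0. The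
  difference of squares is factored, one factor being at most \<open>e\<close> and the other at most
  \<open>- 2 s\<close>.\<close>

lemma trunc_bound:
  assumes "e > 0" "s \<le> 0"
  shows "\<bar>trunc e s\<bar> \<le> - s"
proof -
  let ?A = "max 0 (- s - e)" and ?B = "max 0 (- s - 2 * e)"
  have AB: "0 \<le> ?A - ?B" "?A - ?B \<le> e" "?A + ?B \<le> 2 * (- s)" "0 \<le> ?A + ?B"
    using assms by (auto simp: max_def)
  have "?A\<^sup>2 - ?B\<^sup>2 = (?A - ?B) * (?A + ?B)" by (simp add: power2_eq_square algebra_simps)
  moreover have "(?A - ?B) * (?A + ?B) \<le> e * (2 * (- s))"
    using AB assms by (intro mult_mono) auto
  moreover have "0 \<le> (?A - ?B) * (?A + ?B)" using AB by simp
  ultimately show ?thesis using assms by (simp add: trunc_def abs_minus divide_simps mult_ac)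
qed

lemma deriv_eq_0_on_open_ray:
  fixes \<theta> :: "real \<Rightarrow> real"
  assumes "\<And>s. (\<theta> has_field_derivative \<theta>' s) (at s)" "\<And>s. s \<ge> b \<Longrightarrow> \<theta> s = 0" "s > b"
  shows "\<theta>' s = 0"
proof -
  have "((\<lambda>_. 0) has_field_derivative 0) (at s)" by simp
  then have "(\<theta> has_field_derivative 0) (at s)"
    by (rule has_field_derivative_transform_within_open[where S = "{b<..}"]) (use assms(2,3) in auto)
  then show ?thesis using assms(1) DERIV_unique by blast
qed

section \<open>Integration by parts against compactly supported cut-offs\<close>

text \<open>As \<open>v\<close> vanishes on the boundary, the set where \<open>v \<le> - a\<close>
  is compact and contained in \<open>D\<close>. Extension by zero is therefore C^1 on the whole
  space, however the derivatives behave near the boundary.\<close>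

lemma cutoff_product:
  fixes D :: "(real ^ 'n) set"
  assumes D: "open D" "bounded D" and v: "continuous_on (closure D) v" "Ck_on 1 D v"
    and bd: "\<forall>x\<in>frontier D. v x = 0" and g: "Ck_on 1 D g"
    and \<theta>: "\<And>s. (\<theta> has_field_derivative \<theta>' s) (at s)" "continuous_on UNIV \<theta>'"
    and a: "a > 0" "\<forall>s\<ge>- a. \<theta> s = 0"
  defines "F \<equiv> \<lambda>x. if x \<in> D then \<theta> (v x) * g x else 0"
    and "G \<equiv> \<lambda>x. if x \<in> D then (\<theta>' (v x) * g x) *\<^sub>R grad v x + \<theta> (v x) *\<^sub>R grad g x else 0"
    and "K \<equiv> {x \<in> closure D. v x \<le> - a}"
  shows "(F has_derivative (\<lambda>h. G x \<bullet> h)) (at x)" "continuous_on UNIV G"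
    "compact K" "K \<subseteq> D" "x \<notin> K \<Longrightarrow> F x = 0"
proof -
  have "closed K"
    unfolding K_def using v(1) by (intro continuous_on_closed_Collect_le continuous_on_const) auto
  then show K: "compact K"
    using D(2) by (auto simp: compact_eq_bounded_closed K_def intro: bounded_subset[OF bounded_closure])
  show KD: "K \<subseteq> D"
  proof
    fix x assume x: "x \<in> K"
    then have "x \<notin> frontier D" using bd a(1) by (fastforce simp: K_def)
    then show "x \<in> D" using x D(1) by (simp add: K_def frontier_def interior_open)
  qed
  have F0: "F x = 0" if "x \<notin> K" for x
    using that a(2) closure_subset[of D] by (auto simp: F_def K_def)
  then show "x \<notin> K \<Longrightarrow> F x = 0" .
  have \<theta>'0: "\<theta>' s = 0" if "s > - a" for s
    using deriv_eq_0_on_open_ray[of \<theta> \<theta>' "- a"] \<theta>(1) a(2) that by blast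
  have G0: "G x = 0" if "x \<notin> K" for x
    using that a(2) \<theta>'0[of "v x"] closure_subset[of D] by (auto simp: G_def K_def)
  have "open (- K)" using \<open>closed K\<close> by auto
  have cD: "continuous_on D v" using v(1) closure_subset continuous_on_subset by blast
  show "(F has_derivative (\<lambda>h. G x \<bullet> h)) (at x)" for x
  proof (cases "x \<in> D")
    case True
    have dv: "(v has_derivative (\<lambda>h. grad v x \<bullet> h)) (at x)" and dg: "(g has_derivative (\<lambda>h. grad g x \<bullet> h)) (at x)"
      using v(2) g True by (auto intro!: has_derivative_grad simp: Ck_on_1_iff)
    have "((\<lambda>x. \<theta> (v x)) has_derivative (\<lambda>h. \<theta>' (v x) * (grad v x \<bullet> h))) (at x)"
      by (rule has_derivative_compose[OF dv \<theta>(1)[of "v x", unfolded has_field_derivative_def]])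
    from has_derivative_mult[OF this dg]
    have "((\<lambda>x. \<theta> (v x) * g x) has_derivative (\<lambda>h. G x \<bullet> h)) (at x)"
      by (rule has_derivative_eq_rhs) (use True in \<open>simp add: fun_eq_iff G_def inner_add_left algebra_simps\<close>)
    then show ?thesis
      by (rule has_derivative_transform_within_open[of _ _ x UNIV D]) (use D True in \<open>auto simp: F_def\<close>)
  next
    case False
    then have "x \<notin> K" using KD by blast
    have "((\<lambda>_. 0) has_derivative (\<lambda>h. G x \<bullet> h)) (at x)" using G0[OF \<open>x \<notin> K\<close>] by simp
    then show ?thesis
      by (rule has_derivative_transform_within_open[of _ _ x UNIV "- K"]) (use F0 \<open>open (- K)\<close> \<open>x \<notin> K\<close> in auto)
  qed
  have "continuous_on D (\<lambda>x. (\<theta>' (v x) * g x) *\<^sub>R grad v x + \<theta> (v x) *\<^sub>R grad g x)"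
  proof (intro continuous_intros)
    show "continuous_on D (\<lambda>x. \<theta>' (v x))" by (rule continuous_on_compose2[OF \<theta>(2) cD]) simp
    have "continuous_on UNIV \<theta>" using \<theta>(1) by (meson DERIV_continuous_on has_field_derivative_at_within)
    then show "continuous_on D (\<lambda>x. \<theta> (v x))" by (rule continuous_on_compose2[OF _ cD]) simp
    show "continuous_on D g" using g by (rule Ck_on_1_continuous_on)
    show "continuous_on D (grad v)" "continuous_on D (grad g)"
      using v(2) g unfolding Ck_on_1_iff by blast+
  qed
  then have "continuous_on D G" by (rule continuous_on_eq) (simp add: G_def)
  moreover have "continuous_on (- K) G"
    by (rule continuous_on_eq[OF continuous_on_const[of _ 0]]) (simp add: G0)
  ultimately have "continuous_on (D \<union> - K) G"
    using D(1) \<open>open (- K)\<close> by (intro continuous_on_open_Un)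
  moreover have "D \<union> - K = UNIV" using KD by blast
  ultimately show "continuous_on UNIV G" by simp
qed

lemma has_derivative_vec_lambda_inner:
  fixes F :: "'n::finite \<Rightarrow> real ^ 'm \<Rightarrow> real"
  assumes "\<And>j. (F j has_derivative (\<lambda>h. G j \<bullet> h)) (at x)"
  shows "((\<lambda>x. \<chi> j. F j x) has_derivative (*v) (\<chi> j. G j)) (at x)"
proof (subst has_derivative_componentwise_within, rule ballI)
  fix b :: "real ^ 'n" assume "b \<in> Basis"
  then obtain j where b: "b = axis j 1" by (auto simp: Basis_vec_def)
  have "(\<lambda>h. ((\<chi> j. G j) *v h) \<bullet> b) = (\<lambda>h. G j \<bullet> h)"
    by (simp add: b inner_axis matrix_vector_mul_component)
  then show "((\<lambda>x. (\<chi> j. F j x) \<bullet> b) has_derivative (\<lambda>h. ((\<chi> j. G j) *v h) \<bullet> b)) (at x)"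
    using assms[of j] by (simp add: b inner_axis)
qed

text \<open>\<open>h\<close> is the Jacobian of the map with components \<open>g j\<close>, the one
  at \<open>s\<close> being multiplied by \<open>\<theta> (v x)\<close>: the product rule splits row
  \<open>s\<close> into two terms.\<close>

lemma jacobian_by_parts:
  fixes D :: "(real ^ 'n) set" and g :: "'n \<Rightarrow> real ^ 'n \<Rightarrow> real" and s :: 'n
  assumes D: "open D" "bounded D" and v: "continuous_on (closure D) v" "Ck_on 1 D v"
    and bd: "\<forall>x\<in>frontier D. v x = 0" and g: "\<And>j. Ck_on 1 D (g j)"
    and \<theta>: "\<And>s. (\<theta> has_field_derivative \<theta>' s) (at s)" "continuous_on UNIV \<theta>'"
    and a: "a > 0" "\<forall>s\<ge>- a. \<theta> s = 0"
  defines "h \<equiv> \<lambda>x. \<theta> (v x) * det (\<chi> j. grad (g j) x) +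
      \<theta>' (v x) * (g s x * det (\<chi> j. if j = s then grad v x else grad (g j) x))"
  shows "set_integrable lborel D h" "(LINT x:D|lborel. h x) = 0"
proof -
  \<comment> \<open>The other components must have compact support too. They are multiplied by
    \<eta>, which is 1 for \<open>s \<le> - (3 / 4 * a)\<close>, in particular wherever \<theta> is
    nonzero. On \<open>v x < - (3 / 4 * a)\<close> the factor \<eta> is invisible, and elsewhere
    \<theta> and its derivative vanish together with row \<open>s\<close>.\<close>
  obtain \<eta> \<eta>' where \<eta>: "\<And>s. (\<eta> has_field_derivative \<eta>' s) (at s)" "continuous_on UNIV \<eta>'"
    "\<And>s. s \<ge> - (a / 2) \<Longrightarrow> \<eta> s = 0" "\<And>s. s \<le> - (3 / 4 * a) \<Longrightarrow> \<eta> s = 1"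
    using smooth_step_exists[of "a / 2" "3 / 4 * a"] a(1) by auto
  define T where "T j = (if j = s then \<theta> else \<eta>)" for j
  define T' where "T' j = (if j = s then \<theta>' else \<eta>')" for j
  have T: "(T j has_field_derivative T' j y) (at y)" "continuous_on UNIV (T' j)" for j y
    using \<theta> \<eta> by (auto simp: T_def T'_def)
  have T0: "\<forall>y\<ge>- (a / 2). T j y = 0" for j
    using a \<eta>(3) by (auto simp: T_def)
  define F where "F j x = (if x \<in> D then T j (v x) * g j x else 0)" for j x
  define G where "G j x = (if x \<in> D then (T' j (v x) * g j x) *\<^sub>R grad v x + T j (v x) *\<^sub>R grad (g j) x else 0)" for j x
  have a2: "a / 2 > 0" using a by simp
  note cut = cutoff_product[OF D v bd g T(1) T(2) a2 T0]
  have "((\<lambda>x. \<chi> j. F j x) has_derivative (*v) (\<chi> j. G j x)) (at x)" for x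
    using cut(1) unfolding F_def G_def by (intro has_derivative_vec_lambda_inner)
  moreover have "continuous_on UNIV (\<lambda>x. \<chi> j. G j x)"
    using cut(2) unfolding G_def by (intro continuous_on_vec_lambda)
  moreover have "(\<chi> j. F j x) = 0" if "x \<notin> {x \<in> closure D. v x \<le> - (a / 2)}" for x
    using cut(5)[OF that] unfolding F_def by (simp add: vec_eq_iff)
  ultimately have int: "integrable lborel (\<lambda>x. det (\<chi> j. G j x))" "(LINT x|lborel. det (\<chi> j. G j x)) = 0"
    using integral_det_eq_0[OF _ _ cut(3), of "\<lambda>x. \<chi> j. F j x" "\<lambda>x. \<chi> j. G j x"] by blast+
  have "det (\<chi> j. G j x) = indicator D x *\<^sub>R h x" for x
  proof (cases "x \<in> D")
    case False
    then have "row s (\<chi> j. G j x) = 0" by (simp add: row_def G_def vec_eq_iff)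
    then show ?thesis using False det_zero_row by simp
  next
    case True
    show ?thesis
    proof (cases "v x < - (3 / 4 * a)")
      case True
      have "((\<lambda>_. 1) has_field_derivative 0) (at (v x))" by simp
      then have "(\<eta> has_field_derivative 0) (at (v x))"
        by (rule has_field_derivative_transform_within_open[where S = "{..< - (3 / 4 * a)}"]) (use True \<eta>(4) in auto)
      then have "\<eta>' (v x) = 0" using \<eta>(1) DERIV_unique by blast
      moreover have "\<eta> (v x) = 1" using True \<eta>(4) by simp
      ultimately have "(\<chi> j. G j x) = (\<chi> j. if j = s then (\<theta>' (v x) * g s x) *s grad v x + \<theta> (v x) *s grad (g j) x else grad (g j) x)"
        using \<open>x \<in> D\<close> by (simp add: vec_eq_iff G_def T_def T'_def)
      also have "det \<dots> = h x"
        unfolding det_row_add det_row_mul h_def by simp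
      finally show ?thesis using \<open>x \<in> D\<close> by simp
    next
      case False
      then have "\<theta> (v x) = 0" "\<theta>' (v x) = 0"
        using a deriv_eq_0_on_open_ray[of \<theta> \<theta>' "- a" "v x"] \<theta>(1) by auto
      moreover from this have "row s (\<chi> j. G j x) = 0" by (simp add: row_def G_def vec_eq_iff T_def T'_def)
      ultimately show ?thesis using det_zero_row by (simp add: h_def)
    qed
  qed
  then have eq: "(\<lambda>x. det (\<chi> j. G j x)) = (\<lambda>x. indicator D x *\<^sub>R h x)" by (rule ext)
  show "set_integrable lborel D h" "(LINT x:D|lborel. h x) = 0"
    using int unfolding eq set_integrable_def set_lebesgue_integral_def by simp_all
qed

definition outer :: "real ^ 'n \<Rightarrow> real ^ 'n \<Rightarrow> real ^ 'n ^ 'n" where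
  "outer a b = (\<chi> p q. a $ p * b $ q)"

lemma outer_nth [simp]: "outer a b $ p $ q = a $ p * b $ q"
  by (simp add: outer_def)

text \<open>For each permutation \<open>p\<close>, row \<open>p j\<close> of the transposed Hessian
  of \<open>w j\<close> is the gradient of \<open>partial (p j) (w j)\<close>. Hence the mixed
  discriminant is a signed sum of Jacobians, and moving the derivative in row \<open>s\<close> onto
  the cut-off produces the rank-one matrix.\<close>

lemma hessian_by_parts_cutoff:
  fixes D :: "(real ^ 'n) set" and w :: "'n \<Rightarrow> real ^ 'n \<Rightarrow> real"
  assumes D: "open D" "bounded D" and v: "continuous_on (closure D) v" "Ck_on 1 D v"
    and bd: "\<forall>x\<in>frontier D. v x = 0" and w: "\<And>j. Ck_on 2 D (w j)"
    and \<theta>: "\<And>s. (\<theta> has_field_derivative \<theta>' s) (at s)" "continuous_on UNIV \<theta>'"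
    and a: "a > 0" "\<forall>s\<ge>- a. \<theta> s = 0"
  shows "(LINT x:D|lborel. \<theta> (v x) * mixed_disc (\<lambda>j. Hess (w j) x) +
     \<theta>' (v x) * mixed_disc (\<lambda>j. if j = s then outer (grad v x) (grad (w s) x) else Hess (w j) x)) = 0"
proof -
  define h where "h p x = \<theta> (v x) * det (\<chi> j. grad (partial (p j) (w j)) x) +
      \<theta>' (v x) * (partial (p s) (w s) x * det (\<chi> j. if j = s then grad v x else grad (partial (p j) (w j)) x))" for p x
  have w1: "Ck_on 1 D (partial i (w j))" for i j using w by (simp add: Ck_on_2_iff)
  have h: "set_integrable lborel D (h p)" "(LINT x:D|lborel. h p x) = 0" for p
    using jacobian_by_parts[OF D v bd, where g = "\<lambda>j. partial (p j) (w j)", OF w1 \<theta> a, of s] unfolding h_def by auto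
  have row: "Hess (w j) x $ i $ k = partial i (partial k (w j)) x" for i j k x
    by (simp add: Hess_def)
  have "\<theta> (v x) * mixed_disc (\<lambda>j. Hess (w j) x) +
     \<theta>' (v x) * mixed_disc (\<lambda>j. if j = s then outer (grad v x) (grad (w s) x) else Hess (w j) x)
     = (\<Sum>p | p permutes (UNIV :: 'n set). of_int (sign p) / fact CARD('n) * h p x)" for x
  proof -
    have 1: "mixed_disc (\<lambda>j. Hess (w j) x) = (\<Sum>p | p permutes UNIV. of_int (sign p) * det (\<chi> j. grad (partial (p j) (w j)) x)) / fact CARD('n)"
    proof -
      have "(\<chi> j. transpose (Hess (w j) x) $ p j) = (\<chi> j. grad (partial (p j) (w j)) x)" for p
        by (simp add: vec_eq_iff transpose_def row)
      then show ?thesis by (subst mixed_disc_transpose[symmetric]) (simp only: mixed_disc_def)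
    qed
    have 2: "mixed_disc (\<lambda>j. if j = s then outer (grad v x) (grad (w s) x) else Hess (w j) x) =
      (\<Sum>p | p permutes UNIV. of_int (sign p) * (partial (p s) (w s) x * det (\<chi> j. if j = s then grad v x else grad (partial (p j) (w j)) x))) / fact CARD('n)"
    proof -
      have "(\<chi> j. transpose (if j = s then outer (grad v x) (grad (w s) x) else Hess (w j) x) $ p j)
         = (\<chi> j. if j = s then partial (p s) (w s) x *s grad v x else grad (partial (p j) (w j)) x)" for p
        by (simp add: vec_eq_iff transpose_def row mult.commute)
      then show ?thesis by (subst mixed_disc_transpose[symmetric]) (simp only: mixed_disc_def det_row_mul)
    qed
    show ?thesis unfolding 1 2 h_def
      by (simp add: sum_divide_distrib sum_distrib_left sum.distrib[symmetric] field_simps)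
  qed
  then have "(LINT x:D|lborel. \<theta> (v x) * mixed_disc (\<lambda>j. Hess (w j) x) +
     \<theta>' (v x) * mixed_disc (\<lambda>j. if j = s then outer (grad v x) (grad (w s) x) else Hess (w j) x))
     = (LINT x|lborel. (\<Sum>p | p permutes (UNIV :: 'n set). of_int (sign p) / fact CARD('n) * (indicator D x *\<^sub>R h p x)))"
    unfolding set_lebesgue_integral_def by (simp only: real_scaleR_def sum_distrib_left mult.left_commute)
  also have "\<dots> = (\<Sum>p | p permutes (UNIV :: 'n set). of_int (sign p) / fact CARD('n) * (LINT x|lborel. indicator D x *\<^sub>R h p x))"
    using h(1) by (subst Bochner_Integration.integral_sum) (auto simp: set_integrable_def)
  also have "\<dots> = 0"
    using h(2) by (simp add: set_lebesgue_integral_def)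
  finally show ?thesis .
qed

subsection \<open>Bounded continuous integrands\<close>

text \<open>A class closed under sums and products, integrable over bounded open sets, and
  containing all derivatives up to order two of a function in \<open>C2_closure\<close>.\<close>

definition bcont :: "'a::topological_space set \<Rightarrow> ('a \<Rightarrow> real) \<Rightarrow> bool" where
  "bcont D f \<longleftrightarrow> continuous_on D f \<and> bounded (f ` D)"

lemma bcont_const: "bcont D (\<lambda>_. c)"
  by (auto simp: bcont_def image_constant_conv)

lemma bcont_add: "bcont D f \<Longrightarrow> bcont D g \<Longrightarrow> bcont D (\<lambda>x. f x + g x)"
  by (auto simp: bcont_def intro: bounded_plus_comp continuous_on_add)

lemma bcont_mult:
  assumes "bcont D f" "bcont D g"
  shows "bcont D (\<lambda>x. f x * g x)"
proof -
  obtain B C where "\<And>x. x \<in> D \<Longrightarrow> \<bar>f x\<bar> \<le> B" "\<And>x. x \<in> D \<Longrightarrow> \<bar>g x\<bar> \<le> C"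
    using assms unfolding bcont_def bounded_iff by fastforce
  then have "\<bar>f x * g x\<bar> \<le> \<bar>B\<bar> * \<bar>C\<bar>" if "x \<in> D" for x
    unfolding abs_mult using that by (intro mult_mono) fastforce+
  then show ?thesis
    using assms by (auto simp: bcont_def bounded_iff intro!: continuous_on_mult)
qed

lemma bcont_minus: "bcont D f \<Longrightarrow> bcont D (\<lambda>x. - f x)"
  using bcont_mult[OF bcont_const[of D "-1"]] by simp

lemma bcont_abs: "bcont D f \<Longrightarrow> bcont D (\<lambda>x. \<bar>f x\<bar>)"
  by (auto simp: bcont_def bounded_iff intro: continuous_on_rabs)

lemma bcont_sum: "(\<And>i. i \<in> I \<Longrightarrow> bcont D (f i)) \<Longrightarrow> bcont D (\<lambda>x. \<Sum>i\<in>I. f i x)"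
  by (induction I rule: infinite_finite_induct) (auto intro: bcont_const bcont_add)

lemma bcont_prod: "(\<And>i. i \<in> I \<Longrightarrow> bcont D (f i)) \<Longrightarrow> bcont D (\<lambda>x. \<Prod>i\<in>I. f i x)"
  by (induction I rule: infinite_finite_induct) (auto intro: bcont_const bcont_mult)

lemma bcont_mixed_disc:
  assumes "\<And>r i j. bcont D (\<lambda>x. A x r $ i $ j)"
  shows "bcont D (\<lambda>x. mixed_disc (A x))"
  unfolding mixed_disc_expand divide_inverse
  by (intro bcont_mult bcont_sum bcont_const bcont_prod assms)

lemma bcont_measurable:
  fixes f :: "'a::euclidean_space \<Rightarrow> real"
  assumes "open D" "continuous_on D f"
  shows "(\<lambda>x. indicator D x *\<^sub>R f x) \<in> borel_measurable lborel"
  using borel_measurable_continuous_on_indicator[of D f] assms by simp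

lemma bcont_set_integrable:
  fixes f :: "'a::euclidean_space \<Rightarrow> real"
  assumes D: "open D" "bounded D" and f: "bcont D f"
  shows "set_integrable lborel D f"
proof -
  obtain B where B: "\<And>x. x \<in> D \<Longrightarrow> \<bar>f x\<bar> \<le> B"
    using f by (auto simp: bcont_def bounded_iff)
  have "emeasure lborel D < \<infinity>" using D(2) by (rule emeasure_bounded_finite)
  then have "integrable lborel (\<lambda>x. indicator D x * B)"
    using D(1) by (intro integrable_mult_left integrable_real_indicator) auto
  then have "integrable lborel (\<lambda>x. indicator D x *\<^sub>R f x)"
  proof (rule Bochner_Integration.integrable_bound)
    show "(\<lambda>x. indicator D x *\<^sub>R f x) \<in> borel_measurable lborel"
      using f by (intro bcont_measurable D) (simp add: bcont_def)
    have "norm (indicator D x *\<^sub>R f x) \<le> norm (indicator D x * B)" for x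
      using B[of x] by (cases "x \<in> D") auto
    then show "AE x in lborel. norm (indicator D x *\<^sub>R f x) \<le> norm (indicator D x * B)" by simp
  qed
  then show ?thesis by (simp add: set_integrable_def)
qed

lemma extends_to_closure_bounded:
  fixes D :: "(real ^ 'n) set"
  assumes "bounded D" "extends_to_closure D f"
  shows "bounded (f ` D)"
proof -
  obtain g where g: "continuous_on (closure D) g" "\<And>x. x \<in> D \<Longrightarrow> g x = f x"
    using assms(2) by (auto simp: extends_to_closure_def)
  have "compact (closure D)" using assms(1) by (simp add: compact_closure)
  then have "bounded (g ` closure D)"
    using compact_continuous_image[OF g(1)] compact_imp_bounded by blast
  then show ?thesis
    by (rule bounded_subset) (use g(2) closure_subset in \<open>force simp: image_iff\<close>)
qed

lemma C2_closure_bcont: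
  fixes D :: "(real ^ 'n) set"
  assumes D: "bounded D" and u: "C2_closure D u"
  shows "bcont D u" "bcont D (partial i u)" "bcont D (\<lambda>x. Hess u x $ i $ j)"
proof -
  have c: "continuous_on D u" using u by (auto simp: C2_closure_def intro: continuous_on_subset[OF _ closure_subset])
  moreover have "extends_to_closure D u" using u by (auto simp: C2_closure_def extends_to_closure_def)
  ultimately show "bcont D u" using extends_to_closure_bounded[OF D] by (simp add: bcont_def)
  have 1: "Ck_on 1 D (partial j u)" for j using u by (simp add: C2_closure_def Ck_on_2_iff)
  show "bcont D (partial i u)"
    using u Ck_on_1_continuous_on[OF 1] extends_to_closure_bounded[OF D] by (simp add: bcont_def C2_closure_def)
  have "continuous_on D (partial i (partial j u))" using 1[of j] by (simp add: One_nat_def)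
  then have "bcont D (partial i (partial j u))"
    using u extends_to_closure_bounded[OF D] by (simp add: bcont_def C2_closure_def)
  then show "bcont D (\<lambda>x. Hess u x $ i $ j)" by (simp add: Hess_def)
qed

lemma C2_closure_Ck: "C2_closure D u \<Longrightarrow> Ck_on 1 D u" "C2_closure D u \<Longrightarrow> Ck_on 2 D u"
  "C2_closure D u \<Longrightarrow> continuous_on (closure D) u"
  by (auto simp: C2_closure_def Ck_on_2_iff One_nat_def intro: Ck_on_1_continuous_on)

subsection \<open>Integration by parts for the Hessian form\<close>

lemma grad_eq_0_at_max:
  fixes v :: "real ^ 'n \<Rightarrow> real"
  assumes D: "open D" "x \<in> D" and v: "Ck_on 1 D v" and max: "\<And>y. y \<in> D \<Longrightarrow> v y \<le> v x"
  shows "grad v x = 0"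
proof -
  have "(v has_derivative (\<lambda>h. grad v x \<bullet> h)) (at x)"
    using v D by (intro has_derivative_grad) (auto simp: Ck_on_1_iff)
  then have "(\<lambda>h. grad v x \<bullet> h) = (\<lambda>h. 0)"
    using differential_zero_maxmin[of x D v] D max by blast
  then have "grad v x \<bullet> grad v x = 0" by metis
  then show ?thesis by simp
qed

lemma mixed_disc_zero_slot:
  fixes A :: "'n::finite \<Rightarrow> real ^ 'n ^ 'n"
  assumes "A s = 0"
  shows "mixed_disc A = 0"
proof -
  have "mixed_disc (A(s := 0 *\<^sub>R 0 + 0 *\<^sub>R 0)) = 0"
    by (simp only: mixed_disc_slot_linear mult_zero_left add_0_left)
  moreover have "A(s := 0 *\<^sub>R 0 + 0 *\<^sub>R 0) = A" using assms by auto
  ultimately show ?thesis by simp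
qed

text \<open>The cut-off identity for \<open>trunc e\<close>, with \<open>e\<close> tending to 0 by
  dominated convergence.\<close>

lemma hessian_by_parts:
  fixes D :: "(real ^ 'n) set" and w :: "'n \<Rightarrow> real ^ 'n \<Rightarrow> real" and s :: 'n
  assumes D: "open D" "bounded D" and v: "C2_closure D v"
    and bd: "\<forall>x\<in>frontier D. v x = 0" and neg: "\<And>x. x \<in> D \<Longrightarrow> v x \<le> 0" and w: "\<And>j. C2_closure D (w j)"
  shows "(LINT x:D|lborel. (- v x) * mixed_disc (\<lambda>j. Hess (w j) x)) =
    (LINT x:D|lborel. mixed_disc (\<lambda>j. if j = s then outer (grad v x) (grad (w s) x) else Hess (w j) x))"
proof -
  define A where "A x = mixed_disc (\<lambda>j. Hess (w j) x)" for x
  define B where "B x = mixed_disc (\<lambda>j. if j = s then outer (grad v x) (grad (w s) x) else Hess (w j) x)" for x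
  have bA: "bcont D A"
    unfolding A_def by (intro bcont_mixed_disc C2_closure_bcont D w)
  have bB: "bcont D B"
    unfolding B_def
  proof (intro bcont_mixed_disc)
    fix r i j
    show "bcont D (\<lambda>x. (if r = s then outer (grad v x) (grad (w s) x) else Hess (w r) x) $ i $ j)"
      by (cases "r = s") (simp_all add: bcont_mult C2_closure_bcont[OF D(2)] w v)
  qed
  have bv: "bcont D v" using C2_closure_bcont D v by blast
  define e where "e n = inverse (real (Suc n))" for n
  have e: "e n > 0" for n by (simp add: e_def)
  have e0: "e \<longlonglongrightarrow> 0" unfolding e_def by (rule LIMSEQ_inverse_real_of_nat)
  let ?s = "\<lambda>n x. indicator D x *\<^sub>R (trunc (e n) (v x) * A x + trunc' (e n) (v x) * B x)"
  let ?f = "\<lambda>x. indicator D x *\<^sub>R (v x * A x + B x)"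
  let ?w = "\<lambda>x. indicator D x *\<^sub>R (\<bar>v x\<bar> * \<bar>A x\<bar> + \<bar>B x\<bar>)"
  have 0: "(LINT x|lborel. ?s n x) = 0" for n
  proof -
    have "\<forall>s\<ge>- e n. trunc (e n) s = 0" using trunc_eq_0[OF e] by blast
    then show ?thesis
      using hessian_by_parts_cutoff[where w = w and s = s, OF D C2_closure_Ck(3)[OF v] C2_closure_Ck(1)[OF v] bd
          C2_closure_Ck(2)[OF w] trunc_deriv[OF e[of n]] trunc'_cont e[of n]]
      unfolding set_lebesgue_integral_def A_def B_def by blast
  qed
  have "(\<lambda>n. LINT x|lborel. ?s n x) \<longlonglongrightarrow> (LINT x|lborel. ?f x)"
  proof (rule integral_dominated_convergence[where w = ?w])
    show "?f \<in> borel_measurable lborel"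
      using bA bB bv by (intro bcont_measurable D continuous_intros) (auto simp: bcont_def)
    fix n
    have "continuous_on UNIV (trunc (e n))"
      using trunc_deriv[OF e[of n]] by (meson DERIV_continuous_on has_field_derivative_at_within)
    then have ct: "continuous_on D (\<lambda>x. trunc (e n) (v x))"
      by (rule continuous_on_compose2) (use bv in \<open>auto simp: bcont_def\<close>)
    have ct': "continuous_on D (\<lambda>x. trunc' (e n) (v x))"
      by (rule continuous_on_compose2[OF trunc'_cont]) (use bv in \<open>auto simp: bcont_def\<close>)
    show "?s n \<in> borel_measurable lborel"
      using bA bB ct ct' by (intro bcont_measurable D continuous_on_add continuous_on_mult) (auto simp: bcont_def)
    show "AE x in lborel. norm (?s n x) \<le> ?w x"
    proof (rule AE_I2)
      fix x
      show "norm (?s n x) \<le> ?w x"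
      proof (cases "x \<in> D")
        case True
        have "\<bar>trunc (e n) (v x) * A x + trunc' (e n) (v x) * B x\<bar> \<le> \<bar>trunc (e n) (v x)\<bar> * \<bar>A x\<bar> + \<bar>trunc' (e n) (v x)\<bar> * \<bar>B x\<bar>"
          by (metis abs_mult abs_triangle_ineq)
        also have "\<dots> \<le> \<bar>v x\<bar> * \<bar>A x\<bar> + 1 * \<bar>B x\<bar>"
          using trunc_bound[OF e[of n] neg[OF True]] trunc'_bounds[OF e[of n], of "v x"] neg[OF True]
          by (intro add_mono mult_right_mono) auto
        finally show ?thesis using True by simp
      qed simp
    qed
  next
    show "integrable lborel ?w"
      using bcont_set_integrable[OF D, of "\<lambda>x. \<bar>v x\<bar> * \<bar>A x\<bar> + \<bar>B x\<bar>"] bA bB bv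
      by (simp add: set_integrable_def bcont_add bcont_mult bcont_abs)
    show "AE x in lborel. (\<lambda>n. ?s n x) \<longlonglongrightarrow> ?f x"
    proof (rule AE_I2)
      fix x
      consider "x \<notin> D" | "x \<in> D" "v x = 0" | "x \<in> D" "v x < 0" using neg by force
      then show "(\<lambda>n. ?s n x) \<longlonglongrightarrow> ?f x"
      proof cases
        \<comment> \<open>Here \<open>trunc'\<close> stays 0 while the limit carries
          \<open>B x\<close> with factor 1. The two agree because \<open>v\<close> has an interior
          maximum at \<open>x\<close>, so its gradient and with it \<open>B x\<close>
          vanish.\<close>
        case 2
        have "grad v x = 0"
          using 2 neg by (intro grad_eq_0_at_max[OF D(1)] C2_closure_Ck v) auto
        then have "B x = 0"
          unfolding B_def by (intro mixed_disc_zero_slot[of _ s]) (simp add: vec_eq_iff)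
        then show ?thesis using 2 trunc_eq_0[OF e] e by (simp add: less_imp_le)
      next
        case 3
        have "eventually (\<lambda>n. e n < - v x / 2) sequentially"
          using e0 3 by (intro order_tendstoD) auto
        then have ev: "eventually (\<lambda>n. ?s n x = (v x + 3 * e n / 2) * A x + B x) sequentially"
          by eventually_elim (use 3 trunc_far[OF e] trunc'_far[OF e] in simp)
        have "(\<lambda>n. (v x + 3 * e n / 2) * A x + B x) \<longlonglongrightarrow> (v x + 3 * 0 / 2) * A x + B x"
          by (intro tendsto_intros e0) auto
        then show ?thesis using 3 tendsto_cong[OF ev] by simp
      qed simp
    qed
  qed
  then have "(LINT x|lborel. ?f x) = 0" unfolding 0 by (simp add: LIMSEQ_const_iff)
  then have "(LINT x:D|lborel. B x - (- v x) * A x) = 0"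
    by (simp add: set_lebesgue_integral_def add.commute)
  moreover have "(LINT x:D|lborel. B x - (- v x) * A x) = (LINT x:D|lborel. B x) - (LINT x:D|lborel. (- v x) * A x)"
    using bA bB bv by (intro set_integral_diff bcont_set_integrable D bcont_mult bcont_minus)
  ultimately show ?thesis by (simp add: A_def B_def)
qed

subsection \<open>Symmetry of second derivatives\<close>

lemma partial_line_derivative:
  fixes f :: "real ^ 'n \<Rightarrow> real"
  assumes "f differentiable (at (x + s *\<^sub>R axis i 1))"
  shows "((\<lambda>s. f (x + s *\<^sub>R axis i 1)) has_real_derivative partial i f (x + s *\<^sub>R axis i 1)) (at s)"
proof -
  let ?y = "x + s *\<^sub>R axis i 1"
  have d: "((\<lambda>s. x + s *\<^sub>R axis i 1) has_derivative (\<lambda>h. h *\<^sub>R axis i 1)) (at s)"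
    by (auto intro!: derivative_eq_intros)
  have "((\<lambda>s. f (x + s *\<^sub>R axis i 1)) has_derivative (\<lambda>h. grad f ?y \<bullet> (h *\<^sub>R axis i 1))) (at s)"
    by (rule has_derivative_compose[OF d has_derivative_grad[OF assms]])
  then show ?thesis
    by (rule has_derivative_imp_has_field_derivative) (simp add: inner_axis)
qed

text \<open>Two applications of the mean value theorem. The left-hand side is symmetric in
  \<open>i\<close> and \<open>j\<close>, which yields the symmetry of second derivatives as
  \<open>h\<close> shrinks.\<close>

lemma second_difference_mean_value:
  fixes u :: "real ^ 'n \<Rightarrow> real"
  assumes u: "Ck_on 2 D u" and h: "h > 0"
    and D: "\<And>s t. 0 \<le> s \<Longrightarrow> s \<le> h \<Longrightarrow> 0 \<le> t \<Longrightarrow> t \<le> h \<Longrightarrow> x + s *\<^sub>R axis i 1 + t *\<^sub>R axis j 1 \<in> D"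
  obtains s t where "0 < s" "s < h" "0 < t" "t < h"
    "u (x + h *\<^sub>R axis i 1 + h *\<^sub>R axis j 1) - u (x + h *\<^sub>R axis i 1) - u (x + h *\<^sub>R axis j 1) + u x
      = h\<^sup>2 * partial j (partial i u) (x + s *\<^sub>R axis i 1 + t *\<^sub>R axis j 1)"
proof -
  let ?i = "axis i (1::real)" and ?j = "axis j (1::real)"
  let ?g = "\<lambda>s. u ((x + h *\<^sub>R ?j) + s *\<^sub>R ?i) - u (x + s *\<^sub>R ?i)"
  have du: "u differentiable (at y)" if "y \<in> D" for y using u that by (simp add: Ck_on_2_iff)
  have dp: "partial i u differentiable (at y)" if "y \<in> D" for y using u that by (simp add: Ck_on_2_iff One_nat_def)
  have "(?g has_real_derivative partial i u ((x + h *\<^sub>R ?j) + s *\<^sub>R ?i) - partial i u (x + s *\<^sub>R ?i)) (at s)"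
    if "0 \<le> s" "s \<le> h" for s
  proof (intro DERIV_diff partial_line_derivative du)
    show "x + h *\<^sub>R ?j + s *\<^sub>R ?i \<in> D" using D[OF that, of h] h by (simp add: add_ac)
    show "x + s *\<^sub>R ?i \<in> D" using D[OF that, of 0] h by simp
  qed
  from MVT2[OF h this] obtain s where s: "0 < s" "s < h"
    "?g h - ?g 0 = (h - 0) * (partial i u ((x + h *\<^sub>R ?j) + s *\<^sub>R ?i) - partial i u (x + s *\<^sub>R ?i))"
    by auto
  let ?k = "\<lambda>t. partial i u ((x + s *\<^sub>R ?i) + t *\<^sub>R ?j)"
  have "(?k has_real_derivative partial j (partial i u) ((x + s *\<^sub>R ?i) + t *\<^sub>R ?j)) (at t)" if "0 \<le> t" "t \<le> h" for t
    using D[of s t] s that by (intro partial_line_derivative dp) auto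
  from MVT2[OF h this] obtain t where t: "0 < t" "t < h"
    "?k h - ?k 0 = (h - 0) * partial j (partial i u) ((x + s *\<^sub>R ?i) + t *\<^sub>R ?j)"
    by auto
  have "u (x + h *\<^sub>R ?i + h *\<^sub>R ?j) - u (x + h *\<^sub>R ?i) - u (x + h *\<^sub>R ?j) + u x = ?g h - ?g 0"
    by (simp add: add_ac)
  also have "\<dots> = h * (?k h - ?k 0)" using s(3) by (simp add: add_ac)
  also have "\<dots> = h\<^sup>2 * partial j (partial i u) (x + s *\<^sub>R ?i + t *\<^sub>R ?j)"
    unfolding t(3) by (simp add: power2_eq_square)
  finally show ?thesis using that s(1,2) t(1,2) by blast
qed

lemma mixed_partials_commute:
  fixes u :: "real ^ 'n \<Rightarrow> real"
  assumes D: "open D" "x \<in> D" and u: "Ck_on 2 D u"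
  shows "partial i (partial j u) x = partial j (partial i u) x"
proof (rule ccontr)
  let ?P = "partial i (partial j u)" and ?Q = "partial j (partial i u)"
  assume neq: "?P x \<noteq> ?Q x"
  define e where "e = \<bar>?P x - ?Q x\<bar> / 2"
  have e: "e > 0" using neq by (simp add: e_def)
  have "isCont ?P x" "isCont ?Q x"
    using u D by (auto simp: Ck_on_2_iff One_nat_def continuous_on_eq_continuous_at)
  note c = this[unfolded continuous_at_eps_delta, rule_format, OF e]
  obtain d1 where d1: "d1 > 0" "\<And>y. dist y x < d1 \<Longrightarrow> dist (?P y) (?P x) < e"
    using c(1) by blast
  obtain d2 where d2: "d2 > 0" "\<And>y. dist y x < d2 \<Longrightarrow> dist (?Q y) (?Q x) < e"
    using c(2) by blast
  obtain r where r: "r > 0" "ball x r \<subseteq> D" using D openE by blast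
  define h where "h = min r (min d1 d2) / 3"
  have h: "h > 0" "2 * h < r" "2 * h < d1" "2 * h < d2" using r d1 d2 by (auto simp: h_def)
  have dist: "dist (x + s *\<^sub>R axis a 1 + t *\<^sub>R axis b 1) x \<le> 2 * h"
    if "0 \<le> s" "s \<le> h" "0 \<le> t" "t \<le> h" for s t and a b :: 'n
  proof -
    have "norm (s *\<^sub>R axis a (1::real) + t *\<^sub>R axis b 1 :: real ^ 'n) \<le> norm (s *\<^sub>R axis a 1 :: real ^ 'n) + norm (t *\<^sub>R axis b 1 :: real ^ 'n)"
      by (rule norm_triangle_ineq)
    then show ?thesis using that by (simp add: dist_norm add.assoc)
  qed
  have inD: "x + s *\<^sub>R axis a 1 + t *\<^sub>R axis b 1 \<in> D"
    if "0 \<le> s" "s \<le> h" "0 \<le> t" "t \<le> h" for s t and a b :: 'n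
    using dist[OF that, of a b] h r by (auto simp: dist_commute subset_eq)
  obtain s t where st: "0 < s" "s < h" "0 < t" "t < h"
    "u (x + h *\<^sub>R axis i 1 + h *\<^sub>R axis j 1) - u (x + h *\<^sub>R axis i 1) - u (x + h *\<^sub>R axis j 1) + u x
      = h\<^sup>2 * ?Q (x + s *\<^sub>R axis i 1 + t *\<^sub>R axis j 1)"
    using second_difference_mean_value[OF u h(1) inD, of i j] by blast
  obtain s' t' where st': "0 < s'" "s' < h" "0 < t'" "t' < h"
    "u (x + h *\<^sub>R axis j 1 + h *\<^sub>R axis i 1) - u (x + h *\<^sub>R axis j 1) - u (x + h *\<^sub>R axis i 1) + u x
      = h\<^sup>2 * ?P (x + s' *\<^sub>R axis j 1 + t' *\<^sub>R axis i 1)"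
    using second_difference_mean_value[OF u h(1) inD, of j i] by blast
  have "h\<^sup>2 * ?Q (x + s *\<^sub>R axis i 1 + t *\<^sub>R axis j 1) = h\<^sup>2 * ?P (x + s' *\<^sub>R axis j 1 + t' *\<^sub>R axis i 1)"
    unfolding st(5)[symmetric] st'(5)[symmetric] by (simp add: add_ac)
  then have "?Q (x + s *\<^sub>R axis i 1 + t *\<^sub>R axis j 1) = ?P (x + s' *\<^sub>R axis j 1 + t' *\<^sub>R axis i 1)"
    using h(1) by simp
  moreover have "\<bar>?Q (x + s *\<^sub>R axis i 1 + t *\<^sub>R axis j 1) - ?Q x\<bar> < e"
    using d2(2)[of "x + s *\<^sub>R axis i 1 + t *\<^sub>R axis j 1"] dist[of s t i j] st h(4) by (simp add: dist_real_def)
  moreover have "\<bar>?P (x + s' *\<^sub>R axis j 1 + t' *\<^sub>R axis i 1) - ?P x\<bar> < e"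
    using d1(2)[of "x + s' *\<^sub>R axis j 1 + t' *\<^sub>R axis i 1"] dist[of s' t' j i] st' h(3) by (simp add: dist_real_def)
  ultimately show False unfolding e_def by argo
qed

lemma Hess_symmetric:
  assumes "open D" "x \<in> D" "Ck_on 2 D u"
  shows "Hess u x \<in> symmetric_matrices"
  using mixed_partials_commute[OF assms] by (simp add: symmetric_matrices_nth Hess_def)

subsection \<open>The quadratic potential\<close>

definition half_norm2 :: "real ^ 'n \<Rightarrow> real" where
  "half_norm2 x = x \<bullet> x / 2"

lemma partial_half_norm2: "partial i half_norm2 = (\<lambda>x. x $ i)"
  and half_norm2_differentiable: "half_norm2 differentiable (at x)"
proof -
  have d: "(half_norm2 has_derivative (\<lambda>h. x \<bullet> h)) (at x)" for x :: "real ^ 'n"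
    unfolding half_norm2_def[abs_def]
    by (auto intro!: derivative_eq_intros simp: inner_commute fun_eq_iff)
  show "partial i half_norm2 = (\<lambda>x. x $ i)"
    using has_derivative_inner_eq_grad(3)[OF d] by (rule ext)
  show "half_norm2 differentiable (at x)" using has_derivative_inner_eq_grad(1)[OF d] .
qed

lemma partial_component:
  shows "partial j (\<lambda>x :: real ^ 'n. x $ i) = (\<lambda>_. if i = j then 1 else 0)"
    and "(\<lambda>x :: real ^ 'n. x $ i) differentiable (at x)"
proof -
  have d: "((\<lambda>x :: real ^ 'n. x $ i) has_derivative (\<lambda>h. axis i 1 \<bullet> h)) (at x)" for x
    by (simp add: inner_axis' bounded_linear_imp_has_derivative bounded_linear_vec_nth)
  show "partial j (\<lambda>x :: real ^ 'n. x $ i) = (\<lambda>_. if i = j then 1 else 0)"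
    using has_derivative_inner_eq_grad(3)[OF d] by (auto simp: axis_def fun_eq_iff)
  show "(\<lambda>x :: real ^ 'n. x $ i) differentiable (at x)" using has_derivative_inner_eq_grad(1)[OF d] .
qed

lemma Hess_half_norm2: "Hess half_norm2 x = mat 1"
  by (simp add: Hess_def partial_half_norm2 partial_component mat_def vec_eq_iff eq_commute)

lemma C2_closure_half_norm2: "C2_closure D (half_norm2 :: real ^ 'n \<Rightarrow> real)"
proof -
  have "continuous_on S (\<lambda>x :: real ^ 'n. x $ i)" for S i by (intro continuous_intros)
  moreover have "continuous_on (closure D) (half_norm2 :: real ^ 'n \<Rightarrow> real)"
    unfolding half_norm2_def by (intro continuous_intros) auto
  moreover have "\<exists>g. continuous_on (closure D) g \<and> (\<forall>x\<in>D. g x = c)" for c :: real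
    by (intro exI[of _ "\<lambda>_. c"]) (auto intro: continuous_on_const)
  ultimately show ?thesis
    unfolding C2_closure_def extends_to_closure_def
    by (auto simp: numeral_2_eq_2 partial_half_norm2 partial_component half_norm2_differentiable continuous_on_const)
qed

subsection \<open>The maximum principle\<close>

lemma second_derivative_at_max:
  fixes f f' :: "real \<Rightarrow> real"
  assumes d: "d > 0" and f: "\<And>s. \<bar>s\<bar> < d \<Longrightarrow> (f has_field_derivative f' s) (at s)"
    and f'': "(f' has_field_derivative c) (at 0)" and max: "\<And>s. \<bar>s\<bar> < d \<Longrightarrow> f s \<le> f 0"
  shows "c \<le> 0"
proof (rule ccontr)
  assume "\<not> c \<le> 0"
  then obtain e where e: "e > 0" "\<And>h. 0 < h \<Longrightarrow> h < e \<Longrightarrow> f' 0 < f' (0 + h)"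
    using DERIV_pos_inc_right[OF f''] by auto
  have "f' 0 = 0"
    by (rule DERIV_local_max[OF f[of 0] d]) (use d max in auto)
  define h where "h = min d e / 2"
  have h: "0 < h" "h < d" "h < e" using d e by (auto simp: h_def)
  obtain z where z: "0 < z" "z < h" "f h - f 0 = (h - 0) * f' z"
    using MVT2[of 0 h f f'] h f by auto
  have "f' z > 0" using e(2)[of z] z h \<open>f' 0 = 0\<close> by simp
  then have "f h > f 0" using z h by (simp add: algebra_simps)
  then show False using max[of h] h by simp
qed

text \<open>By \<open>mixed_disc_single\<close> the hypothesis \<open>sub\<close> says that the
  Laplacian is nonnegative. Adding a small multiple of \<open>half_norm2\<close> makes second
  derivatives strictly negative at an interior maximum.\<close>

lemma subharmonic_nonpos:
  fixes D :: "(real ^ 'n) set" and a :: 'n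
  assumes D: "open D" "bounded D" and u: "C2_closure D u" and bd: "\<forall>x\<in>frontier D. u x = 0"
    and sub: "\<And>x. x \<in> D \<Longrightarrow> 0 \<le> mixed_disc (\<lambda>r. if r = a then Hess u x else mat 1)"
    and x0: "x0 \<in> D"
  shows "u x0 \<le> 0"
proof (rule ccontr)
  assume "\<not> u x0 \<le> 0"
  then have pos: "u x0 > 0" by simp
  have comp: "compact (closure D)" using D(2) by (simp add: compact_closure)
  obtain R where R: "R > 0" "\<And>x. x \<in> closure D \<Longrightarrow> norm x \<le> R"
    using compact_imp_bounded[OF comp] unfolding bounded_pos by blast
  \<comment> \<open>With this \<open>e\<close> the added term is at most \<open>u x0 / 2\<close> on
    the closure, so on the boundary the perturbed function stays below its value at
    \<open>x0\<close>.\<close>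
  define e where "e = u x0 / R\<^sup>2"
  have e: "e > 0" "e * R\<^sup>2 = u x0" using pos R(1) by (simp_all add: e_def)
  define f where "f x = u x + e * half_norm2 x" for x
  have "continuous_on (closure D) f"
    unfolding f_def using C2_closure_Ck(3)[OF u] C2_closure_Ck(3)[OF C2_closure_half_norm2, of D]
    by (intro continuous_intros)
  then obtain y where y: "y \<in> closure D" "\<And>x. x \<in> closure D \<Longrightarrow> f x \<le> f y"
    using continuous_attains_sup[OF comp, of f] x0 closure_subset by blast
  have "f y \<ge> u x0"
  proof -
    have "u x0 \<le> f x0" using e(1) by (simp add: f_def half_norm2_def)
    then show ?thesis using y(2)[of x0] x0 closure_subset by fastforce
  qed
  have yD: "y \<in> D"
  proof (rule ccontr)
    assume "y \<notin> D"
    then have "y \<in> frontier D" using y(1) D(1) by (simp add: frontier_def interior_open)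
    then have "f y = e * half_norm2 y" using bd by (simp add: f_def)
    also have "half_norm2 y \<le> R\<^sup>2 / 2"
      using R(2)[OF y(1)] by (simp add: half_norm2_def dot_square_norm power_mono)
    then have "e * half_norm2 y \<le> e * (R\<^sup>2 / 2)" using e(1) by (simp add: mult_left_mono)
    also have "\<dots> < u x0" using e pos by simp
    finally show False using \<open>f y \<ge> u x0\<close> by simp
  qed
  obtain r where r: "r > 0" "ball y r \<subseteq> D" using D(1) yD openE by blast
  have neg: "Hess u y $ i $ i < 0" for i
  proof -
    let ?l = "\<lambda>s. y + s *\<^sub>R axis i (1::real)"
    have l: "?l s \<in> D" if "\<bar>s\<bar> < r" for s
      using r(2) that by (auto simp: subset_eq dist_norm)
    have "partial i (partial i u) y + e * 1 \<le> 0"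
    proof (rule second_derivative_at_max[OF r(1)])
      fix s assume s: "\<bar>s\<bar> < r"
      show "((\<lambda>s. f (?l s)) has_field_derivative partial i u (?l s) + e * partial i half_norm2 (?l s)) (at s)"
        unfolding f_def using C2_closure_Ck(1)[OF u] l[OF s]
        by (intro DERIV_add DERIV_cmult partial_line_derivative half_norm2_differentiable) (auto simp: Ck_on_1_iff)
      show "f (?l s) \<le> f (?l 0)" using y(2)[of "?l s"] l[OF s] closure_subset by auto
    next
      have "((\<lambda>s. partial i half_norm2 (?l s)) has_field_derivative 1) (at 0)"
        using partial_line_derivative[of "partial i half_norm2" y 0 i] by (simp add: partial_half_norm2 partial_component)
      moreover have "((\<lambda>s. partial i u (?l s)) has_field_derivative partial i (partial i u) y) (at 0)"
        using partial_line_derivative[of "partial i u" y 0 i] C2_closure_Ck(2)[OF u] yD by (simp add: Ck_on_2_iff One_nat_def)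
      ultimately show "((\<lambda>s. partial i u (?l s) + e * partial i half_norm2 (?l s)) has_field_derivative partial i (partial i u) y + e * 1) (at 0)"
        by (intro DERIV_add DERIV_cmult)
    qed
    then show ?thesis using e(1) by (simp add: Hess_def)
  qed
  have "(\<Sum>p | p permutes (UNIV :: 'n set). Hess u y $ p a $ p a) < 0"
  proof -
    have "{p. p permutes (UNIV :: 'n set)} \<noteq> {}" using permutes_id by blast
    then have "(\<Sum>p | p permutes (UNIV :: 'n set). Hess u y $ p a $ p a) < (\<Sum>p | p permutes (UNIV :: 'n set). 0)"
      using neg by (intro sum_strict_mono) (auto simp: finite_permutations)
    then show ?thesis by simp
  qed
  then have "mixed_disc (\<lambda>r. if r = a then Hess u y else mat 1) < 0"
    unfolding mixed_disc_single by (simp add: divide_neg_pos)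
  then show False using sub[OF yD] by simp
qed

subsection \<open>From two arguments to all arguments\<close>

lemma quadratic_form_discriminant:
  fixes a b c :: real
  assumes "a \<ge> 0" "\<And>t. 0 \<le> a * t\<^sup>2 + 2 * b * t + c"
  shows "b\<^sup>2 \<le> a * c"
proof (cases "a = 0")
  case True
  have "b = 0"
  proof (rule ccontr)
    assume "b \<noteq> 0"
    \<comment> \<open>The linear function takes the value \<open>- 1\<close> at this point.\<close>
    then show False using assms(2)[of "- (c + 1) / (2 * b)"] True by simp
  qed
  then show ?thesis using True by simp
next
  case False
  have "0 \<le> a * (a * (- b / a)\<^sup>2 + 2 * b * (- b / a) + c)"
    by (rule mult_nonneg_nonneg[OF assms])
  also have "\<dots> = a * c - b\<^sup>2" using False by (simp add: field_simps power2_eq_square)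
  finally show ?thesis by simp
qed

text \<open>Among the index tuples maximizing the normalized form take one in which the value at index
  \<open>0\<close> occurs most often; the Cauchy-Schwarz inequality forces it to be constant.\<close>

lemma normalized_form_le_1:
  fixes W :: "(nat \<Rightarrow> nat) \<Rightarrow> real"
  assumes k: "1 \<le> k"
    and perm: "\<And>c p. c \<in> {..k} \<rightarrow>\<^sub>E {..k} \<Longrightarrow> p permutes {1..k} \<Longrightarrow> W (c \<circ> p) = W c"
    and nonneg: "\<And>c. c \<in> {..k} \<rightarrow>\<^sub>E {..k} \<Longrightarrow> 0 \<le> W c"
    and CS: "\<And>c. c \<in> {..k} \<rightarrow>\<^sub>E {..k} \<Longrightarrow> (W c)\<^sup>2 \<le> W (c(1 := c 0)) * W (c(0 := c 1))"
    and diag: "\<And>c. c \<in> {..k} \<rightarrow>\<^sub>E {..k} \<Longrightarrow> (\<forall>i\<le>k. c i = c 0) \<Longrightarrow> W c \<le> 1"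
    and c: "c \<in> {..k} \<rightarrow>\<^sub>E {..k}"
  shows "W c \<le> 1"
proof (rule ccontr)
  assume gt: "\<not> W c \<le> 1"
  let ?C = "{..k} \<rightarrow>\<^sub>E {..k}"
  let ?N = "\<lambda>c::nat \<Rightarrow> nat. card {i \<in> {..k}. c i = c 0}"
  have finC: "finite ?C" by (intro finite_PiE) auto
  define w where "w = Max (W ` ?C)"
  have le_w: "W c \<le> w" if "c \<in> ?C" for c unfolding w_def using finC that by simp
  have "w \<in> W ` ?C" unfolding w_def using finC c by (intro Max_in) auto
  then have ne: "?N ` {c \<in> ?C. W c = w} \<noteq> {}" by auto
  have fin: "finite (?N ` {c \<in> ?C. W c = w})" using finC by simp
  obtain b where b: "b \<in> ?C" "W b = w" and Nb: "?N b = Max (?N ` {c \<in> ?C. W c = w})"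
    using Max_in[OF fin ne] by (auto simp del: Max_in)
  have bmax: "?N c \<le> ?N b" if "c \<in> ?C" "W c = w" for c
    unfolding Nb using fin that by (intro Max_ge) auto
  have "w > 1" using gt le_w[OF c] by simp
  then have "\<not> (\<forall>i\<le>k. b i = b 0)"
  proof (intro notI)
    assume "w > 1" "\<forall>i\<le>k. b i = b 0"
    then have "W b \<le> 1" using diag[OF b(1)] by blast
    then show False using b(2) \<open>w > 1\<close> by simp
  qed
  then obtain i where i: "i \<le> k" "b i \<noteq> b 0" by blast
  then have "i \<ge> 1" by (cases i) auto
  define p where "p = Transposition.transpose 1 i"
  have p: "p permutes {1..k}" unfolding p_def using i \<open>i \<ge> 1\<close> by (intro permutes_swap_id) auto
  then have pk: "p permutes {..k}" by (rule permutes_subset) auto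
  define d where "d = b \<circ> p"
  have p01: "p 0 = 0" "p 1 = i" using \<open>i \<ge> 1\<close> by (auto simp: p_def Transposition.transpose_def)
  have dC: "d \<in> ?C"
  proof (rule PiE_I)
    show "d x \<in> {..k}" if "x \<in> {..k}" for x
      using permutes_in_image[OF pk, of x] that b(1) by (auto simp: d_def PiE_def Pi_def)
    show "d x = undefined" if "x \<notin> {..k}" for x
      using permutes_not_in[OF pk that] b(1) that by (auto simp: d_def PiE_def extensional_def)
  qed
  have Wd: "W d = w" unfolding d_def using perm[OF b(1) p] b(2) by simp
  have Nd: "?N d = ?N b"
  proof -
    have "p ` {i \<in> {..k}. d i = d 0} = {i \<in> {..k}. b i = b 0}"
    proof (intro equalityI subsetI)
      fix j assume "j \<in> {i \<in> {..k}. b i = b 0}"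
      then show "j \<in> p ` {i \<in> {..k}. d i = d 0}"
        using permutes_in_image[OF permutes_inv[OF pk], of j] permutes_inverses(1)[OF pk, of j]
        by (intro image_eqI[of _ _ "inv p j"]) (auto simp: d_def p01)
    qed (use permutes_in_image[OF pk] in \<open>auto simp: d_def p01\<close>)
    then show ?thesis using card_image[OF inj_on_subset[OF permutes_inj[OF pk] subset_UNIV]] by metis
  qed
  let ?d1 = "d(1 := d 0)" and ?d2 = "d(0 := d 1)"
  have C12: "?d1 \<in> ?C" "?d2 \<in> ?C"
    using dC k by (auto simp: PiE_def Pi_def extensional_def)
  \<comment> \<open>Both factors are at most \<open>w\<close>, so \<open>?d1\<close> is a maximizer
    as well, and the value at index 0 occurs in it once more than in \<open>d\<close>.\<close>
  have "w * w \<le> W ?d1 * W ?d2" using CS[OF dC] by (simp add: Wd power2_eq_square)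
  also have "\<dots> \<le> W ?d1 * w" using nonneg[OF C12(1)] le_w[OF C12(2)] by (rule mult_left_mono[rotated])
  finally have "w \<le> W ?d1" using \<open>w > 1\<close> by simp
  then have "W ?d1 = w" using le_w[OF C12(1)] by simp
  then have "?N ?d1 \<le> ?N d" using bmax[OF C12(1)] Nd by simp
  moreover have "{i \<in> {..k}. d i = d 0} \<subset> {i \<in> {..k}. ?d1 i = ?d1 0}"
  proof -
    have "1 \<notin> {i \<in> {..k}. d i = d 0}" using i(2) p01 by (simp add: d_def)
    moreover have "1 \<in> {i \<in> {..k}. ?d1 i = ?d1 0}" using k by simp
    ultimately show ?thesis by auto
  qed
  then have "?N d < ?N ?d1" by (intro psubset_card_mono) auto
  ultimately show False by simp
qed

text \<open>Shows that the Cauchy-Schwarz inequality survives division by the normalizing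
  product.\<close>

lemma prod_fun_upd_mult:
  fixes r :: "nat \<Rightarrow> real" and k :: nat
  assumes "1 \<le> k"
  shows "(\<Prod>i\<le>k. r ((c(1 := c 0)) i)) * (\<Prod>i\<le>k. r ((c(0 := c 1)) i)) = (\<Prod>i\<le>k. r (c i))\<^sup>2"
proof -
  have split: "(\<Prod>i\<le>k. g i) = g 0 * g 1 * (\<Prod>i\<in>{2..k}. g i)" for g :: "nat \<Rightarrow> real"
  proof -
    have "{..k} = insert 0 (insert 1 {2..k})" using assms by auto
    then show ?thesis by simp
  qed
  have "(\<Prod>i\<in>{2..k}. r ((c(1 := c 0)) i)) = (\<Prod>i\<in>{2..k}. r (c i))" "(\<Prod>i\<in>{2..k}. r ((c(0 := c 1)) i)) = (\<Prod>i\<in>{2..k}. r (c i))"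
    by (intro prod.cong; simp)+
  then show ?thesis unfolding split by (simp add: power2_eq_square)
qed

text \<open>Dividing by one root factor per argument reduces the claim to the bound 1 for the
  normalized form.\<close>

lemma form_le_prod_root:
  fixes M :: "(nat \<Rightarrow> nat) \<Rightarrow> real"
  assumes k: "1 \<le> k"
    and dep: "\<And>c c'. (\<And>i. i \<le> k \<Longrightarrow> c i = c' i) \<Longrightarrow> M c = M c'"
    and perm: "\<And>c p. (\<And>i. i \<le> k \<Longrightarrow> c i \<le> k) \<Longrightarrow> p permutes {1..k} \<Longrightarrow> M (c \<circ> p) = M c"
    and nonneg: "\<And>c. (\<And>i. i \<le> k \<Longrightarrow> c i \<le> k) \<Longrightarrow> 0 \<le> M c"
    and CS: "\<And>c. (\<And>i. i \<le> k \<Longrightarrow> c i \<le> k) \<Longrightarrow> (M c)\<^sup>2 \<le> M (c(1 := c 0)) * M (c(0 := c 1))"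
  shows "M id \<le> (\<Prod>j=0..k. root (k + 1) (M (\<lambda>_. j)))"
proof -
  let ?J = "\<lambda>j. M (\<lambda>_. j)"
  have J: "?J j \<ge> 0" if "j \<le> k" for j using that by (intro nonneg)
  have pert: "M id \<le> (\<Prod>j=0..k. root (k + 1) (?J j + e))" if e: "e > 0" for e
  proof -
    \<comment> \<open>The shift by \<open>e\<close> keeps the divisors positive when some diagonal
      value vanishes; it is removed in the limit. A constant tuple repeats the same root
      \<open>k + 1\<close> times and gives the diagonal value plus \<open>e\<close>.\<close>
    define r where "r j = root (k + 1) (?J j + e)" for j
    have r: "r j > 0" if "j \<le> k" for j unfolding r_def using J[OF that] e by simp
    define W where "W c = M c / (\<Prod>i\<le>k. r (c i))" for c
    have C: "c i \<le> k" if "c \<in> {..k} \<rightarrow>\<^sub>E {..k}" "i \<le> k" for c :: "nat \<Rightarrow> nat" and i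
      using that by (auto simp: PiE_def Pi_def)
    have P: "(\<Prod>i\<le>k. r (c i)) > 0" if "c \<in> {..k} \<rightarrow>\<^sub>E {..k}" for c
      using r C[OF that] by (intro prod_pos) auto
    let ?id = "restrict id {..k}"
    have "W ?id \<le> 1"
    proof (rule normalized_form_le_1[OF k, where W = W and c = ?id])
      fix c :: "nat \<Rightarrow> nat" and p assume c: "c \<in> {..k} \<rightarrow>\<^sub>E {..k}" and p: "p permutes {1..k}"
      then have "p permutes {..k}" by (auto intro: permutes_subset)
      then have "(\<Prod>i\<le>k. r ((c \<circ> p) i)) = (\<Prod>i\<le>k. r (c i))"
        using prod.permute[of p "{..k}" "\<lambda>i. r (c i)"] by (simp add: o_def)
      moreover have "M (c \<circ> p) = M c" using C[OF c] p by (intro perm)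
      ultimately show "W (c \<circ> p) = W c" by (simp add: W_def)
    next
      fix c :: "nat \<Rightarrow> nat" assume c: "c \<in> {..k} \<rightarrow>\<^sub>E {..k}"
      show "0 \<le> W c" unfolding W_def using P[OF c] nonneg[of c] C[OF c] by (simp add: less_imp_le)
      have "(W c)\<^sup>2 = (M c)\<^sup>2 / ((\<Prod>i\<le>k. r ((c(1 := c 0)) i)) * (\<Prod>i\<le>k. r ((c(0 := c 1)) i)))"
        unfolding W_def prod_fun_upd_mult[OF k] by (simp add: power_divide)
      also have "\<dots> \<le> (M (c(1 := c 0)) * M (c(0 := c 1))) / ((\<Prod>i\<le>k. r ((c(1 := c 0)) i)) * (\<Prod>i\<le>k. r ((c(0 := c 1)) i)))"
        using CS[of c] C[OF c] unfolding prod_fun_upd_mult[OF k] by (intro divide_right_mono) auto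
      also have "\<dots> = W (c(1 := c 0)) * W (c(0 := c 1))" unfolding W_def by simp
      finally show "(W c)\<^sup>2 \<le> W (c(1 := c 0)) * W (c(0 := c 1))" .
      assume const: "\<forall>i\<le>k. c i = c 0"
      have "M c = ?J (c 0)" by (rule dep) (use const in blast)
      moreover have "(\<Prod>i\<le>k. r (c i)) = ?J (c 0) + e"
      proof -
        have "(\<Prod>i\<le>k. r (c i)) = (\<Prod>i\<le>k. r (c 0))" using const by (intro prod.cong refl arg_cong[where f = r]) blast
        also have "\<dots> = root (k + 1) (?J (c 0) + e) ^ (k + 1)" by (simp add: r_def)
        also have "\<dots> = ?J (c 0) + e" using J[of "c 0"] C[OF c, of 0] e by (intro real_root_pow_pos2) auto
        finally show ?thesis .
      qed
      ultimately show "W c \<le> 1" unfolding W_def using J[of "c 0"] C[OF c, of 0] e by simp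
    qed simp
    moreover have "M ?id = M id" by (rule dep) simp
    moreover have "(\<Prod>i\<le>k. r (?id i)) = (\<Prod>j=0..k. r j)" by (intro prod.cong) auto
    moreover have "(\<Prod>j=0..k. r j) > 0" using r by (intro prod_pos) auto
    ultimately show ?thesis by (simp add: W_def r_def)
  qed
  have "(\<lambda>n. \<Prod>j=0..k. root (k + 1) (?J j + inverse (real (Suc n)))) \<longlonglongrightarrow> (\<Prod>j=0..k. root (k + 1) (?J j + 0))"
    by (intro tendsto_prod tendsto_real_root tendsto_add tendsto_const LIMSEQ_inverse_real_of_nat)
  then have "M id \<le> (\<Prod>j=0..k. root (k + 1) (?J j + 0))"
    by (rule LIMSEQ_le_const) (use pert in auto)
  then show ?thesis by simp
qed

subsection \<open>The Hessian integral inequality\<close>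

definition hess_slots :: "nat \<Rightarrow> (nat \<Rightarrow> real ^ 'n \<Rightarrow> real) \<Rightarrow> 'n::finite \<Rightarrow> real ^ 'n \<Rightarrow> real" where
  "hess_slots k u j = (if j \<in> free_slots k then half_norm2 else u (slot_index j))"

lemma k_form_Hess: "k_form k (\<lambda>i. Hess (u i) x) = mixed_disc (\<lambda>j. Hess (hess_slots k u j) x)"
  unfolding k_form_def hess_slots_def
  by (intro arg_cong[where f = mixed_disc]) (auto simp: Hess_half_norm2)

lemma k_convex_k_positive:
  fixes D :: "(real ^ 'n) set"
  assumes "open D" "k_convex k D u" "x \<in> D"
  shows "k_positive k (Hess u x)"
  using assms Hess_symmetric[OF assms(1,3)] C2_closure_Ck(2)
  by (intro k_positive_Gamma_cone) (auto simp: k_convex_def)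

lemma k_convex_nonpos:
  fixes D :: "(real ^ 'n) set"
  assumes D: "open D" "bounded D" and k: "1 \<le> k" and u: "k_convex k D u" and bd: "\<forall>x\<in>frontier D. u x = 0"
    and x: "x \<in> D"
  shows "u x \<le> 0"
proof -
  obtain a :: 'n where True by simp
  show ?thesis
  proof (rule subharmonic_nonpos[OF D _ bd _ x, of a])
    show "C2_closure D u" using u by (simp add: k_convex_def)
    fix y assume "y \<in> D"
    then have "k_positive k (Hess u y)" by (rule k_convex_k_positive[OF D(1) u])
    moreover have "card (- (- {a})) \<le> k" using k by simp
    ultimately have "0 \<le> mixed_disc (\<lambda>r. if r \<in> - {a} then mat 1 else Hess u y)"
      unfolding k_positive_def by blast
    moreover have "(\<lambda>r. if r \<in> - {a} then mat 1 else Hess u y) = (\<lambda>r. if r = a then Hess u y else mat 1)" by auto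
    ultimately show "0 \<le> mixed_disc (\<lambda>r. if r = a then Hess u y else mat 1)" by simp
  qed
qed

lemma hess_slots_nonneg:
  fixes D :: "(real ^ 'n) set" and F :: "'n \<Rightarrow> real ^ 'n ^ 'n"
  assumes k: "k \<le> CARD('n)" and F: "\<And>j. j \<notin> free_slots k \<Longrightarrow> k_positive k (F j)"
    and free: "\<And>j. j \<in> free_slots k \<Longrightarrow> F j = mat 1"
  shows "0 \<le> mixed_disc F"
proof -
  have "0 \<le> mixed_disc (\<lambda>j. if j \<in> free_slots k then mat 1 else F j)"
    using F card_slots[OF k] by (intro mixed_disc_nonneg_k_positive) auto
  also have "(\<lambda>j. if j \<in> free_slots k then mat 1 else F j) = F" using free by auto
  finally show ?thesis .
qed

text \<open>The form in two gradients left after one integration by parts. The function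
  \<open>w s\<close> does not enter, since slot \<open>s\<close> is overwritten.\<close>

definition energy ::
  "(real ^ 'n) set \<Rightarrow> ('n::finite \<Rightarrow> real ^ 'n \<Rightarrow> real) \<Rightarrow> 'n \<Rightarrow> (real ^ 'n \<Rightarrow> real) \<Rightarrow> (real ^ 'n \<Rightarrow> real) \<Rightarrow> real" where
  "energy D w s f g = (LINT x:D|lborel. mixed_disc ((\<lambda>j. Hess (w j) x)(s := outer (grad f x) (grad g x))))"

text \<open>\<open>outer a b\<close> is not symmetric, but transposing every slot leaves the mixed
  discriminant and the Hessians unchanged and exchanges \<open>a\<close> and \<open>b\<close>. The
  form is thus symmetric, and positive semidefinite by \<open>pos\<close>.\<close>

lemma energy_Cauchy_Schwarz:
  fixes D :: "(real ^ 'n) set" and w :: "'n \<Rightarrow> real ^ 'n \<Rightarrow> real"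
  assumes D: "open D" "bounded D" and w: "\<And>j. C2_closure D (w j)" and f: "C2_closure D f" and g: "C2_closure D g"
    and pos: "\<And>x \<xi>. x \<in> D \<Longrightarrow> 0 \<le> mixed_disc ((\<lambda>j. Hess (w j) x)(s := outer \<xi> \<xi>))"
  shows "(energy D w s f g)\<^sup>2 \<le> energy D w s f f * energy D w s g g"
proof -
  define T where "T x a b = mixed_disc ((\<lambda>j. Hess (w j) x)(s := outer a b))" for x a b
  have sym: "T x a b = T x b a" if "x \<in> D" for x a b
  proof -
    have H: "transpose (Hess (w j) x) = Hess (w j) x" for j
      using Hess_symmetric[OF D(1) that C2_closure_Ck(2)[OF w[of j]]] by (simp add: symmetric_matrices_def)
    have "T x b a = mixed_disc (\<lambda>j. transpose (((\<lambda>j. Hess (w j) x)(s := outer b a)) j))"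
      unfolding T_def by (rule mixed_disc_transpose[symmetric])
    also have "(\<lambda>j. transpose (((\<lambda>j. Hess (w j) x)(s := outer b a)) j)) = (\<lambda>j. Hess (w j) x)(s := outer a b)"
      using H by (auto simp: fun_eq_iff transpose_def vec_eq_iff)
    finally show ?thesis unfolding T_def by (rule sym)
  qed
  have quad: "T x (t *\<^sub>R a + b) (t *\<^sub>R a + b) = t\<^sup>2 * T x a a + 2 * t * T x a b + T x b b" if x: "x \<in> D" for x t a b
  proof -
    \<comment> \<open>The nesting into two-term combinations is the shape that
      \<open>mixed_disc_slot_linear\<close> accepts.\<close>
    have "outer (t *\<^sub>R a + b) (t *\<^sub>R a + b) = t *\<^sub>R (t *\<^sub>R outer a a + 2 *\<^sub>R ((1 / 2) *\<^sub>R outer a b + (1 / 2) *\<^sub>R outer b a)) + 1 *\<^sub>R outer b b"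
      by (simp add: vec_eq_iff algebra_simps)
    then show ?thesis
      unfolding T_def by (simp only: mixed_disc_slot_linear) (simp add: sym[OF x, unfolded T_def, of b a] algebra_simps power2_eq_square)
  qed
  have bT: "bcont D (\<lambda>x. T x (grad f x) (grad g x))" if "C2_closure D f" "C2_closure D g" for f g
    unfolding T_def
  proof (intro bcont_mixed_disc)
    fix r i j
    show "bcont D (\<lambda>x. ((\<lambda>j. Hess (w j) x)(s := outer (grad f x) (grad g x))) r $ i $ j)"
      by (cases "r = s") (simp_all add: bcont_mult C2_closure_bcont[OF D(2)] w that)
  qed
  have int: "set_integrable lborel D (\<lambda>x. c * T x (grad f x) (grad g x))" if "C2_closure D f" "C2_closure D g" for f g c
    by (intro bcont_set_integrable D bcont_mult bcont_const bT that)
  have E: "energy D w s f g = (LINT x:D|lborel. T x (grad f x) (grad g x))" for f g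
    by (simp add: energy_def T_def)
  have "0 \<le> energy D w s f f * t\<^sup>2 + 2 * energy D w s f g * t + energy D w s g g" for t
  proof -
    have "0 \<le> (LINT x:D|lborel. t\<^sup>2 * T x (grad f x) (grad f x) + 2 * t * T x (grad f x) (grad g x) + 1 * T x (grad g x) (grad g x))"
      unfolding set_lebesgue_integral_def
    proof (rule Bochner_Integration.integral_nonneg)
      fix x
      show "0 \<le> indicator D x *\<^sub>R (t\<^sup>2 * T x (grad f x) (grad f x) + 2 * t * T x (grad f x) (grad g x) + 1 * T x (grad g x) (grad g x))"
        using pos[of x "t *\<^sub>R grad f x + grad g x", folded T_def] quad[of x t "grad f x" "grad g x"]
        by (cases "x \<in> D") auto
    qed
    also have "\<dots> = t\<^sup>2 * energy D w s f f + 2 * t * energy D w s f g + 1 * energy D w s g g"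
      unfolding E set_integral_mult_right[symmetric]
      using int f g by (simp only: set_integral_add)
    finally show ?thesis by (simp add: mult_ac)
  qed
  moreover have "0 \<le> energy D w s f f"
    unfolding E set_lebesgue_integral_def
    using pos[folded T_def] by (intro Bochner_Integration.integral_nonneg) (simp add: indicator_def)
  ultimately show ?thesis by (intro quadratic_form_discriminant)
qed

theorem theorem3:
  fixes D :: "(real ^ 'n) set"
    and u :: "nat \<Rightarrow> real ^ 'n \<Rightarrow> real"
    and k :: nat
  assumes "k \<le> CARD('n)"
    and "smooth_bounded_domain D"
    and "\<And>j. j \<le> k \<Longrightarrow> k_convex k D (u j)"
    and "\<And>j x. j \<le> k \<Longrightarrow> x \<in> frontier D \<Longrightarrow> u j x = 0"
  shows "G_int k D u \<le> (\<Prod>j=0..k. root (k + 1) (J_int k D (u j)))"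
proof -
  have D: "open D" "bounded D" using assms(2) by (auto simp: smooth_bounded_domain_def)
  define M where "M c = (LINT x:D|lborel. (- u (c 0) x) * k_form k (\<lambda>i. Hess (u (c i)) x))" for c
  have C2: "C2_closure D (u j)" if "j \<le> k" for j using assms(3)[OF that] by (simp add: k_convex_def)
  have S: "S_pol k (\<lambda>i. Hess (u (c i)) x) = k_form k (\<lambda>i. Hess (u (c i)) x)"
    if "x \<in> D" "\<And>i. i \<le> k \<Longrightarrow> c i \<le> k" for x c
    using that C2_closure_Ck(2)[OF C2]
    by (intro S_pol_eq_k_form assms(1) Hess_symmetric[OF D(1)]) auto
  have G: "(LINT x:D|lborel. (- u (c 0) x) * S_pol k (\<lambda>i. Hess (u (c i)) x)) = M c"
    if "\<And>i. i \<le> k \<Longrightarrow> c i \<le> k" for c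
    unfolding M_def using D(1) S that by (intro set_lebesgue_integral_cong) auto
  have Gid: "G_int k D u = M id"
    using G[of id] by (simp add: G_int_def)
  have GJ: "J_int k D (u j) = M (\<lambda>_. j)" if "j \<le> k" for j
    using G[of "\<lambda>_. j"] that by (simp add: J_int_def G_int_def)
  have M_dep: "M c = M c'" if "\<And>i. i \<le> k \<Longrightarrow> c i = c' i" for c c'
  proof -
    have "k_form k (\<lambda>i. Hess (u (c i)) x) = k_form k (\<lambda>i. Hess (u (c' i)) x)" for x
      unfolding k_form_def using that
      by (intro arg_cong[where f = mixed_disc]) (auto simp: free_slots_def fun_eq_iff)
    then show ?thesis using that[of 0] by (simp add: M_def)
  qed
  show ?thesis
  proof (cases "k = 0")
    case True
    \<comment> \<open>For \<open>k = 0\<close> the functions need not have a sign, but the product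
      is the single factor \<open>root 1\<close>, and both sides coincide.\<close>
    have "M id = M (\<lambda>_. 0)" by (rule M_dep) (simp add: True)
    then show ?thesis using Gid GJ[of 0] True by simp
  next
    case False
    then have k: "1 \<le> k" by simp
    have bd: "\<forall>x\<in>frontier D. u j x = 0" if "j \<le> k" for j using assms(4) that by blast
    have neg: "u j x \<le> 0" if "j \<le> k" "x \<in> D" for j x
      using k_convex_nonpos[OF D k assms(3) bd] that by blast
    \<comment> \<open>The slot holding the Hessian of the first argument, where the integration by
      parts takes place.\<close>
    obtain s :: 'n where s: "slot_index s = 1" "s \<notin> free_slots k"
      using slot_of_index[of 1 k, where 'n = 'n] k assms(1) by auto
    define w where "w c = hess_slots k (\<lambda>i. u (c i))" for c
    have wC2: "C2_closure D (w c j)" if "\<And>i. i \<le> k \<Longrightarrow> c i \<le> k" for c j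
      unfolding w_def hess_slots_def using C2 that C2_closure_half_norm2 by (auto simp: free_slots_def)
    have wpos: "k_positive k (Hess (w c j) x)" if "\<And>i. i \<le> k \<Longrightarrow> c i \<le> k" "x \<in> D" "j \<notin> free_slots k" for c j x
      using that k_convex_k_positive[OF D(1) assms(3)] by (simp add: w_def hess_slots_def free_slots_def)
    have wfree: "Hess (w c j) x = mat 1" if "j \<in> free_slots k" for c j x
      using that by (simp add: w_def hess_slots_def Hess_half_norm2)
    have E: "M c = energy D (w c) s (u (c 0)) (u (c 1))" if c: "\<And>i. i \<le> k \<Longrightarrow> c i \<le> k" for c
    proof -
      have ws: "w c s = u (c 1)" using s by (simp add: w_def hess_slots_def)
      have "c 0 \<le> k" using c by simp
      have "M c = (LINT x:D|lborel. (- u (c 0) x) * mixed_disc (\<lambda>j. Hess (w c j) x))"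
        unfolding M_def k_form_Hess w_def ..
      also have "\<dots> = (LINT x:D|lborel. mixed_disc (\<lambda>j. if j = s then outer (grad (u (c 0)) x) (grad (w c s) x) else Hess (w c j) x))"
        using D C2 bd neg wC2 c \<open>c 0 \<le> k\<close> by (intro hessian_by_parts) auto
      finally show ?thesis unfolding energy_def ws fun_upd_def .
    qed
    \<comment> \<open>The entry \<open>c 0\<close> enters no slot, and \<open>c 1\<close> enters
      only the overwritten slot \<open>s\<close>. Hence replacing one of these two entries by the
      other evaluates the same form at equal arguments.\<close>
    have Econg: "energy D (w c) s = energy D (w c') s" if "\<And>i. i \<in> {2..k} \<Longrightarrow> c i = c' i" for c c'
    proof -
      have "w c j = w c' j" if "j \<noteq> s" for j
      proof (cases "j \<in> free_slots k")
        case False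
        have "slot_index j \<noteq> 1" using that s(1) slot_index_eq_iff[of j s] by simp
        then have "slot_index j \<in> {2..k}" using False slot_index_ge_1[of j] by (simp add: free_slots_def)
        then show ?thesis using \<open>\<And>i. i \<in> {2..k} \<Longrightarrow> c i = c' i\<close> by (simp add: w_def hess_slots_def)
      qed (simp add: w_def hess_slots_def)
      then have "(\<lambda>j. Hess (w c j) x)(s := X) = (\<lambda>j. Hess (w c' j) x)(s := X)" for x X
        by (intro ext) simp
      then show ?thesis unfolding energy_def by presburger
    qed
    have "M id \<le> (\<Prod>j=0..k. root (k + 1) (M (\<lambda>_. j)))"
    proof (rule form_le_prod_root[OF k M_dep])
      fix c :: "nat \<Rightarrow> nat" and p assume "\<And>i. i \<le> k \<Longrightarrow> c i \<le> k" and p: "p permutes {1..k}"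
      have "k_form k ((\<lambda>i. Hess (u (c i)) x) \<circ> p) = k_form k (\<lambda>i. Hess (u (c i)) x)" for x
        by (rule k_form_permute[OF assms(1) p])
      moreover have "p 0 = 0" using p by (auto intro: permutes_not_in)
      ultimately show "M (c \<circ> p) = M c" by (simp add: M_def o_def)
    next
      fix c :: "nat \<Rightarrow> nat" assume c: "\<And>i. i \<le> k \<Longrightarrow> c i \<le> k"
      have "0 \<le> (- u (c 0) x) * mixed_disc (\<lambda>j. Hess (w c j) x)" if "x \<in> D" for x
        using neg[of "c 0" x] c that wpos[OF c that] wfree
        by (intro mult_nonneg_nonneg hess_slots_nonneg[OF assms(1)]) auto
      then show "0 \<le> M c"
        unfolding M_def k_form_Hess w_def[symmetric] set_lebesgue_integral_def
        by (intro Bochner_Integration.integral_nonneg) (simp add: indicator_def)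
      let ?c1 = "c(1 := c 0)" and ?c2 = "c(0 := c 1)"
      have c12: "?c1 i \<le> k" "?c2 i \<le> k" if "i \<le> k" for i using c k that by auto
      have "(energy D (w c) s (u (c 0)) (u (c 1)))\<^sup>2 \<le> energy D (w c) s (u (c 0)) (u (c 0)) * energy D (w c) s (u (c 1)) (u (c 1))"
      proof (rule energy_Cauchy_Schwarz[OF D])
        fix x and \<xi> :: "real ^ 'n" assume x: "x \<in> D"
        show "0 \<le> mixed_disc ((\<lambda>j. Hess (w c j) x)(s := outer \<xi> \<xi>))"
        \<comment> \<open>Garding's inequality with a rank-one matrix in slot \<open>s\<close>,
          Hessians of k-convex functions in the other arguments and the identity in the free
          slots.\<close>
        proof (rule hess_slots_nonneg[OF assms(1)])
          fix j :: 'n assume "j \<notin> free_slots k"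
          then show "k_positive k (((\<lambda>j. Hess (w c j) x)(s := outer \<xi> \<xi>)) j)"
            using wpos[OF c x] k_positive_rank_one[of k \<xi>] by (simp add: outer_def)
        qed (use s wfree in auto)
      qed (use wC2 C2 c k in auto)
      also have "energy D (w c) s (u (c 0)) (u (c 0)) = M ?c1"
        using E[of ?c1, OF c12(1)] Econg[of c ?c1] by simp
      also have "energy D (w c) s (u (c 1)) (u (c 1)) = M ?c2"
        using E[of ?c2, OF c12(2)] Econg[of c ?c2] by simp
      also have "energy D (w c) s (u (c 0)) (u (c 1)) = M c" by (rule E[symmetric]) (rule c)
      finally show "(M c)\<^sup>2 \<le> M ?c1 * M ?c2" .
    qed
    also have "\<dots> = (\<Prod>j=0..k. root (k + 1) (J_int k D (u j)))"
      using GJ by (intro prod.cong) auto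
    finally show ?thesis unfolding Gid .
  qed
qed

end
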